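(* The ILP consistency problem for the setting $\mathcal{G}$ is NP-complete.
   Context: Clauses are finite disjunctions of first-order literals, treated as sets of literals (no duplicate literals). A clause $\phi$ $\theta$-subsumes a clause $\psi$, written $\phi \vdash \psi$, if there is a variable substitution $\theta$ with $\phi\theta \subseteq \psi$. For a set $E$ of clauses, $H \vdash E$ means $H \vdash e$ for every $e \in E$, and $H \not\vdash E$ means $H \not\vdash e$ for every $e \in E$. A clause $C$ is guarded if there is a literal $G \in C$ with $\bigcup_{R \in C} \mathrm{vars}(R) \subseteq \mathrm{vars}(G)$. The ILP consistency problem for $\mathcal{G}$: given finite sets $E^+$ and $E^-$ of ground clauses, decide whether there exists a function-free guarded clause $H$ with $H \vdash E^+$, $H \not\vdash E^-$, and $\{H\}$ consistent. *)

theory Defs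
  imports "HOL-Computational_Algebra.Polynomial"
begin

section \<open>Deterministic multitape Turing machines\<close>

datatype direction = MoveLeft | Stay | MoveRight

text \<open>
  A tape is infinite in both directions; it consists of its contents and its head position.
  Symbol 0 is the blank, and symbols 1 and 2 stand for the input bits False and True.
  The states are the numbers below \<open>num_states\<close>, the initial one is 0, and a machine halts
  on reaching \<open>num_states\<close> itself.
\<close>

type_synonym tape = "(int \<Rightarrow> nat) \<times> int"

record machine =
  num_tapes :: nat
  num_symbols :: nat
  num_states :: nat
  transition :: "nat \<Rightarrow> nat list \<Rightarrow> nat \<times> (nat \<times> direction) list"

definition valid_machine :: "machine \<Rightarrow> bool" where
  "valid_machine M \<longleftrightarrow>
     num_tapes M \<ge> 1 \<and> num_symbols M \<ge> 3 \<and>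
     (\<forall>q < num_states M. \<forall>as. length as = num_tapes M \<and> set as \<subseteq> {..<num_symbols M} \<longrightarrow>
        (case transition M q as of (q', acts) \<Rightarrow>
           q' \<le> num_states M \<and> length acts = num_tapes M \<and>
           fst ` set acts \<subseteq> {..<num_symbols M}))"

fun act :: "tape \<Rightarrow> nat \<times> direction \<Rightarrow> tape" where
  "act (c, h) (b, d) =
     (c(h := b), case d of MoveLeft \<Rightarrow> h - 1 | Stay \<Rightarrow> h | MoveRight \<Rightarrow> h + 1)"

fun step :: "machine \<Rightarrow> nat \<times> tape list \<Rightarrow> nat \<times> tape list" where
  "step M (q, ts) =
     (if q < num_states M
      then (case transition M q (map (\<lambda>(c, h). c h) ts) of (q', acts) \<Rightarrow> (q', map2 act ts acts))
      else (q, ts))"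

definition word_contents :: "bool list \<Rightarrow> int \<Rightarrow> nat" where
  "word_contents w i =
     (if 0 \<le> i \<and> i < int (length w) then (if w ! nat i then 2 else 1) else 0)"

definition initial :: "machine \<Rightarrow> bool list \<Rightarrow> nat \<times> tape list" where
  "initial M w = (0, (word_contents w, 0) # replicate (num_tapes M - 1) (\<lambda>_. 0, 0))"

text \<open>Input and output are both on the first tape; the final head positions and the final
  contents of the other tapes are irrelevant.\<close>

definition outputs_within :: "machine \<Rightarrow> bool list \<Rightarrow> bool list \<Rightarrow> nat \<Rightarrow> bool" where
  "outputs_within M w v t \<longleftrightarrow>
     (\<exists>n \<le> t. case (step M ^^ n) (initial M w) of (q, ts) \<Rightarrow>
        q = num_states M \<and> fst (hd ts) = word_contents v)"


section \<open>Polynomial time, NP and NP-completeness\<close>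

type_synonym language = "bool list set"

definition polytime :: "(bool list \<Rightarrow> bool list) \<Rightarrow> bool" where
  "polytime f \<longleftrightarrow>
     (\<exists>M (p :: nat poly). valid_machine M \<and>
        (\<forall>w. outputs_within M w (f w) (poly p (length w))))"

definition in_P :: "language \<Rightarrow> bool" where
  "in_P L \<longleftrightarrow> polytime (\<lambda>w. [w \<in> L])"

text \<open>Self-delimiting list code: True announces a further entry, False ends the list.\<close>

fun enc_list :: "bool list list \<Rightarrow> bool list" where
  "enc_list [] = [False]"
| "enc_list (w # ws) = True # w @ enc_list ws"

definition enc_pair :: "bool list \<Rightarrow> bool list \<Rightarrow> bool list" where
  "enc_pair w u = enc_list (map (\<lambda>b. [b]) w) @ u"

definition in_NP :: "language \<Rightarrow> bool" where
  "in_NP L \<longleftrightarrow>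
     (\<exists>V (p :: nat poly). in_P V \<and>
        (\<forall>w. w \<in> L \<longleftrightarrow> (\<exists>u. length u \<le> poly p (length w) \<and> enc_pair w u \<in> V)))"

definition polytime_reducible :: "language \<Rightarrow> language \<Rightarrow> bool" where
  "polytime_reducible L L' \<longleftrightarrow> (\<exists>f. polytime f \<and> (\<forall>w. w \<in> L \<longleftrightarrow> f w \<in> L'))"

definition NP_hard :: "language \<Rightarrow> bool" where
  "NP_hard L \<longleftrightarrow> (\<forall>L'. in_NP L' \<longrightarrow> polytime_reducible L' L)"

definition NP_complete :: "language \<Rightarrow> bool" where
  "NP_complete L \<longleftrightarrow> in_NP L \<and> NP_hard L"


section \<open>Clauses and subsumption\<close>

text \<open>
  A symbol is identified by its name together with the number of its arguments, so that
  no signature has to be fixed. Constants are function symbols without arguments.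
\<close>

datatype fterm = Var nat | Fun nat "fterm list"

datatype literal = Pos nat "fterm list" | Neg nat "fterm list"

type_synonym clause = "literal set"

primrec args :: "literal \<Rightarrow> fterm list" where
  "args (Pos p ts) = ts"
| "args (Neg p ts) = ts"

fun vars_term :: "fterm \<Rightarrow> nat set" where
  "vars_term (Var x) = {x}"
| "vars_term (Fun f ts) = (\<Union>t \<in> set ts. vars_term t)"

definition vars :: "literal \<Rightarrow> nat set" where
  "vars R = (\<Union>t \<in> set (args R). vars_term t)"

fun subst_term :: "(nat \<Rightarrow> fterm) \<Rightarrow> fterm \<Rightarrow> fterm" where
  "subst_term \<theta> (Var x) = \<theta> x"
| "subst_term \<theta> (Fun f ts) = Fun f (map (subst_term \<theta>) ts)"

primrec subst :: "(nat \<Rightarrow> fterm) \<Rightarrow> literal \<Rightarrow> literal" where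
  "subst \<theta> (Pos p ts) = Pos p (map (subst_term \<theta>) ts)"
| "subst \<theta> (Neg p ts) = Neg p (map (subst_term \<theta>) ts)"

definition subsumes :: "clause \<Rightarrow> clause \<Rightarrow> bool" where
  "subsumes C D \<longleftrightarrow> (\<exists>\<theta>. subst \<theta> ` C \<subseteq> D)"

definition ground :: "clause \<Rightarrow> bool" where
  "ground C \<longleftrightarrow> (\<forall>R \<in> C. vars R = {})"

text \<open>Constants are allowed in function-free clauses.\<close>

definition function_free :: "clause \<Rightarrow> bool" where
  "function_free C \<longleftrightarrow>
     (\<forall>R \<in> C. \<forall>t \<in> set (args R). (\<exists>x. t = Var x) \<or> (\<exists>c. t = Fun c []))"

definition guarded :: "clause \<Rightarrow> bool" where
  "guarded C \<longleftrightarrow> (\<exists>G \<in> C. (\<Union>R \<in> C. vars R) \<subseteq> vars G)"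


section \<open>Consistency\<close>

fun eval_term :: "(nat \<Rightarrow> 'd list \<Rightarrow> 'd) \<Rightarrow> (nat \<Rightarrow> 'd) \<Rightarrow> fterm \<Rightarrow> 'd" where
  "eval_term F v (Var x) = v x"
| "eval_term F v (Fun f ts) = F f (map (eval_term F v) ts)"

primrec holds ::
  "(nat \<Rightarrow> 'd list \<Rightarrow> 'd) \<Rightarrow> (nat \<Rightarrow> 'd list \<Rightarrow> bool) \<Rightarrow> (nat \<Rightarrow> 'd) \<Rightarrow> literal \<Rightarrow> bool" where
  "holds F P v (Pos p ts) \<longleftrightarrow> P p (map (eval_term F v) ts)"
| "holds F P v (Neg p ts) \<longleftrightarrow> \<not> P p (map (eval_term F v) ts)"

definition is_model ::
  "'d set \<Rightarrow> (nat \<Rightarrow> 'd list \<Rightarrow> 'd) \<Rightarrow> (nat \<Rightarrow> 'd list \<Rightarrow> bool) \<Rightarrow> clause set \<Rightarrow> bool" where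
  "is_model D F P S \<longleftrightarrow>
     D \<noteq> {} \<and> (\<forall>f ds. set ds \<subseteq> D \<longrightarrow> F f ds \<in> D) \<and>
     (\<forall>C \<in> S. \<forall>v. range v \<subseteq> D \<longrightarrow> (\<exists>R \<in> C. holds F P v R))"

text \<open>The language is countable, so by the Loewenheim-Skolem theorem it is no restriction to
  consider only models whose domain is a set of natural numbers.\<close>

definition consistent :: "clause set \<Rightarrow> bool" where
  "consistent S \<longleftrightarrow> (\<exists>(D :: nat set) F P. is_model D F P S)"


section \<open>The consistency problem for guarded clauses\<close>

definition ilp_consistent_guarded :: "clause set \<Rightarrow> clause set \<Rightarrow> bool" where
  "ilp_consistent_guarded Epos Eneg \<longleftrightarrow>
     (\<exists>H. finite H \<and> function_free H \<and> guarded H \<and>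
        (\<forall>e \<in> Epos. subsumes H e) \<and> (\<forall>e \<in> Eneg. \<not> subsumes H e) \<and> consistent {H})"

text \<open>Binary notation, least significant bit first.\<close>

fun nat_bits :: "nat \<Rightarrow> bool list" where
  "nat_bits n = (if n = 0 then [] else odd n # nat_bits (n div 2))"

declare nat_bits.simps [simp del]

definition enc_nat :: "nat \<Rightarrow> bool list" where
  "enc_nat n = enc_list (map (\<lambda>b. [b]) (nat_bits n))"

fun enc_term :: "fterm \<Rightarrow> bool list" where
  "enc_term (Var x) = False # enc_nat x"
| "enc_term (Fun f ts) = True # enc_nat f @ enc_list (map enc_term ts)"

primrec enc_literal :: "literal \<Rightarrow> bool list" where
  "enc_literal (Pos p ts) = True # enc_nat p @ enc_list (map enc_term ts)"
| "enc_literal (Neg p ts) = False # enc_nat p @ enc_list (map enc_term ts)"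

definition enc_clauses :: "literal list list \<Rightarrow> bool list" where
  "enc_clauses Cs = enc_list (map (\<lambda>C. enc_list (map enc_literal C)) Cs)"

definition enc_instance :: "literal list list \<Rightarrow> literal list list \<Rightarrow> bool list" where
  "enc_instance Ps Ns = enc_clauses Ps @ enc_clauses Ns"

text \<open>An instance is written down by listing the elements of the two finite sets of
  finite clauses, in any order and possibly with repetitions.\<close>

definition ILP_CONSISTENCY_GUARDED :: language where
  "ILP_CONSISTENCY_GUARDED =
     {enc_instance Ps Ns | Ps Ns.
        (\<forall>C \<in> set Ps \<union> set Ns. ground (set C)) \<and>
        ilp_consistent_guarded (set ` set Ps) (set ` set Ns)}"


text \<open>The code of an instance determines the two lists, hence the instance.\<close>

lemma enc_list_prefix:
  assumes "\<And>x y r s. x \<in> set xs \<Longrightarrow> f x @ r = f y @ s \<Longrightarrow> x = y \<and> r = s"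
    and "enc_list (map f xs) @ r = enc_list (map f ys) @ s"
  shows "xs = ys \<and> r = s"
  using assms
proof (induction xs arbitrary: ys r s)
  case Nil
  then show ?case by (cases ys) auto
next
  case (Cons x xs)
  from Cons.prems(2) obtain y ys' where ys: "ys = y # ys'"
    by (cases ys) auto
  have "f x @ (enc_list (map f xs) @ r) = f y @ (enc_list (map f ys') @ s)"
    using Cons.prems(2) ys by simp
  then have "x = y \<and> enc_list (map f xs) @ r = enc_list (map f ys') @ s"
    by (rule Cons.prems(1)[rotated]) simp
  then have xy: "x = y" and eq: "enc_list (map f xs) @ r = enc_list (map f ys') @ s"
    by simp_all
  have "xs = ys' \<and> r = s"
    by (rule Cons.IH[OF _ eq], rule Cons.prems(1)) auto
  then show ?case using xy ys by simp
qed

lemma nat_bits_inj: "nat_bits m = nat_bits n \<Longrightarrow> m = n"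
proof (induction m arbitrary: n rule: less_induct)
  case (less m)
  have zero: "nat_bits 0 = []" by (simp add: nat_bits.simps)
  have pos: "nat_bits k = odd k # nat_bits (k div 2)" if "k \<noteq> 0" for k
    using that by (subst nat_bits.simps) simp
  show ?case
  proof (cases "m = 0 \<or> n = 0")
    case True
    then show ?thesis using less.prems zero pos by (metis list.distinct(1))
  next
    case False
    then have eq: "odd m = odd n" "nat_bits (m div 2) = nat_bits (n div 2)"
      using less.prems pos[of m] pos[of n] by simp_all
    from False have "m div 2 < m" by simp
    with eq(2) have "m div 2 = n div 2" using less.IH by blast
    then show ?thesis using eq(1) by presburger
  qed
qed

lemma enc_nat_prefix:
  assumes "enc_nat m @ r = enc_nat n @ s"
  shows "m = n \<and> r = s"
proof -
  have "nat_bits m = nat_bits n \<and> r = s"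
    by (rule enc_list_prefix[OF _ assms[unfolded enc_nat_def]]) simp
  then show ?thesis using nat_bits_inj by blast
qed

lemma enc_term_prefix: "enc_term t @ r = enc_term t' @ s \<Longrightarrow> t = t' \<and> r = s"
proof (induction t arbitrary: t' r s)
  case (Var x)
  show ?case
  proof (cases t')
    case [simp]: (Var y)
    have "enc_nat x @ r = enc_nat y @ s" using Var.prems by simp
    from enc_nat_prefix[OF this] show ?thesis by simp
  next
    case (Fun g ts')
    with Var.prems show ?thesis by simp
  qed
next
  case (Fun f ts)
  show ?case
  proof (cases t')
    case (Var y)
    with Fun.prems show ?thesis by simp
  next
    case t': (Fun g ts')
    have "enc_nat f @ (enc_list (map enc_term ts) @ r) =
        enc_nat g @ (enc_list (map enc_term ts') @ s)"
      using Fun.prems t' by simp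
    from enc_nat_prefix[OF this]
    have "f = g" and eq: "enc_list (map enc_term ts) @ r = enc_list (map enc_term ts') @ s"
      by simp_all
    moreover have "ts = ts' \<and> r = s"
      by (rule enc_list_prefix[OF _ eq]) (rule Fun.IH)
    ultimately show ?thesis using t' by simp
  qed
qed

lemma enc_literal_prefix: "enc_literal R @ r = enc_literal R' @ s \<Longrightarrow> R = R' \<and> r = s"
proof -
  assume eq: "enc_literal R @ r = enc_literal R' @ s"
  have "p = p' \<and> ts = ts' \<and> r = s"
    if "enc_nat p @ enc_list (map enc_term ts) @ r = enc_nat p' @ enc_list (map enc_term ts') @ s"
    for p p' ts ts'
  proof -
    from enc_nat_prefix[OF that]
    have "p = p'" and eq': "enc_list (map enc_term ts) @ r = enc_list (map enc_term ts') @ s"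
      by simp_all
    moreover have "ts = ts' \<and> r = s"
      by (rule enc_list_prefix[OF _ eq']) (rule enc_term_prefix)
    ultimately show ?thesis by simp
  qed
  note inj = this
  show ?thesis
  proof (cases R; cases R')
    fix p ts p' ts' assume R: "R = Pos p ts" "R' = Pos p' ts'"
    then show ?thesis using inj[of p ts p' ts'] eq by simp
  next
    fix p ts p' ts' assume R: "R = Neg p ts" "R' = Neg p' ts'"
    then show ?thesis using inj[of p ts p' ts'] eq by simp
  qed (use eq in simp_all)
qed

lemma enc_instance_inj:
  assumes "enc_instance Ps Ns = enc_instance Ps' Ns'"
  shows "Ps = Ps' \<and> Ns = Ns'"
proof -
  have C: "C = C' \<and> r = s"
    if "enc_list (map enc_literal C) @ r = enc_list (map enc_literal C') @ s" for C C' r s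
    by (rule enc_list_prefix[OF _ that]) (rule enc_literal_prefix)
  have Cs: "Cs = Cs' \<and> r = s" if "enc_clauses Cs @ r = enc_clauses Cs' @ s" for Cs Cs' r s
    by (rule enc_list_prefix[OF _ that[unfolded enc_clauses_def]]) (rule C)
  have eq: "enc_clauses Ps @ enc_clauses Ns = enc_clauses Ps' @ enc_clauses Ns'"
    using assms unfolding enc_instance_def .
  have "enc_clauses Ns @ [] = enc_clauses Ns' @ []" by (simp only: conjunct2[OF Cs[OF eq]])
  from conjunct1[OF Cs[OF eq]] conjunct1[OF Cs[OF this]] show ?thesis ..
qed

end

theory Submission
  imports Defs "HOL-Library.Countable"
begin

text \<open>
  Membership in NP: a non-empty clause is always consistent, and in a guarded hypothesis the image of
  the guard determines the whole substitution. A solution can therefore be thinned out to the guard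
  and, for each literal of a negative example that the guard could be mapped to, one literal that then
  fails. After renaming the variables to argument positions of the guard, subsumption of an example is
  tested by trying its literals as images of the guard.

  Hardness: the positive examples can force the guard to be \<open>P(x\<^sub>1, \<dots>, x\<^sub>N)\<close> and offer, in the
  \<open>i\<close>-th of them, a choice among finitely many values of \<open>x\<^sub>i\<close>; a single negative example then excludes
  any given list of partial assignments. So hypotheses solve constraint satisfaction problems over a
  finite alphabet, and the tableau of a polynomially bounded computation is one.

  Both parts need polynomial-time functions on concrete Turing machines. Structured programs are
  compiled to machines whose states are the remaining programs. They operate on a tape used as a
  stack of binary trees in prefix notation, on which pairing, projections, composition, case
  distinction and bounded iteration are easily implemented; every other function is obtained from
  these closure properties.
\<close>


section \<open>Structured programs on five tapes\<close>

text \<open>The size of numbers shapes the membership proof. Numbers computed with are unary, but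
  instances name their symbols in binary, so a name may be exponential in the length of its code.
  Names are therefore never turned into numbers: they stay bit lists, and literals are compared
  through their encodings. A certificate must also be short. The thinning out bounds the number of
  literals of a hypothesis but not their names and arities; these are bounded because every literal
  has an instance in any positive example. Without positive examples this bound is missing, but then
  a solution always exists. In the hardness proof the verifier is an arbitrary machine and enters
  only through its tableau. Its alphabet depends on the machine alone, so all tables derived from
  the transition function are constants of the reduction; what remains to be computed is where in
  the tableau they are repeated.\<close>

datatype com =
    Skip
  | Act "nat list \<Rightarrow> (nat \<times> direction) list"
  | Seq com com (infixr \<open>;;\<close> 60)
  | Cond "nat list \<Rightarrow> bool" com com
  | Loop "nat list \<Rightarrow> bool" com

definition idle :: "nat list \<Rightarrow> (nat \<times> direction) list" where
  "idle = map (\<lambda>a. (a, Stay))"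

definition reads :: "tape list \<Rightarrow> nat list" where
  "reads = map (\<lambda>(c, h). c h)"

text \<open>The times are exactly those of \<open>cstep\<close>: taking a constructor apart costs
  one step of its own, in which the tapes stay as they are.\<close>

inductive exec :: "com \<Rightarrow> tape list \<Rightarrow> tape list \<Rightarrow> nat \<Rightarrow> bool" where
  Skip: "exec Skip s s 1"
| Act: "exec (Act f) s (map2 act s (f (reads s))) 1"
| Seq: "exec a s t m \<Longrightarrow> exec b t u n \<Longrightarrow> exec (a ;; b) s u (Suc (m + n))"
| CondT: "p (reads s) \<Longrightarrow> exec a s t m \<Longrightarrow> exec (Cond p a b) s t (Suc m)"
| CondF: "\<not> p (reads s) \<Longrightarrow> exec b s t m \<Longrightarrow> exec (Cond p a b) s t (Suc m)"
| LoopT: "p (reads s) \<Longrightarrow> exec a s t m \<Longrightarrow> exec (Loop p a) t u n \<Longrightarrow> exec (Loop p a) s u (Suc (m + n))"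
| LoopF: "\<not> p (reads s) \<Longrightarrow> exec (Loop p a) s s 1"

text \<open>The control state of the compiled machine is the list of programs still to be executed.\<close>

fun advance :: "com list \<Rightarrow> nat list \<Rightarrow> com list \<times> (nat \<times> direction) list" where
  "advance [] as = ([], idle as)"
| "advance (Skip # k) as = (k, idle as)"
| "advance (Act f # k) as = (k, f as)"
| "advance (Seq a b # k) as = (a # b # k, idle as)"
| "advance (Cond p a b # k) as = ((if p as then a else b) # k, idle as)"
| "advance (Loop p a # k) as = (if p as then a # Loop p a # k else k, idle as)"

definition cstep :: "com list \<times> tape list \<Rightarrow> com list \<times> tape list" where
  "cstep = (\<lambda>(k, ts). let (k', x) = advance k (reads ts) in (k', map2 act ts x))"

lemma act_idle [simp]: "map2 act ts (idle (reads ts)) = ts"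
  by (induction ts) (auto simp: idle_def reads_def)

lemma exec_cstep: "exec c s t n \<Longrightarrow> (cstep ^^ n) (c # k, s) = (k, t)"
proof (induction arbitrary: k rule: exec.induct)
  case (Seq a s t m b u n)
  then show ?case
    by (simp only: funpow_Suc_right funpow_add add.commute[of m n]) (simp add: cstep_def)
next
  case (LoopT p s a t m u n)
  then show ?case
    by (simp only: funpow_Suc_right funpow_add add.commute[of m n]) (simp add: cstep_def)
qed (simp_all only: funpow_Suc_right One_nat_def, simp_all add: cstep_def)

text \<open>A finite set containing \<open>[c]\<close> and closed under \<open>advance\<close>, so
  that the control lists can serve as machine states. The entries \<open>l @ [b]\<close> and
  \<open>l @ [Loop p a]\<close> describe the part \<open>a\<close> under way with the rest still
  waiting.\<close>

primrec points :: "com \<Rightarrow> com list set" where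
  "points Skip = {[Skip], []}"
| "points (Act f) = {[Act f], []}"
| "points (Seq a b) = {[Seq a b]} \<union> (\<lambda>l. l @ [b]) ` points a \<union> points b"
| "points (Cond p a b) = {[Cond p a b]} \<union> points a \<union> points b"
| "points (Loop p a) = {[Loop p a], []} \<union> (\<lambda>l. l @ [Loop p a]) ` points a"

primrec wf_com :: "com \<Rightarrow> bool" where
  "wf_com Skip \<longleftrightarrow> True"
| "wf_com (Act f) \<longleftrightarrow> (\<forall>as. length as = 5 \<and> set as \<subseteq> {..<3} \<longrightarrow>
     length (f as) = 5 \<and> fst ` set (f as) \<subseteq> {..<3})"
| "wf_com (Seq a b) \<longleftrightarrow> wf_com a \<and> wf_com b"
| "wf_com (Cond p a b) \<longleftrightarrow> wf_com a \<and> wf_com b"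
| "wf_com (Loop p a) \<longleftrightarrow> wf_com a"

lemma finite_points: "finite (points c)"
  by (induction c) auto

lemma points_self: "[c] \<in> points c" and points_Nil: "[] \<in> points c"
  by (induction c) auto

lemma advance_append: "l \<noteq> [] \<Longrightarrow> advance (l @ k) as = (let (l', x) = advance l as in (l' @ k, x))"
  by (cases "(l, as)" rule: advance.cases) auto

text \<open>Since \<open>advance\<close> inspects only the head of the list, a step inside a part
  carries over to the whole. The separate case is a part that is used up: \<open>[] @ [b]\<close> is
  a control point of \<open>b\<close>, and \<open>[] @ [Loop p a]\<close> is the loop about to be
  tested again.\<close>

lemma points_closed: "l \<in> points c \<Longrightarrow> fst (advance l as) \<in> points c"
proof (induction c arbitrary: l)
  case (Seq a b)
  then consider "l = [Seq a b]" | l' where "l' \<in> points a" "l = l' @ [b]" | "l \<in> points b" by auto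
  then show ?case
  proof cases
    case 1
    then show ?thesis using points_self[of a] by (auto intro!: image_eqI[of _ _ "[a]"])
  next
    case 2
    show ?thesis
    proof (cases "l' = []")
      case True
      then show ?thesis using 2 Seq.IH(2) points_self[of b] by simp
    next
      case False
      then show ?thesis using 2 Seq.IH(1)[of l']
        by (auto simp: advance_append split: prod.splits)
    qed
  next
    case 3
    then show ?thesis using Seq.IH by simp
  qed
next
  case (Loop p a)
  then consider "l = [Loop p a]" | "l = []" | l' where "l' \<in> points a" "l = l' @ [Loop p a]" by auto
  then show ?case
  proof cases
    case 1
    then show ?thesis using points_self[of a] by (auto intro!: image_eqI[of _ _ "[a]"])
  next
    case 2
    then show ?thesis by simp
  next
    case 3
    show ?thesis
    proof (cases "l' = []")
      case True
      then show ?thesis using 3 points_self[of a] by (auto intro!: image_eqI[of _ _ "[a]"])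
    next
      case False
      then show ?thesis using 3 Loop.IH[of l']
        by (auto simp: advance_append split: prod.splits)
    qed
  qed
next
  case (Cond p a b)
  then show ?case using points_self[of a] points_self[of b] by auto
qed auto

lemma points_wf_com: "l \<in> points c \<Longrightarrow> wf_com c \<Longrightarrow> d \<in> set l \<Longrightarrow> wf_com d"
  by (induction c arbitrary: l) (auto simp del: wf_com.simps(2))

lemma points_wf:
  assumes "wf_com c" "l \<in> points c" "length as = 5" "set as \<subseteq> {..<3}"
  shows "length (snd (advance l as)) = 5 \<and> fst ` set (snd (advance l as)) \<subseteq> {..<3}"
proof -
  have idle: "length (idle as) = 5 \<and> fst ` set (idle as) \<subseteq> {..<3}"
    using assms(3,4) by (auto simp: idle_def)
  have wf: "\<forall>d \<in> set l. wf_com d" using points_wf_com[OF assms(2,1)] by blast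
  show ?thesis
  proof (cases "\<exists>f k. l = Act f # k")
    case True
    then obtain f k where "l = Act f # k" by blast
    then show ?thesis using wf assms(3,4) by simp
  next
    case False
    then have "snd (advance l as) = idle as" by (induction l as rule: advance.induct) simp_all
    then show ?thesis using idle by simp
  qed
qed

lemma compile:
  assumes "wf_com c"
  obtains M where "valid_machine M"
    "\<And>w t n. exec c ((word_contents w, 0) # replicate 4 (\<lambda>_. 0, 0)) t n \<Longrightarrow>
       (step M ^^ n) (initial M w) = (num_states M, t)"
proof -
  obtain ys where ys: "set ys = points c - {[], [c]}" "distinct ys"
    using finite_distinct_list[of "points c - {[], [c]}"] finite_points by auto
  \<comment> \<open>A machine starts in state 0 and halts on reaching \<open>num_states\<close>.
    Hence \<open>[c]\<close> comes first and the empty list last, just behind the proper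
    states.\<close>
  define xs where "xs = [c] # ys"
  define zs where "zs = xs @ [[]]"
  define ix where "ix k = (LEAST i. zs ! i = k)" for k
  define M where "M = \<lparr>num_tapes = 5, num_symbols = 3, num_states = length xs,
    transition = (\<lambda>q as. let (k, x) = advance (zs ! q) as in (ix k, x))\<rparr>"
  have set_zs: "set zs = points c" using ys points_self[of c] points_Nil[of c]
    by (auto simp: xs_def zs_def)
  have ix: "zs ! ix k = k \<and> ix k \<le> length xs" if k: "k \<in> points c" for k
  proof -
    obtain i where i: "i < length zs" "zs ! i = k" using k set_zs by (metis in_set_conv_nth)
    then have "zs ! ix k = k" unfolding ix_def by (metis (mono_tags) LeastI)
    moreover have "ix k \<le> i" unfolding ix_def using i by (simp add: Least_le)
    ultimately show ?thesis using i by (simp add: zs_def)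
  qed
  have ix0: "ix [c] = 0" unfolding ix_def by (rule Least_eq_0) (simp add: zs_def xs_def)
  have ixNil: "ix k = length xs \<longleftrightarrow> k = []" if "k \<in> points c" for k
  proof
    show "k = []" if "ix k = length xs" using ix[OF \<open>k \<in> points c\<close>] that by (auto simp: zs_def)
    assume "k = []"
    have "[] \<notin> set xs" using ys by (auto simp: xs_def)
    moreover have "xs ! ix [] = []" if "ix [] < length xs"
      using ix[OF points_Nil] that by (simp add: zs_def nth_append)
    ultimately have "\<not> ix [] < length xs" by (metis nth_mem)
    then show "ix k = length xs" using ix[OF points_Nil] \<open>k = []\<close> by fastforce
  qed
  have pt: "zs ! q \<in> points c" if "q \<le> length xs" for q
    using that set_zs nth_mem[of q zs] by (simp add: zs_def)
  have valid: "valid_machine M"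
    unfolding valid_machine_def
  proof (intro conjI allI impI)
    fix q as assume q: "q < num_states M" and as: "length as = num_tapes M \<and> set as \<subseteq> {..<num_symbols M}"
    have "zs ! q \<in> points c" using pt q by (simp add: M_def)
    with points_wf[OF assms this, of as] points_closed[OF this, of as] as ix
    show "case transition M q as of (q', acts) \<Rightarrow> q' \<le> num_states M \<and>
        length acts = num_tapes M \<and> fst ` set acts \<subseteq> {..<num_symbols M}"
      by (simp add: M_def split_beta)
  qed (simp_all add: M_def)
  have sim: "step M (ix k, ts) = (\<lambda>(k, ts). (ix k, ts)) (cstep (k, ts))" if "k \<in> points c" for k ts
  proof (cases "k = []")
    case True
    then show ?thesis using ixNil[OF that] by (simp add: M_def cstep_def)
  next
    case False
    then have "ix k < length xs" using ixNil[OF that] ix[OF that] by simp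
    then show ?thesis using ix[OF that]
      by (auto simp: M_def cstep_def reads_def split: prod.splits)
  qed
  have sims: "fst ((cstep ^^ n) (k, ts)) \<in> points c \<and>
      (step M ^^ n) (ix k, ts) = (\<lambda>(k, ts). (ix k, ts)) ((cstep ^^ n) (k, ts))"
    if "k \<in> points c" for k ts n
  proof (induction n)
    case (Suc n)
    obtain l us where l: "(cstep ^^ n) (k, ts) = (l, us)" by (meson surj_pair)
    then have "fst (cstep (l, us)) \<in> points c" using Suc points_closed[of l c]
      by (simp add: cstep_def split: prod.splits) (metis fst_conv)
    then show ?case using Suc l sim[of l us] by simp
  qed (use that in simp)
  have "(step M ^^ n) (initial M w) = (num_states M, t)"
    if "exec c ((word_contents w, 0) # replicate 4 (\<lambda>_. 0, 0)) t n" for w t n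
  proof -
    have "initial M w = (ix [c], (word_contents w, 0) # replicate 4 (\<lambda>_. 0, 0))"
      by (simp add: initial_def ix0 M_def)
    then show ?thesis
      using sims[OF points_self] exec_cstep[OF that, of "[]"] ixNil[OF points_Nil]
      by (simp add: M_def)
  qed
  with valid show ?thesis using that by blast
qed

section \<open>Execution within a time bound\<close>

definition runs :: "com \<Rightarrow> tape list \<Rightarrow> tape list \<Rightarrow> nat \<Rightarrow> bool" where
  "runs c s t n \<longleftrightarrow> (\<exists>m \<le> n. exec c s t m)"

lemma runs_mono: "runs c s t m \<Longrightarrow> m \<le> n \<Longrightarrow> runs c s t n"
  unfolding runs_def using order_trans by blast

lemma runs_Skip: "runs Skip s s 1"
  unfolding runs_def using exec.Skip by blast

lemma runs_Seq:
  assumes "runs a s t m" "runs b t u n"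
  shows "runs (a ;; b) s u (Suc (m + n))"
proof -
  obtain i j where "i \<le> m" "exec a s t i" "j \<le> n" "exec b t u j"
    using assms unfolding runs_def by blast
  then have "exec (a ;; b) s u (Suc (i + j))" "Suc (i + j) \<le> Suc (m + n)"
    by (auto intro: exec.Seq)
  then show ?thesis unfolding runs_def by blast
qed

lemma runs_CondT: "p (reads s) \<Longrightarrow> runs a s t m \<Longrightarrow> runs (Cond p a b) s t (Suc m)"
  unfolding runs_def using exec.CondT by (metis Suc_le_mono)

lemma runs_CondF: "\<not> p (reads s) \<Longrightarrow> runs b s t m \<Longrightarrow> runs (Cond p a b) s t (Suc m)"
  unfolding runs_def using exec.CondF by (metis Suc_le_mono)

lemma runs_LoopT:
  assumes "p (reads s)" "runs a s t m" "runs (Loop p a) t u n"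
  shows "runs (Loop p a) s u (Suc (m + n))"
proof -
  obtain i j where "i \<le> m" "exec a s t i" "j \<le> n" "exec (Loop p a) t u j"
    using assms unfolding runs_def by blast
  then have "exec (Loop p a) s u (Suc (i + j))" "Suc (i + j) \<le> Suc (m + n)"
    using assms(1) by (auto intro: exec.LoopT)
  then show ?thesis unfolding runs_def by blast
qed

lemma runs_LoopF: "\<not> p (reads s) \<Longrightarrow> runs (Loop p a) s s 1"
  unfolding runs_def using exec.LoopF by blast


section \<open>Stacks of bits\<close>

definition bit_symbol :: "bool \<Rightarrow> nat" where
  "bit_symbol b = (if b then 2 else 1)"

lemma bit_simps [simp]: "bit_symbol b = 2 \<longleftrightarrow> b" "bit_symbol b \<noteq> 0" "0 < bit_symbol b" "bit_symbol b < 3"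
    "bit_symbol b \<le> 2" "bit_symbol True = 2" "bit_symbol False = 1"
  by (auto simp: bit_symbol_def)

text \<open>The parameter \<open>e\<close> is the position behind the bottom of the stack. Pushing and popping
  leave it unchanged, so that no head positions need to be tracked.\<close>

definition stk :: "int \<Rightarrow> bool list \<Rightarrow> tape" where
  "stk e s = (\<lambda>z. if e - int (length s) \<le> z \<and> z < e then bit_symbol (s ! nat (z - (e - int (length s))))
      else 0,
     e - int (length s))"

definition top_symbol :: "bool list \<Rightarrow> nat" where
  "top_symbol s = (case s of [] \<Rightarrow> 0 | b # _ \<Rightarrow> bit_symbol b)"

lemma top_simps [simp]: "top_symbol [] = 0" "top_symbol (b # s) = bit_symbol b"
  by (simp_all add: top_symbol_def)

lemma stk_top [simp]: "fst (stk e s) (snd (stk e s)) = top_symbol s"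
  by (simp add: stk_def top_symbol_def split: list.split)

lemma length_reads [simp]: "length (reads ts) = length ts"
  by (simp add: reads_def)

lemma nth_reads: "k < length ts \<Longrightarrow> reads ts ! k = fst (ts ! k) (snd (ts ! k))"
  by (simp add: reads_def split: prod.splits)

definition on :: "nat \<Rightarrow> (nat \<Rightarrow> nat \<times> direction) \<Rightarrow> com" where
  "on k f = Act (\<lambda>as. (idle as)[k := f (as ! k)])"

text \<open>A machine step writes before the head moves, so a push takes two actions and a pop only
  one. A pop writes a blank because \<open>stk\<close> prescribes blanks outside the stack.\<close>

definition push :: "nat \<Rightarrow> bool \<Rightarrow> com" where
  "push k b = on k (\<lambda>a. (a, MoveLeft)) ;; on k (\<lambda>_. (bit_symbol b, Stay))"

definition pop :: "nat \<Rightarrow> com" where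
  "pop k = on k (\<lambda>_. (0, MoveRight))"

lemma wf_on: "(\<And>a. a < 3 \<Longrightarrow> fst (f a) < 3) \<Longrightarrow> k < 5 \<Longrightarrow> wf_com (on k f)"
proof -
  assume f: "\<And>a. a < 3 \<Longrightarrow> fst (f a) < 3" and k: "k < 5"
  have "fst y < 3" if as: "length as = 5" "set as \<subseteq> {..<3}" and y: "y \<in> set ((idle as)[k := f (as ! k)])"
      for as y
  proof -
    from y have "y = f (as ! k) \<or> y \<in> set (idle as)"
      using set_update_subset_insert[of "idle as" k "f (as ! k)"] by blast
    moreover have "as ! k < 3" using as k nth_mem[of k as] by (simp add: subset_iff)
    ultimately show ?thesis using f as by (auto simp: idle_def)
  qed
  then show "wf_com (on k f)" by (auto simp: on_def idle_def)
qed

lemma wf_push [simp]: "k < 5 \<Longrightarrow> wf_com (push k b)"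
  by (simp add: push_def wf_on)

lemma wf_pop [simp]: "k < 5 \<Longrightarrow> wf_com (pop k)"
  by (simp add: pop_def wf_on)

lemma runs_on:
  assumes "k < length ts"
  shows "runs (on k f) ts (ts[k := act (ts ! k) (f (reads ts ! k))]) 1"
proof -
  have "map2 act ts ((idle (reads ts))[k := f (reads ts ! k)]) = ts[k := act (ts ! k) (f (reads ts ! k))]"
  proof (rule nth_equalityI)
    fix i assume "i < length (map2 act ts ((idle (reads ts))[k := f (reads ts ! k)]))"
    then have i: "i < length ts" by simp
    then have "act (ts ! i) (reads ts ! i, Stay) = ts ! i"
      by (cases "ts ! i") (simp add: nth_reads)
    with i show "map2 act ts ((idle (reads ts))[k := f (reads ts ! k)]) ! i =
        ts[k := act (ts ! k) (f (reads ts ! k))] ! i"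
      by (cases "i = k") (simp_all add: idle_def)
  qed (simp add: idle_def)
  then show ?thesis using exec.Act[of "\<lambda>as. (idle as)[k := f (as ! k)]" ts]
    unfolding runs_def on_def by auto
qed

lemma runs_push:
  assumes "k < length ts" "ts ! k = stk e s"
  shows "runs (push k b) ts (ts[k := stk e (b # s)]) 3"
proof -
  have eq: "act (act (stk e s) (fst (stk e s) (snd (stk e s)), MoveLeft)) (bit_symbol b, Stay) = stk e
      (b # s)"
    by (auto simp: stk_def fun_eq_iff nth_Cons' nat_diff_distrib intro!: arg_cong[where f = "\<lambda>i. bit_symbol
        (s ! i)"])
  define us where "us = ts[k := act (ts ! k) (reads ts ! k, MoveLeft)]"
  have "runs (on k (\<lambda>a. (a, MoveLeft))) ts us 1"
    using runs_on[OF assms(1), of "\<lambda>a. (a, MoveLeft)"] by (simp add: us_def)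
  moreover have "runs (on k (\<lambda>_. (bit_symbol b, Stay))) us (ts[k := stk e (b # s)]) 1"
    using runs_on[of k us "\<lambda>_. (bit_symbol b, Stay)"] assms eq
    by (simp add: us_def nth_reads)
  ultimately show ?thesis unfolding push_def
    using runs_Seq[THEN runs_mono, of _ ts us 1 _ "ts[k := stk e (b # s)]" 1 3] by simp
qed

lemma runs_pop:
  assumes "k < length ts" "ts ! k = stk e (b # s)"
  shows "runs (pop k) ts (ts[k := stk e s]) 1"
proof -
  have "act (stk e (b # s)) (0, MoveRight) = stk e s"
    by (auto simp: stk_def fun_eq_iff nth_Cons' nat_diff_distrib intro!: arg_cong[where f = "\<lambda>i. bit_symbol
        (s ! i)"])
  then show ?thesis using runs_on[OF assms(1), of "\<lambda>_. (0, MoveRight)"] assms(2)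
    by (simp add: pop_def)
qed


section \<open>Trees on a stack\<close>

datatype tree = Leaf | Node tree tree

text \<open>Prefix notation is self-delimiting: a program finds the end of the topmost tree without
  knowing what lies below it. Moreover the first bit alone tells a leaf from a node, hence the empty
  list from a non-empty one.\<close>

primrec code :: "tree \<Rightarrow> bool list" where
  "code Leaf = [False]"
| "code (Node a b) = True # code a @ code b"

definition filled :: "nat \<Rightarrow> nat list \<Rightarrow> bool" where
  "filled i as \<longleftrightarrow> as ! i \<noteq> 0"

definition is_True :: "nat \<Rightarrow> nat list \<Rightarrow> bool" where
  "is_True i as \<longleftrightarrow> as ! i = 2"

lemma runs_push':
  "k < length ts \<Longrightarrow> ts ! k = stk e s \<Longrightarrow> ts[k := stk e (b # s)] = us \<Longrightarrow> runs (push k b) ts us 3"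
  using runs_push by blast

lemma runs_pop':
  "k < length ts \<Longrightarrow> ts ! k = stk e (b # s) \<Longrightarrow> ts[k := stk e s] = us \<Longrightarrow> runs (pop k) ts us 1"
  using runs_pop by blast

lemma runs_Seq': "runs a s t m \<Longrightarrow> runs b t u n \<Longrightarrow> Suc (m + n) \<le> k \<Longrightarrow> runs (a ;; b) s u k"
  using runs_Seq runs_mono by blast

lemma filled_reads [simp]: "i < length ts \<Longrightarrow> filled i (reads ts) \<longleftrightarrow> fst (ts ! i) (snd (ts ! i)) \<noteq> 0"
  by (simp add: filled_def nth_reads)

lemma is_True_reads [simp]: "i < length ts \<Longrightarrow> is_True i (reads ts) \<longleftrightarrow> fst (ts ! i) (snd (ts ! i)) = 2"
  by (simp add: is_True_def nth_reads)

lemma runs_Cond_bit: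
  assumes "runs (f b) s t m" "is_True i (reads s) = b" "Suc m \<le> n"
  shows "runs (Cond (is_True i) (f True) (f False)) s t n"
proof (cases b)
  case True
  then show ?thesis using assms runs_CondT[of "is_True i" s "f True" t m "f False"] runs_mono by simp
next
  case False
  then show ?thesis using assms runs_CondF[of "is_True i" s "f False" t m "f True"] runs_mono by simp
qed

lemma runs_Loop_filled:
  assumes "filled i (reads s)" "runs a s t m" "runs (Loop (filled i) a) t u n" "Suc (m + n) \<le> k"
  shows "runs (Loop (filled i) a) s u k"
  using runs_LoopT[of "filled i", OF assms(1-3)] assms(4) runs_mono by blast

text \<open>\<open>P s u\<close> is the layout of the tapes with \<open>s\<close> still to be read
  and \<open>u\<close> collected so far. The loops that transfer, copy, erase or convert a word bit
  by bit are all instances, differing only in \<open>P\<close>.\<close>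

lemma drain:
  assumes body: "\<And>b s u. runs body (P (b # s) u) (P s (b # u)) K"
    and top_symbol: "\<And>s u. filled i (reads (P s u)) \<longleftrightarrow> s \<noteq> []"
  shows "runs (Loop (filled i) body) (P s u) (P [] (rev s @ u)) (Suc (Suc K * length s))"
proof (induction s arbitrary: u)
  case Nil
  show ?case using runs_LoopF[of "filled i" "P [] u"] top_symbol by simp
next
  case (Cons b s)
  show ?case
    by (rule runs_Loop_filled[OF _ body]) (use Cons.IH[of "b # u"] top_symbol in simp)+
qed

lemma top_eq_0 [simp]: "top_symbol s = 0 \<longleftrightarrow> s = []" "0 < top_symbol s \<longleftrightarrow> s \<noteq> []"
  by (cases s; simp)+

text \<open>\<open>mv j\<close> moves the topmost tree of the main stack 1, reversed, to stack \<open>j\<close>; stack 4 counts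
  the subtrees still to be read.\<close>

definition mv_body :: "nat \<Rightarrow> com" where
  "mv_body j = Cond (is_True 1) (push j True ;; pop 1 ;; push 4 True) (push j False ;; pop 1 ;; pop 4)"

definition mv :: "nat \<Rightarrow> com" where
  "mv j = push 4 True ;; Loop (filled 4) (mv_body j)"

lemma mv_body_runs:
  assumes "j = 2 \<or> j = 3"
  shows "runs (mv_body j) ([x, stk 0 (b # r), y, z, stk 0 (True # d)][j := stk 0 s])
    ([x, stk 0 r, y, z, stk 0 (if b then True # True # d else d)][j := stk 0 (b # s)]) 10"
proof -
  have top_symbol: "is_True 1 (reads ([x, stk 0 (b # r), y, z, stk 0 (True # d)][j := stk 0 s])) \<longleftrightarrow> b"
    using assms by auto
  show ?thesis
  proof (cases b)
    case True
    have "runs (push j True ;; pop 1 ;; push 4 True) ([x, stk 0 (b # r), y, z, stk 0 (True # d)][j := stk 0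
        s])
      ([x, stk 0 r, y, z, stk 0 (True # True # d)][j := stk 0 (b # s)]) 9"
      using assms True by (elim disjE)
          (simp?, rule runs_Seq'[OF runs_push' runs_Seq[OF runs_pop' runs_push']], simp+)+
    from runs_CondT[of "is_True 1", OF _ this] True top_symbol show ?thesis unfolding mv_body_def
      by (auto intro: runs_mono)
  next
    case False
    have "runs (push j False ;; pop 1 ;; pop 4) ([x, stk 0 (b # r), y, z, stk 0 (True # d)][j := stk 0 s])
      ([x, stk 0 r, y, z, stk 0 d][j := stk 0 (b # s)]) 9"
      using assms False by (elim disjE)
          (simp?, rule runs_Seq'[OF runs_push' runs_Seq[OF runs_pop' runs_pop']], simp+)+
    from runs_CondF[of "is_True 1", OF _ this] False top_symbol show ?thesis unfolding mv_body_def
      by (auto intro: runs_mono)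
  qed
qed

text \<open>Stated for an arbitrary continuation of the loop: reading a tree uses up one mark on
  stack 4, not necessarily the last one. A node bit replaces its mark by two, and the two subtrees
  are then read one after the other by the same loop. Each bit costs 10 steps for the body and one
  for the test.\<close>

lemma mv_loop:
  assumes j: "j = 2 \<or> j = 3"
    and "runs (Loop (filled 4) (mv_body j)) ([x, stk 0 r, y, z, stk 0 d][j := stk 0 (rev (code t) @ s)]) u
        n"
  shows "runs (Loop (filled 4) (mv_body j))
    ([x, stk 0 (code t @ r), y, z, stk 0 (True # d)][j := stk 0 s]) u (n + 11 * length (code t))"
  using assms(2)
proof (induction t arbitrary: r s d n)
  case Leaf
  have "filled 4 (reads ([x, stk 0 (False # r), y, z, stk 0 (True # d)][j := stk 0 s]))"
    using j by auto
  have "runs (Loop (filled 4) (mv_body j)) ([x, stk 0 (False # r), y, z, stk 0 (True # d)][j := stk 0 s]) u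
      (Suc (10 + n))"
    by (rule runs_Loop_filled[OF \<open>filled 4 _\<close> mv_body_runs[OF j]]) (use Leaf in simp)+
  then show ?case by (auto intro: runs_mono)
next
  case (Node a b)
  have "filled 4 (reads ([x, stk 0 (True # code a @ code b @ r), y, z, stk 0 (True # d)][j := stk 0 s]))"
    using j by auto
  moreover have "runs (Loop (filled 4) (mv_body j))
      ([x, stk 0 (code b @ r), y, z, stk 0 (True # d)][j := stk 0 (rev (code a) @ True # s)]) u
      (n + 11 * length (code b))"
    using Node.IH(2)[of r d "rev (code a) @ True # s"] Node.prems by simp
  note rest = Node.IH(1)[OF this]
  have "runs (Loop (filled 4) (mv_body j))
      ([x, stk 0 (True # code a @ code b @ r), y, z, stk 0 (True # d)][j := stk 0 s]) u
      (Suc (10 + (n + 11 * length (code b) + 11 * length (code a))))"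
    by (rule runs_Loop_filled[OF calculation mv_body_runs[OF j]]) (use rest in simp)+
  then show ?case by (auto intro: runs_mono)
qed

lemma mv_runs:
  assumes j: "j = 2 \<or> j = 3"
  shows "runs (mv j) ([x, stk 0 (code t @ r), y, z, stk 0 []][j := stk 0 s])
    ([x, stk 0 r, y, z, stk 0 []][j := stk 0 (rev (code t) @ s)]) (5 + 11 * length (code t))"
proof -
  have 1: "runs (push 4 True) ([x, stk 0 (code t @ r), y, z, stk 0 []][j := stk 0 s])
     ([x, stk 0 (code t @ r), y, z, stk 0 [True]][j := stk 0 s]) 3"
    using j by (elim disjE; simp) (rule runs_push'; simp)+
  have nf: "\<not> filled 4 (reads ([x, stk 0 r, y, z, stk 0 []][j := stk 0 (rev (code t) @ s)]))"
    using j by auto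
  from mv_loop[OF j runs_LoopF[of "filled 4", OF nf]]
  have "runs (Loop (filled 4) (mv_body j)) ([x, stk 0 (code t @ r), y, z, stk 0 [True]][j := stk 0 s])
     ([x, stk 0 r, y, z, stk 0 []][j := stk 0 (rev (code t) @ s)]) (1 + 11 * length (code t))" .
  note 2 = this
  from runs_Seq[OF 1 2] show ?thesis unfolding mv_def by (rule runs_mono) simp
qed

lemma mv2_runs: "runs (mv 2) [x, stk 0 (code t @ r), stk 0 s, z, stk 0 []]
    [x, stk 0 r, stk 0 (rev (code t) @ s), z, stk 0 []] (5 + 11 * length (code t))"
  using mv_runs[of 2 x t r "stk 0 s" z s] by simp

lemma mv3_runs: "runs (mv 3) [x, stk 0 (code t @ r), y, stk 0 s, stk 0 []]
    [x, stk 0 r, y, stk 0 (rev (code t) @ s), stk 0 []] (5 + 11 * length (code t))"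
  using mv_runs[of 3 x t r y "stk 0 s" s] by simp

definition xfer :: "nat \<Rightarrow> nat \<Rightarrow> com" where
  "xfer i j = Loop (filled i) (Cond (is_True i) (push j True) (push j False) ;; pop i)"

lemma xfer_body:
  assumes "i < 5" "j < 5" "i \<noteq> j" "length ts = 5" "ts ! i = stk 0 (b # s)" "ts ! j = stk 0 u"
    "ts[j := stk 0 (b # u), i := stk 0 s] = us"
  shows "runs (Cond (is_True i) (push j True) (push j False) ;; pop i) ts us 6"
proof -
  have "runs (push j b) ts (ts[j := stk 0 (b # u)]) 3"
    by (rule runs_push) (use assms in simp_all)
  moreover have "is_True i (reads ts) \<longleftrightarrow> b"
    using assms by simp
  ultimately have 1: "runs (Cond (is_True i) (push j True) (push j False)) ts (ts[j := stk 0 (b # u)]) 4"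
    by (rule runs_Cond_bit[where f = "push j" and b = b and m = 3]) simp_all
  have "runs (pop i) (ts[j := stk 0 (b # u)]) us 1"
    by (rule runs_pop'[where b = b and s = s]) (use assms in simp_all)
  from runs_Seq[OF 1 this] show ?thesis by simp
qed

lemma xfer21: "runs (xfer 2 1) [x, stk 0 r, stk 0 s, z, w] [x, stk 0 (rev s @ r), stk 0 [], z, w]
    (Suc (7 * length s))"
  unfolding xfer_def
  using drain[where P = "\<lambda>s u. [x, stk 0 u, stk 0 s, z, w]" and i = 2 and K = 6
      and body = "Cond (is_True 2) (push 1 True) (push 1 False) ;; pop 2", OF xfer_body]
  by simp

lemma xfer31: "runs (xfer 3 1) [x, stk 0 r, z, stk 0 s, w] [x, stk 0 (rev s @ r), z, stk 0 [], w]
    (Suc (7 * length s))"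
  unfolding xfer_def
  using drain[where P = "\<lambda>s u. [x, stk 0 u, z, stk 0 s, w]" and i = 3 and K = 6
      and body = "Cond (is_True 3) (push 1 True) (push 1 False) ;; pop 3", OF xfer_body]
  by simp

lemma xfer32: "runs (xfer 3 2) [x, z, stk 0 r, stk 0 s, w] [x, z, stk 0 (rev s @ r), stk 0 [], w]
    (Suc (7 * length s))"
  unfolding xfer_def
  using drain[where P = "\<lambda>s u. [x, z, stk 0 u, stk 0 s, w]" and i = 3 and K = 6
      and body = "Cond (is_True 3) (push 2 True) (push 2 False) ;; pop 3", OF xfer_body]
  by simp

lemma xfer02: "runs (xfer 0 2) [stk e s, z, stk 0 r, y, w] [stk e [], z, stk 0 (rev s @ r), y, w]
    (Suc (7 * length s))"
proof -
  have "runs (Cond (is_True 0) (push 2 True) (push 2 False) ;; pop 0) [stk e (b # s), z, stk 0 u, y, w]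
      [stk e s, z, stk 0 (b # u), y, w] 6" for b s u
  proof -
    have 1: "runs (push 2 b) [stk e (b # s), z, stk 0 u, y, w] [stk e (b # s), z, stk 0 (b # u), y, w] 3"
      by (rule runs_push') simp_all
    have "is_True 0 (reads [stk e (b # s), z, stk 0 u, y, w]) \<longleftrightarrow> b" by simp
    from runs_Cond_bit[where f = "push 2", OF 1 this]
    have 2: "runs (Cond (is_True 0) (push 2 True) (push 2 False)) [stk e (b # s), z, stk 0 u, y, w]
        [stk e (b # s), z, stk 0 (b # u), y, w] 4"
      by simp
    have "runs (pop 0) [stk e (b # s), z, stk 0 (b # u), y, w] [stk e s, z, stk 0 (b # u), y, w] 1"
      by (rule runs_pop') simp_all
    from runs_Seq[OF 2 this] show ?thesis by simp
  qed
  from drain[where P = "\<lambda>s u. [stk e s, z, stk 0 u, y, w]" and i = 0 and K = 6, OF this]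
  show ?thesis unfolding xfer_def by simp
qed

section \<open>Duplicating, exchanging and discarding trees\<close>

definition conf :: "tape \<Rightarrow> bool list \<Rightarrow> tape list" where
  "conf x s = [x, stk 0 s, stk 0 [], stk 0 [], stk 0 []]"

text \<open>Every transfer reverses. The first copy comes back from stack 2 in the right order; the
  second lies on stack 3 unreversed and takes the detour over stack 2 to be reversed twice.\<close>

definition dup :: com where
  "dup = mv 2 ;; Loop (filled 2) (Cond (is_True 2) (push 1 True ;; push 3 True)
      (push 1 False ;; push 3 False) ;; pop 2)
     ;; xfer 3 2 ;; xfer 2 1"

definition swap :: com where
  "swap = mv 2 ;; mv 3 ;; xfer 2 1 ;; xfer 3 1"

definition drop_tree :: com where
  "drop_tree = mv 2 ;; Loop (filled 2) (pop 2)"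

lemma swap_runs: "runs swap (conf x (code a @ code b @ r)) (conf x (code b @ code a @ r))
    (20 + 20 * (length (code a) + length (code b)))"
proof -
  have "runs swap (conf x (code a @ code b @ r)) [x, stk 0 (code b @ code a @ r), stk 0 [], stk 0 [], stk 0
      []]
    (Suc ((5 + 11 * length (code a)) + Suc ((5 + 11 * length (code b)) +
       Suc (Suc (7 * length (rev (code a) @ [])) + Suc (7 * length (rev (code b) @ []))))))"
    unfolding swap_def conf_def
    apply (rule runs_Seq[OF mv2_runs])
    apply (rule runs_Seq[OF mv3_runs])
    apply (rule runs_Seq[OF xfer21])
    using xfer31[of x "rev (rev (code a) @ []) @ r" "stk 0 []" "rev (code b) @ []" "stk 0 []"]
    by simp
  then show ?thesis unfolding conf_def by (rule runs_mono) simp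
qed

lemma dup_runs: "runs dup (conf x (code a @ r)) (conf x (code a @ code a @ r)) (20 + 50 * length (code a))"
proof -
  have body: "runs (Cond (is_True 2) (push 1 True ;; push 3 True) (push 1 False ;; push 3 False) ;; pop 2)
      [x, stk 0 (u @ r), stk 0 (b # s), stk 0 u, stk 0 []] [x, stk 0 ((b # u) @ r), stk 0 s, stk 0
          (b # u), stk 0 []] 10"
    for b s u
  proof -
    have 1: "runs (push 1 b ;; push 3 b) [x, stk 0 (u @ r), stk 0 (b # s), stk 0 u, stk 0 []]
        [x, stk 0 (b # u @ r), stk 0 (b # s), stk 0 (b # u), stk 0 []] 7"
      by (rule runs_Seq' runs_push' | simp)+
    have "is_True 2 (reads [x, stk 0 (u @ r), stk 0 (b # s), stk 0 u, stk 0 []]) \<longleftrightarrow> b"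
      by simp
    from runs_Cond_bit[where f = "\<lambda>b. push 1 b ;; push 3 b", OF 1 this]
    have 2: "runs (Cond (is_True 2) (push 1 True ;; push 3 True) (push 1 False ;; push 3 False))
        [x, stk 0 (u @ r), stk 0 (b # s), stk 0 u, stk 0 []]
        [x, stk 0 (b # u @ r), stk 0 (b # s), stk 0 (b # u), stk 0 []] 8"
      by simp
    have "runs (pop 2) [x, stk 0 (b # u @ r), stk 0 (b # s), stk 0 (b # u), stk 0 []]
       [x, stk 0 ((b # u) @ r), stk 0 s, stk 0 (b # u), stk 0 []] 1"
      by (rule runs_pop') simp_all
    from runs_Seq[OF 2 this] show ?thesis by simp
  qed
  have loop: "runs (Loop (filled 2) (Cond (is_True 2) (push 1 True ;; push 3 True)
      (push 1 False ;; push 3 False) ;; pop 2))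
      [x, stk 0 r, stk 0 (rev (code a)), stk 0 [], stk 0 []] [x, stk 0 (code a @ r), stk 0 [], stk 0
          (code a), stk 0 []]
      (Suc (Suc 10 * length (rev (code a))))"
    using drain[where P = "\<lambda>s u. [x, stk 0 (u @ r), stk 0 s, stk 0 u, stk 0 []]" and i = 2 and u =
        "[]", OF body, of "rev (code a)"]
    by simp
  have "runs dup (conf x (code a @ r)) [x, stk 0 (code a @ code a @ r), stk 0 [], stk 0 [], stk 0 []]
     (Suc ((5 + 11 * length (code a)) + Suc ((Suc (Suc 10 * length (rev (code a)))) +
       Suc (Suc (7 * length (code a)) + Suc (7 * length (code a))))))"
    unfolding dup_def conf_def
    apply (rule runs_Seq[OF mv2_runs])
    apply (rule runs_Seq)
     apply (use loop in simp)
    apply (rule runs_Seq[OF xfer32])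
    using xfer21[of x "code a @ r" "rev (code a)" "stk 0 []" "stk 0 []"]
    by simp
  then show ?thesis unfolding conf_def by (rule runs_mono) simp
qed

lemma drop_runs: "runs drop_tree (conf x (code a @ r)) (conf x r) (20 + 20 * length (code a))"
proof -
  have "runs (pop 2) [x, stk 0 r, stk 0 (b # s), stk 0 [], stk 0 []] [x, stk 0 r, stk 0 s, stk 0 [], stk 0
      []] 1" for b s
    by (rule runs_pop') simp_all
  from drain[where P = "\<lambda>s u. [x, stk 0 r, stk 0 s, stk 0 [], stk 0 []]" and i = 2, OF this, of
      "rev (code a) @ []"]
  have 1: "runs (Loop (filled 2) (pop 2)) [x, stk 0 r, stk 0 (rev (code a) @ []), stk 0 [], stk 0 []]
      [x, stk 0 r, stk 0 [], stk 0 [], stk 0 []] (Suc (2 * length (code a)))"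
    by (simp add: mult_2)
  have "runs drop_tree (conf x (code a @ r)) [x, stk 0 r, stk 0 [], stk 0 [], stk 0 []]
     (Suc ((5 + 11 * length (code a)) + (Suc (2 * length (code a)))))"
    unfolding drop_tree_def conf_def by (rule runs_Seq[OF mv2_runs 1])
  then show ?thesis unfolding conf_def by (rule runs_mono) simp
qed

lemma wf_tree_coms [simp]: "wf_com (mv 2)" "wf_com (mv 3)" "wf_com dup" "wf_com swap" "wf_com drop_tree"
    "i < 5 \<Longrightarrow> j < 5 \<Longrightarrow> wf_com (xfer i j)"
  by (simp_all add: mv_def mv_body_def dup_def swap_def drop_tree_def xfer_def)


section \<open>Polynomial-time functions between encodable types\<close>

class encodable =
  fixes tr :: "'a \<Rightarrow> tree"

instantiation tree :: encodable
begin
definition tr_tree :: "tree \<Rightarrow> tree" where [simp]: "tr_tree t = t"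
instance ..
end

instantiation unit :: encodable
begin
definition tr_unit :: "unit \<Rightarrow> tree" where [simp]: "tr_unit u = Leaf"
instance ..
end

instantiation bool :: encodable
begin
definition tr_bool :: "bool \<Rightarrow> tree" where [simp]: "tr_bool b = (if b then Node Leaf Leaf else Leaf)"
instance ..
end

instantiation prod :: (encodable, encodable) encodable
begin
definition tr_prod :: "'a \<times> 'b \<Rightarrow> tree" where "tr_prod z = Node (tr (fst z)) (tr (snd z))"
instance ..
end

instantiation list :: (encodable) encodable
begin
definition tr_list :: "'a list \<Rightarrow> tree" where "tr_list xs = foldr (\<lambda>a. Node (tr a)) xs Leaf"
instance ..
end

text \<open>Unary, so that a number and a list of that many units have the same tree and arithmetic
  reduces to lists. This is affordable since only lengths, positions, times and symbols of a fixed
  alphabet are stored as numbers.\<close>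

instantiation nat :: encodable
begin
definition tr_nat :: "nat \<Rightarrow> tree" where "tr_nat n = (Node Leaf ^^ n) Leaf"
instance ..
end

lemma tr_simps [simp]: "tr (a, b) = Node (tr a) (tr b)" "tr [] = Leaf" "tr (x # xs) = Node (tr x) (tr xs)"
  "tr (0::nat) = Leaf" "tr (Suc n) = Node Leaf (tr n)"
  by (simp_all add: tr_prod_def tr_list_def tr_nat_def)

definition sz :: "'a::encodable \<Rightarrow> nat" where
  "sz x = length (code (tr x))"

lemma sz_simps [simp]: "sz (a, b) = Suc (sz a + sz b)" "sz [] = 1" "sz (x # xs) = Suc (sz x + sz xs)"
  "sz Leaf = 1" "sz (Node s t) = Suc (sz s + sz t)" "sz True = 3" "sz False = 1" "sz () = 1"
  by (simp_all add: sz_def)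

lemma sz_nat [simp]: "sz (n::nat) = 2 * n + 1"
  by (induction n) (simp_all add: sz_def)

lemma sz_pos [simp]: "0 < sz x" "1 \<le> sz x" "sz x \<noteq> 0"
proof -
  show "0 < sz x" by (cases "tr x") (simp_all add: sz_def)
  then show "1 \<le> sz x" "sz x \<noteq> 0" by simp_all
qed

lemma sz_bool: "sz (b::bool) \<le> 3"
  by (simp add: sz_def)

lemma sz_list: "sz xs = Suc (\<Sum>x\<leftarrow>xs. Suc (sz x))"
  by (induction xs) simp_all

lemma length_le_sz: "length xs \<le> sz xs"
  by (induction xs) simp_all

lemma sz_bools: "sz (w :: bool list) \<le> Suc (4 * length w)"
proof (induction w)
  case (Cons b w)
  then show ?case using sz_bool[of b] by simp
qed simp

text \<open>The coefficients are natural numbers, so none is negative. This allows bounds to be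
  substituted into bounds.\<close>

lemma poly_nat_mono: "m \<le> n \<Longrightarrow> poly (p :: nat poly) m \<le> poly p n"
  by (induction p) (auto intro: add_mono mult_mono)

text \<open>A program computes a function if it replaces the topmost tree of the main stack and leaves
  everything below it untouched; programs can then be composed on a common stack.\<close>

definition computes :: "com \<Rightarrow> ('a::encodable \<Rightarrow> 'b::encodable) \<Rightarrow> nat poly \<Rightarrow> bool" where
  "computes c f p \<longleftrightarrow> wf_com c \<and> (\<forall>a. sz (f a) \<le> poly p (sz a)) \<and>
     (\<forall>a x r. runs c (conf x (code (tr a) @ r)) (conf x (code (tr (f a)) @ r)) (poly p (sz a)))"

definition pt :: "('a::encodable \<Rightarrow> 'b::encodable) \<Rightarrow> bool" where
  "pt f \<longleftrightarrow> (\<exists>c p. computes c f p)"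

lemma ptI:
  assumes "wf_com c" "\<And>a. sz (f a) \<le> poly p (sz a)"
    "\<And>a x r. runs c (conf x (code (tr a) @ r)) (conf x (code (tr (f a)) @ r)) (poly q (sz a))"
  shows "pt f"
proof -
  have "sz (f a) \<le> poly (p + q) (sz a)" for a using assms(2)[of a] by simp
  moreover have "runs c (conf x (code (tr a) @ r)) (conf x (code (tr (f a)) @ r)) (poly (p + q) (sz a))"
      for a x r
    by (rule runs_mono[OF assms(3)]) simp
  ultimately show ?thesis using assms(1) unfolding pt_def computes_def by blast
qed

lemma computesD:
  assumes "computes c f p"
  shows "wf_com c" "sz (f a) \<le> poly p (sz a)"
    "runs c (conf x (code (tr a) @ r)) (conf x (code (tr (f a)) @ r)) (poly p (sz a))"
  using assms unfolding computes_def by blast+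

lemma pt_sz: assumes "pt f" obtains p where "\<And>a. sz (f a) \<le> poly p (sz a)"
  using assms unfolding pt_def computes_def by blast

text \<open>A program sees only the tree of a value, so a change of type that keeps the tree is
  free. In this way a pair becomes a list cell, a number a list of units, a tree its list of
  children.\<close>

lemma pt_recode: "pt f \<Longrightarrow> (\<And>x. tr (g x) = tr (f x)) \<Longrightarrow> pt g"
  unfolding pt_def computes_def sz_def by simp

lemma pt_id: "pt (\<lambda>x. x)"
  by (rule ptI[of Skip _ "[:0, 1:]" 1]) (simp_all add: runs_Skip[unfolded One_nat_def])

lemma pt_comp:
  assumes "pt f" "pt g"
  shows "pt (\<lambda>x. g (f x))"
proof -
  obtain c p where "computes c f p" using assms(1) unfolding pt_def by blast
  note c = computesD[OF this]
  obtain d q where "computes d g q" using assms(2) unfolding pt_def by blast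
  note d = computesD[OF this]
  have q: "poly q (sz (f a)) \<le> poly (pcompose q p) (sz a)" for a
    using poly_nat_mono[OF c(2)] by (simp add: poly_pcompose)
  show ?thesis
  proof (rule ptI[of "c ;; d"])
    show "sz (g (f a)) \<le> poly (pcompose q p) (sz a)" for a using d(2) q le_trans by blast
    show "runs (c ;; d) (conf x (code (tr a) @ r)) (conf x (code (tr (g (f a))) @ r))
        (poly (1 + p + pcompose q p) (sz a))" for a x r
      by (rule runs_Seq'[OF c(3) d(3)]) (use q[of a] in simp)
  qed (use c(1) d(1) in simp)
qed

lemma pt_pair:
  assumes "pt f" "pt g"
  shows "pt (\<lambda>x. (f x, g x))"
proof -
  obtain c p where "computes c f p" using assms(1) unfolding pt_def by blast
  note c = computesD[OF this]
  obtain d q where "computes d g q" using assms(2) unfolding pt_def by blast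
  note d = computesD[OF this]
  show ?thesis
  proof (rule ptI[of "dup ;; c ;; swap ;; d ;; swap ;; push 1 True"])
    show "sz (f a, g a) \<le> poly (1 + p + q) (sz a)" for a using c(2)[of a] d(2)[of a] by simp
    fix a x r
    have 6: "runs (push 1 True) (conf x (code (tr (f a)) @ code (tr (g a)) @ r))
        (conf x (code (tr (f a, g a)) @ r)) 3"
      unfolding conf_def by (rule runs_push') simp_all
    note 5 = runs_Seq[OF swap_runs[of x "tr (g a)" "tr (f a)" r] 6]
    note 4 = runs_Seq[OF d(3)[of x a "code (tr (f a)) @ r"] 5]
    note 3 = runs_Seq[OF swap_runs[of x "tr (f a)" "tr a" r] 4]
    note 2 = runs_Seq[OF c(3)[of x a "code (tr a) @ r"] 3]
    note 1 = runs_Seq[OF dup_runs 2]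
    show "runs (dup ;; c ;; swap ;; d ;; swap ;; push 1 True) (conf x (code (tr a) @ r))
      (conf x (code (tr (f a, g a)) @ r)) (poly ([:100, 100:] + smult 50 p + smult 50 q) (sz a))"
      by (rule runs_mono[OF 1]) (use c(2)[of a] d(2)[of a] in \<open>simp flip: sz_def\<close>)
  qed (use c(1) d(1) in simp)
qed

primrec pushes :: "bool list \<Rightarrow> com" where
  "pushes [] = Skip"
| "pushes (b # s) = pushes s ;; push 1 b"

lemma wf_pushes [simp]: "wf_com (pushes s)"
  by (induction s) simp_all

lemma pushes_runs: "runs (pushes s) (conf x r) (conf x (s @ r)) (1 + 4 * length s)"
proof (induction s)
  case Nil
  then show ?case by (simp add: runs_Skip[unfolded One_nat_def])
next
  case (Cons b s)
  have "runs (push 1 b) (conf x (s @ r)) (conf x ((b # s) @ r)) 3"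
    unfolding conf_def by (rule runs_push') simp_all
  from runs_Seq[OF Cons this] show ?case by simp
qed

lemma pt_const: "pt (\<lambda>_. k)"
proof (rule ptI[of "drop_tree ;; pushes (code (tr k))"])
  show "sz k \<le> poly [:sz k:] (sz a)" for a by simp
  show "runs (drop_tree ;; pushes (code (tr k))) (conf x (code (tr a) @ r)) (conf x (code (tr k) @ r))
      (poly ([:30 + 4 * sz k, 20:]) (sz a))" for a :: 'a and x r
    by (rule runs_Seq'[OF drop_runs pushes_runs]) (simp add: sz_def)
qed simp

lemma pop_runs: "runs (pop 1) (conf x (b # r)) (conf x r) 1"
  unfolding conf_def by (rule runs_pop') simp_all

lemma push_runs: "runs (push 1 b) (conf x r) (conf x (b # r)) 3"
  unfolding conf_def by (rule runs_push') simp_all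

lemma pt_fst_raw: "pt (fst :: 'a::encodable \<times> 'b::encodable \<Rightarrow> 'a)"
proof (rule ptI[of "pop 1 ;; swap ;; drop_tree"])
  show "sz (fst a) \<le> poly [:0, 1:] (sz a)" for a :: "'a \<times> 'b" by (cases a) simp
  fix z :: "'a \<times> 'b" and x r
  obtain a b where z: "z = (a, b)" by (cases z)
  have "runs (pop 1 ;; swap ;; drop_tree) (conf x (True # code (tr a) @ code (tr b) @ r))
      (conf x (code (tr a) @ r))
      (poly [:100, 100:] (sz z))"
    by (rule runs_mono[OF runs_Seq[OF pop_runs runs_Seq[OF swap_runs drop_runs]]])
      (simp add: z flip: sz_def)
  then show "runs (pop 1 ;; swap ;; drop_tree) (conf x (code (tr z) @ r)) (conf x (code (tr (fst z)) @ r))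
      (poly [:100, 100:] (sz z))" by (simp add: z)
qed simp

lemma pt_snd_raw: "pt (snd :: 'a::encodable \<times> 'b::encodable \<Rightarrow> 'b)"
proof (rule ptI[of "pop 1 ;; drop_tree"])
  show "sz (snd a) \<le> poly [:0, 1:] (sz a)" for a :: "'a \<times> 'b" by (cases a) simp
  fix z :: "'a \<times> 'b" and x r
  obtain a b where z: "z = (a, b)" by (cases z)
  have "runs (pop 1 ;; drop_tree) (conf x (True # code (tr a) @ code (tr b) @ r)) (conf x (code (tr b) @ r))
      (poly [:100, 100:] (sz z))"
    by (rule runs_mono[OF runs_Seq[OF pop_runs drop_runs]])
      (simp add: z flip: sz_def)
  then show "runs (pop 1 ;; drop_tree) (conf x (code (tr z) @ r)) (conf x (code (tr (snd z)) @ r))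
      (poly [:100, 100:] (sz z))" by (simp add: z)
qed simp

lemmas pt_fst = pt_comp[OF _ pt_fst_raw]
lemmas pt_snd = pt_comp[OF _ pt_snd_raw]

lemma pt_Cons: "pt f \<Longrightarrow> pt g \<Longrightarrow> pt (\<lambda>x. f x # g x)"
  by (rule pt_recode[OF pt_pair]) simp_all

lemma is_True_conf [simp]: "is_True 1 (reads (conf x (b # s))) = b" "is_True (Suc 0)
    (reads (conf x (b # s))) = b"
  by (simp_all add: conf_def)

text \<open>The list is computed next to the argument, as the pair \<open>(l x, x)\<close>. Once the
  bit of the pair is removed, the top bit tells whether the list is empty. If not, pushing the bit
  back turns the cell into the pair \<open>(a, t)\<close>, so the branch is run on
  \<open>((a, t), x)\<close>.\<close>

lemma pt_case_list:
  assumes "pt l" "pt d" "pt (\<lambda>z. g (snd z) (fst (fst z)) (snd (fst z)))"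
  shows "pt (\<lambda>x. case l x of [] \<Rightarrow> d x | a # t \<Rightarrow> g x a t)"
proof -
  obtain c p where "computes c (\<lambda>a. (l a, a)) p" using pt_pair[OF assms(1) pt_id] unfolding pt_def by blast
  note c = computesD[OF this]
  obtain c1 p1 where "computes c1 d p1" using assms(2) unfolding pt_def by blast
  note c1 = computesD[OF this]
  obtain c2 p2 where "computes c2 (\<lambda>z. g (snd z) (fst (fst z)) (snd (fst z))) p2"
    using assms(3) unfolding pt_def by blast
  note c2 = computesD(1)[OF this] computesD(2)[OF this, of "((a, t), y)"
      for a t y, unfolded fst_conv snd_conv]
    computesD(3)[OF this, of _ "((a, t), y)" for a t y, unfolded fst_conv snd_conv]
  have p2: "poly p2 (sz ((a, t), x)) \<le> poly (pcompose p2 p) (sz x)" if "l x = a # t" for x a t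
  proof -
    have "sz ((a, t), x) \<le> poly p (sz x)" using c(2)[of x] that by simp
    then show ?thesis by (simp add: poly_pcompose poly_nat_mono)
  qed
  let ?c = "c ;; pop 1 ;; Cond (is_True 1) (push 1 True ;; c2) (pop 1 ;; c1)"
  show ?thesis
  proof (rule ptI[of ?c])
    show "sz (case l a of [] \<Rightarrow> d a | b # t \<Rightarrow> g a b t) \<le> poly (p1 + pcompose p2 p) (sz a)" for a
    proof (cases "l a")
      case Nil
      then show ?thesis using c1(2)[of a] by simp
    next
      case (Cons b t)
      then show ?thesis using c2(2)[of a b t] p2[OF Cons] by simp
    qed
    fix y x r
    show "runs ?c (conf x (code (tr y) @ r))
        (conf x (code (tr (case l y of [] \<Rightarrow> d y | b # t \<Rightarrow> g y b t)) @ r))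
        (poly ([:100:] + p + p1 + pcompose p2 p) (sz y))"
    proof (cases "l y")
      case Nil
      have 1: "runs c (conf x (code (tr y) @ r)) (conf x (True # False # code (tr y) @ r)) (poly p (sz y))"
        using c(3)[of x y r] Nil by simp
      have 2: "runs (Cond (is_True 1) (push 1 True ;; c2) (pop 1 ;; c1)) (conf x (False # code (tr y) @ r))
         (conf x (code (tr (d y)) @ r)) (Suc (Suc (1 + poly p1 (sz y))))"
        by (rule runs_CondF) (simp, rule runs_Seq[OF pop_runs c1(3)])
      show ?thesis
        using runs_mono[OF runs_Seq[OF 1 runs_Seq[OF pop_runs 2]]] Nil by simp
    next
      case (Cons a t)
      have 1: "runs c (conf x (code (tr y) @ r))
          (conf x (True # True # code (tr a) @ code (tr t) @ code (tr y) @ r)) (poly p (sz y))"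
        using c(3)[of x y r] Cons by simp
      have 2: "runs c2 (conf x (True # True # code (tr a) @ code (tr t) @ code (tr y) @ r))
          (conf x (code (tr (g y a t)) @ r))
          (poly p2 (sz ((a, t), y)))"
        using c2(3)[of x a t y r] by simp
      have 3: "runs (Cond (is_True 1) (push 1 True ;; c2) (pop 1 ;; c1))
          (conf x (True # code (tr a) @ code (tr t) @ code (tr y) @ r))
         (conf x (code (tr (g y a t)) @ r)) (Suc (Suc (3 + poly p2 (sz ((a, t), y)))))"
        by (rule runs_CondT) (simp, rule runs_Seq[OF push_runs 2])
      show ?thesis
        using runs_mono[OF runs_Seq[OF 1 runs_Seq[OF pop_runs 3]]] Cons p2[OF Cons] by simp
    qed
  qed (use c(1) c1(1) c2(1) in simp)
qed

text \<open>Polynomial time for one round does not suffice, as repeated doubling of the accumulator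
  shows. The bound \<open>bnd\<close> on all intermediate accumulators bounds the time of each round
  and thereby the whole loop.\<close>

lemma pt_fold:
  fixes h :: "'c::encodable \<Rightarrow> 'a::encodable \<Rightarrow> 's::encodable \<Rightarrow> 's"
  assumes h: "pt (\<lambda>z. h (fst z) (fst (snd z)) (snd (snd z)))" and l: "pt l" and s: "pt s"
    and bnd: "\<And>x i. i \<le> length (l x) \<Longrightarrow> sz (fold (h x) (take i (l x)) (s x)) \<le> poly p (sz x)"
  shows "pt (\<lambda>x. fold (h x) (l x) (s x))"
proof -
  define step :: "('a \<times> 'a list) \<times> 'c \<times> 's \<Rightarrow> 'a list \<times> 'c \<times> 's" where
    "step z = (snd (fst z), (fst (snd z), h (fst (snd z)) (fst (fst z)) (snd (snd z))))" for z
  have "pt (\<lambda>z :: ('a \<times> 'a list) \<times> 'c \<times> 's. (fst (snd z), (fst (fst z), snd (snd z))))"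
    by (intro pt_pair pt_fst pt_snd pt_id)
  note pt_comp[OF this h, simplified]
  then have "pt step"
    unfolding step_def by (intro pt_pair pt_fst pt_snd pt_id)
  then obtain c q where "computes c step q" unfolding pt_def by blast
  note c = computesD[OF this]
  obtain c0 p0 where "computes c0 (\<lambda>x. (l x, (x, s x))) p0"
    using pt_pair[OF l pt_pair[OF pt_id s]] unfolding pt_def by blast
  note c0 = computesD[OF this]
  obtain c1 p1 where "computes c1 (\<lambda>a. snd (snd (a :: 'a list \<times> 'c \<times> 's))) p1"
    using pt_snd[OF pt_snd[OF pt_id]] unfolding pt_def by blast
  note c1 = computesD[OF this]
  \<comment> \<open>The remaining list lies directly on the stack, so its first bit is the loop
    test. Pushing a bit turns the list together with the state into the argument
    \<open>((a, as), (y, s))\<close> of \<open>step\<close>.\<close>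
  let ?body = "push 1 True ;; c ;; pop 1"
  have loop: "runs (Loop (is_True 1) ?body) (conf x (code (tr as) @ code (tr (y, s)) @ r))
      (conf x (False # code (tr (y, fold (h y) as s)) @ r))
          (Suc (length as * (10 + poly q (S + sz y + b + 10))))"
    if "\<forall>i \<le> length as. sz (fold (h y) (take i as) s) \<le> b" "sz as \<le> S" for as y s x r b S
    using that
  proof (induction as arbitrary: s)
    case Nil
    show ?case using runs_LoopF[of "is_True 1" "conf x (False # code (tr (y, s)) @ r)"] by simp
  next
    case (Cons a as)
    let ?s = "h y a s"
    have "sz s \<le> b" using Cons.prems by (metis fold_simps(1) take0 zero_le)
    then have q: "poly q (sz ((a, as), (y, s))) \<le> poly q (S + sz y + b + 10)"
      using Cons.prems by (intro poly_nat_mono) simp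
    have "runs c (conf x (True # code (tr (a # as)) @ code (tr (y, s)) @ r))
        (conf x (True # code (tr as) @ code (tr (y, ?s)) @ r)) (poly q (sz ((a, as), (y, s))))"
      using c(3)[of x "((a, as), (y, s))" r] by (simp add: step_def)
    then have body: "runs ?body (conf x (code (tr (a # as)) @ code (tr (y, s)) @ r))
        (conf x (code (tr as) @ code (tr (y, ?s)) @ r)) (9 + poly q (S + sz y + b + 10))"
      using q by (intro runs_Seq'[OF push_runs runs_Seq[OF _ pop_runs]]) auto
    have "\<forall>i \<le> length as. sz (fold (h y) (take i as) ?s) \<le> b"
    proof (intro allI impI)
      fix i assume "i \<le> length as"
      then show "sz (fold (h y) (take i as) ?s) \<le> b" using Cons.prems(1)
          by (metis Suc_le_mono fold_simps(2) length_Cons take_Suc_Cons)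
    qed
    moreover have "sz as \<le> S" using Cons.prems by simp
    ultimately have rest: "runs (Loop (is_True 1) ?body) (conf x (code (tr as) @ code (tr (y, ?s)) @ r))
      (conf x (False # code (tr (y, fold (h y) as ?s)) @ r))
          (Suc (length as * (10 + poly q (S + sz y + b + 10))))"
      by (rule Cons.IH)
    have "is_True 1 (reads (conf x (code (tr (a # as)) @ code (tr (y, s)) @ r)))" by simp
    note runs_LoopT[of "is_True 1", OF this body rest, folded fold_simps(2)[of "h y" a as s]]
    then show ?case by (rule runs_mono) simp
  qed
  let ?c = "c0 ;; pop 1 ;; Loop (is_True 1) ?body ;; push 1 True ;; c1"
  show ?thesis
  proof (rule ptI[of ?c])
    show "sz (fold (h y) (l y) (s y)) \<le> poly p (sz y)" for y using bnd[of "length (l y)" y] by simp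
    fix y x r
    let ?res = "fold (h y) (l y) (s y)"
    have sz0: "sz (l y) \<le> poly p0 (sz y)" using c0(2)[of y] by simp
    have q: "poly q (poly p0 (sz y) + sz y + poly p (sz y) + 10) = poly (pcompose q (p0 + [:10, 1:] + p))
        (sz y)"
      by (simp add: poly_pcompose algebra_simps)
    have len: "length (l y) \<le> poly p0 (sz y)" using length_le_sz[of "l y"] sz0 by simp
    have 1: "runs c0 (conf x (code (tr y) @ r)) (conf x (True # code (tr (l y)) @ code (tr (y, s y)) @ r))
        (poly p0 (sz y))"
      using c0(3)[of x y r] by simp
    have 2: "runs (Loop (is_True 1) ?body) (conf x (code (tr (l y)) @ code (tr (y, s y)) @ r))
      (conf x (False # code (tr (y, ?res)) @ r))
      (Suc (poly p0 (sz y) * (10 + poly (pcompose q (p0 + [:10, 1:] + p)) (sz y))))"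
      by (rule runs_mono[OF loop[of "l y" y "s y" "poly p (sz y)" "poly p0 (sz y)" x r, unfolded q]])
        (use bnd[of _ y] sz0 len in simp_all)
    have "sz ([] :: 'a list, y, ?res) \<le> poly ([:10, 1:] + p) (sz y)"
      using bnd[of "length (l y)" y] by simp
    from poly_nat_mono[OF this, of p1]
    have p1: "poly p1 (sz ([] :: 'a list, y, ?res)) \<le> poly (pcompose p1 ([:10, 1:] + p)) (sz y)"
      by (simp only: poly_pcompose)
    have 3: "runs c1 (conf x (True # False # code (tr (y, ?res)) @ r)) (conf x (code (tr ?res) @ r))
       (poly (pcompose p1 ([:10, 1:] + p)) (sz y))"
      using runs_mono[OF c1(3)[of x "([], y, ?res)" r] p1] by simp
    show "runs ?c (conf x (code (tr y) @ r)) (conf x (code (tr ?res) @ r))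
       (poly (100 + p0 + p0 * ([:10:] + pcompose q (p0 + [:10, 1:] + p)) + pcompose p1 ([:10, 1:] + p))
           (sz y))"
      by (rule runs_mono[OF runs_Seq[OF 1 runs_Seq[OF pop_runs runs_Seq[OF 2 runs_Seq[OF push_runs 3]]]]])
        (simp add: algebra_simps)
  qed (use c(1) c0(1) c1(1) in simp)
qed


subsection \<open>Input and output\<close>

text \<open>The bits on stack 2 arrive last one first, so consing them rebuilds the word. The extra
  action \<open>e\<close> is \<open>Skip\<close> in \<open>pt_code\<close>; when the input is read
  it moves the head of tape 0 back by one square per bit, so that the output can start at position
  0.\<close>

definition listify_body :: "com \<Rightarrow> com" where
  "listify_body e = Cond (is_True 2) (pushes [True, False, False]) (pushes [False]) ;; push 1 True ;; pop 2
      ;; e"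

lemma listify_runs:
  assumes e: "\<And>b s ys. runs e (X (b # s) # ys) (X s # ys) 1"
  shows "runs (Loop (filled 2) (listify_body e)) [X s, stk 0 (code (tr u) @ r), stk 0 s, stk 0 [], stk 0 []]
    [X [], stk 0 (code (tr (rev s @ u)) @ r), stk 0 [], stk 0 [], stk 0 []] (Suc (31 * length s))"
proof -
  define P where "P = (\<lambda>s (u :: bool list). [X s, stk 0 (code (tr u) @ r), stk 0 s, stk 0 [], stk 0 []])"
  have "runs (listify_body e) (P (b # s) u) (P s (b # u)) 30" for b s u
  proof -
    have ps: "runs (pushes v) [X (b # s), stk 0 r', stk 0 (b # s), stk 0 [], stk 0 []]
        [X (b # s), stk 0 (v @ r'), stk 0 (b # s), stk 0 [], stk 0 []] (1 + 4 * length v)" for v r'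
    proof (induction v)
      case Nil
      then show ?case by (simp add: runs_Skip[unfolded One_nat_def])
    next
      case (Cons a v)
      have "runs (push 1 a) [X (b # s), stk 0 (v @ r'), stk 0 (b # s), stk 0 [], stk 0 []]
          [X (b # s), stk 0 ((a # v) @ r'), stk 0 (b # s), stk 0 [], stk 0 []] 3"
        by (rule runs_push') simp_all
      from runs_Seq[OF Cons this] show ?case by simp
    qed
    have "runs ((\<lambda>b. pushes (if b then [True, False, False] else [False])) b) (P (b # s) u)
        [X (b # s), stk 0 (code (tr b) @ code (tr u) @ r), stk 0 (b # s), stk 0 [], stk 0 []] 13"
      using runs_mono[OF ps[of "if b then [True, False, False] else [False]" "code (tr u) @ r"], of 13]
      unfolding P_def by (auto split: if_splits)
    from runs_Cond_bit[of "\<lambda>b. pushes (if b then [True, False, False] else [False])", OF this, of 2 14]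
    have 1: "runs (Cond (is_True 2) (pushes [True, False, False]) (pushes [False])) (P (b # s) u)
        [X (b # s), stk 0 (code (tr b) @ code (tr u) @ r), stk 0 (b # s), stk 0 [], stk 0 []] 14"
      by (simp add: P_def)
    have 2: "runs (push 1 True) [X (b # s), stk 0 (code (tr b) @ code (tr u) @ r), stk 0 (b # s), stk 0 [],
        stk 0 []]
        [X (b # s), stk 0 (code (tr (b # u)) @ r), stk 0 (b # s), stk 0 [], stk 0 []] 3"
      by (rule runs_push') simp_all
    have 3: "runs (pop 2) [X (b # s), stk 0 (code (tr (b # u)) @ r), stk 0 (b # s), stk 0 [], stk 0 []]
        [X (b # s), stk 0 (code (tr (b # u)) @ r), stk 0 s, stk 0 [], stk 0 []] 1"
      by (rule runs_pop') simp_all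
    show ?thesis unfolding listify_body_def P_def
      by (rule runs_mono[OF runs_Seq[OF 1[unfolded P_def] runs_Seq[OF 2 runs_Seq[OF 3 e]]]]) simp
  qed
  from drain[of _ P, OF this, of 2 s u] show ?thesis by (simp add: P_def)
qed

lemma pt_code: "pt (code :: tree \<Rightarrow> bool list)"
proof (rule ptI[of "mv 2 ;; push 1 False ;; Loop (filled 2) (listify_body Skip)"])
  show "sz (code t) \<le> poly [:1, 4:] (sz t)" for t using sz_bools[of "code t"] by (simp add: sz_def)
  fix t :: tree and x r
  have 1: "runs (mv 2) (conf x (code t @ r)) [x, stk 0 r, stk 0 (rev (code t) @ []), stk 0 [], stk 0 []]
      (5 + 11 * sz t)"
    unfolding conf_def using mv2_runs[of x t r "[]" "stk 0 []"] by (simp add: sz_def)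
  have 2: "runs (push 1 False) [x, stk 0 r, stk 0 (rev (code t) @ []), stk 0 [], stk 0 []]
     [x, stk 0 (code (tr ([] :: bool list)) @ r), stk 0 (rev (code t)), stk 0 [], stk 0 []] 3"
    by (rule runs_push') simp_all
  have 3: "runs (Loop (filled 2) (listify_body Skip)) [x, stk 0 (code (tr ([] :: bool list)) @ r), stk 0
      (rev (code t)), stk 0 [], stk 0 []]
     (conf x (code (tr (code t)) @ r)) (Suc (31 * sz t))"
    using listify_runs[of Skip "\<lambda>_. x" "rev (code t)" "[]" r] runs_Skip by (simp add: conf_def sz_def)
  show "runs (mv 2 ;; push 1 False ;; Loop (filled 2) (listify_body Skip)) (conf x (code (tr t) @ r))
     (conf x (code (tr (code t)) @ r)) (poly [:100, 100:] (sz t))"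
    by (rule runs_mono[OF runs_Seq[OF _ runs_Seq[OF 2 3]]]) (use 1 in auto)
qed (simp add: listify_body_def)

definition read_input :: com where
  "read_input = xfer 0 2 ;; push 1 False ;; Loop (filled 2) (listify_body (on 0 (\<lambda>a. (a, MoveLeft))))"

definition write_output :: com where
  "write_output = Loop (is_True 1) (pop 1 ;;
     Cond (is_True 1) (pop 1 ;; pop 1 ;; pop 1 ;; on 0 (\<lambda>_. (2, MoveRight)))
         (pop 1 ;; on 0 (\<lambda>_. (1, MoveRight))))"

lemma wf_io [simp]: "wf_com read_input" "wf_com write_output"
  by (simp_all add: read_input_def write_output_def listify_body_def wf_on)

lemma read_input_runs:
  "runs read_input ((word_contents w, 0) # replicate 4 (\<lambda>_. 0, 0)) (conf (\<lambda>_. 0, 0) (code (tr w)))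
    (10 + 50 * length w)"
proof -
  have blank: "stk e [] = (\<lambda>_. 0, e)" for e by (auto simp: stk_def fun_eq_iff)
  \<comment> \<open>The input tape is a stack already, with its bottom at \<open>length w\<close>;
    the usual transfer reads it and blanks it.\<close>
  have "(word_contents w, 0) = stk (int (length w)) w"
    by (auto simp: stk_def word_contents_def bit_symbol_def fun_eq_iff)
  then have init: "(word_contents w, 0) # replicate 4 (\<lambda>_. 0, 0) = [stk (int (length w)) w, stk 0 [], stk 0
      [], stk 0 [], stk 0 []]"
    by (simp add: blank numeral_eq_Suc)
  have 1: "runs (xfer 0 2) [stk (int (length w)) w, stk 0 [], stk 0 [], stk 0 [], stk 0 []]
     [stk (int (length w)) [], stk 0 [], stk 0 (rev w @ []), stk 0 [], stk 0 []] (Suc (7 * length w))"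
    by (rule xfer02)
  have 2: "runs (push 1 False) [stk (int (length w)) [], stk 0 [], stk 0 (rev w @ []), stk 0 [], stk 0 []]
     [stk (int (length (rev w))) [], stk 0 (code (tr ([] :: bool list)) @ []), stk 0 (rev w), stk 0 [], stk
         0 []] 3"
    by (rule runs_push') simp_all
  have "runs (on 0 (\<lambda>a. (a, MoveLeft))) (stk (int (length (b # s))) [] # ys) (stk (int (length s)) [] # ys)
      1" for b s ys
    using runs_on[of 0 "stk (int (length (b # s))) [] # ys" "\<lambda>a. (a, MoveLeft)"]
    by (simp add: blank nth_reads fun_upd_idem)
  from listify_runs[of _ "\<lambda>s. stk (int (length s)) []", OF this, of "rev w" "[]" "[]"]
  have 3: "runs (Loop (filled 2) (listify_body (on 0 (\<lambda>a. (a, MoveLeft)))))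
     [stk (int (length (rev w))) [], stk 0 (code (tr ([] :: bool list)) @ []), stk 0 (rev w), stk 0 [], stk
         0 []]
     (conf (\<lambda>_. 0, 0) (code (tr w))) (Suc (31 * length w))"
    by (simp add: conf_def blank)
  show ?thesis unfolding init read_input_def
    by (rule runs_mono[OF runs_Seq[OF 1 runs_Seq[OF 2 3]]]) simp
qed

lemma write_output_runs:
  "runs write_output (conf (word_contents u, int (length u)) (code (tr v)))
    (conf (word_contents (u @ v), int (length (u @ v))) [False]) (1 + 20 * length v)"
proof (induction v arbitrary: u)
  case Nil
  show ?case unfolding write_output_def
    using runs_LoopF[of "is_True 1" "conf (word_contents u, int (length u)) [False]"] by simp
next
  case (Cons b v)
  have wc: "act (word_contents u, int (length u)) (bit_symbol b, MoveRight) = (word_contents (u @ [b]), int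
      (length (u @ [b])))"
    by (auto simp: word_contents_def bit_symbol_def fun_eq_iff nth_append)
  have wr: "runs (on 0 (\<lambda>_. (bit_symbol b, MoveRight))) (conf (word_contents u, int (length u)) r)
     (conf (word_contents (u @ [b]), int (length (u @ [b]))) r) 1" for r
    using runs_on[of 0 "conf (word_contents u, int (length u)) r" "\<lambda>_. (bit_symbol b, MoveRight)"] wc
    by (simp add: conf_def add.commute)
  have "runs (Cond (is_True 1) (pop 1 ;; pop 1 ;; pop 1 ;; on 0 (\<lambda>_. (2, MoveRight)))
      (pop 1 ;; on 0 (\<lambda>_. (1, MoveRight))))
     (conf (word_contents u, int (length u)) (code (tr b) @ code (tr v)))
     (conf (word_contents (u @ [b]), int (length (u @ [b]))) (code (tr v))) 10"
  proof (cases b)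
    case True
    show ?thesis
      using runs_CondT[of "is_True 1", OF _
          runs_Seq[OF pop_runs runs_Seq[OF pop_runs runs_Seq[OF pop_runs wr]]]] True
      by (force intro: runs_mono)
  next
    case False
    show ?thesis
      using runs_CondF[of "is_True 1", OF _ runs_Seq[OF pop_runs wr]] False
      by (force intro: runs_mono)
  qed
  from runs_Seq[OF pop_runs this] have body: "runs (pop 1 ;;
     Cond (is_True 1) (pop 1 ;; pop 1 ;; pop 1 ;; on 0 (\<lambda>_. (2, MoveRight)))
         (pop 1 ;; on 0 (\<lambda>_. (1, MoveRight))))
     (conf (word_contents u, int (length u)) (code (tr (b # v))))
     (conf (word_contents (u @ [b]), int (length (u @ [b]))) (code (tr v))) 12"
    by simp
  have "is_True 1 (reads (conf (word_contents u, int (length u)) (code (tr (b # v)))))" by simp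
  note runs_LoopT[of "is_True 1", OF this body Cons.IH[of "u @ [b]", unfolded write_output_def append_assoc
      append.simps]]
  then show ?case unfolding write_output_def by (rule runs_mono) simp
qed

text \<open>A word of length \<open>n\<close> has a tree code of at most \<open>4 * n + 1\<close>
  bits, so a bound in \<open>sz\<close> turns into one in the length of the word.\<close>

theorem polytime_pt:
  assumes "pt f"
  shows "polytime f"
proof -
  obtain c p where "computes c f p" using assms unfolding pt_def by blast
  note c = computesD[OF this]
  obtain M where M: "valid_machine M"
    "\<And>w t n. exec (read_input ;; c ;; write_output) ((word_contents w, 0) # replicate 4 (\<lambda>_. 0, 0)) t n \<Longrightarrow>
       (step M ^^ n) (initial M w) = (num_states M, t)"
    by (rule compile[of "read_input ;; c ;; write_output"]) (use c(1) in simp_all)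
  define q where "q = [:100, 100:] + smult 50 (pcompose p [:1, 4:])"
  have "outputs_within M w (f w) (poly q (length w))" for w
  proof -
    have w0: "(\<lambda>_. 0, 0) = (word_contents [], 0 :: int)" by (auto simp: word_contents_def fun_eq_iff)
    have 3: "runs write_output (conf (\<lambda>_. 0, 0) (code (tr (f w))))
        (conf (word_contents (f w), int (length (f w))) [False]) (1 + 20 * length (f w))"
      using write_output_runs[of "[]" "f w"] by (simp add: w0)
    have 2: "runs c (conf (\<lambda>_. 0, 0) (code (tr w))) (conf (\<lambda>_. 0, 0) (code (tr (f w)))) (poly p (sz w))"
      using c(3)[of _ w "[]"] by simp
    have p: "poly p (sz w) \<le> poly (pcompose p [:1, 4:]) (length w)"
      using poly_nat_mono[OF sz_bools[of w], of p] by (simp add: poly_pcompose algebra_simps)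
    have "length (f w) \<le> poly p (sz w)" using c(2)[of w] length_le_sz[of "f w"] by simp
    with p have "Suc ((10 + 50 * length w) + Suc (poly p (sz w) + (1 + 20 * length (f w)))) \<le> poly q
        (length w)"
      by (simp add: q_def)
    from runs_Seq'[OF read_input_runs runs_Seq[OF 2 3] this]
    obtain n where n: "n \<le> poly q (length w)" "exec (read_input ;; c ;; write_output)
      ((word_contents w, 0) # replicate 4 (\<lambda>_. 0, 0)) (conf (word_contents (f w), int (length (f w)))
          [False]) n"
      unfolding runs_def by blast
    from M(2)[OF n(2)] n(1) show ?thesis
      unfolding outputs_within_def by (auto simp: conf_def)
  qed
  with M(1) show ?thesis unfolding polytime_def by blast
qed


subsection \<open>Derived closure properties\<close>

text \<open>A truth value has the same tree as a list of units, with \<open>False\<close> as the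
  empty list; the case distinction on lists applies.\<close>

lemma pt_if: "pt P \<Longrightarrow> pt f \<Longrightarrow> pt g \<Longrightarrow> pt (\<lambda>x. if P x then f x else g x)"
proof -
  assume P: "pt P" and fg: "pt f" "pt g"
  have "pt (\<lambda>x. if P x then [()] else [])" by (rule pt_recode[OF P]) simp
  from pt_case_list[OF this fg(2), of "\<lambda>x _ _. f x"]
  have "pt (\<lambda>x. case if P x then [()] else [] of [] \<Rightarrow> g x | a # t \<Rightarrow> f x)"
    by (simp add: pt_comp[OF pt_snd[OF pt_id] fg(1)])
  then show ?thesis by (rule pt_recode) simp
qed

lemma pt_not: "pt P \<Longrightarrow> pt (\<lambda>x. \<not> P x)"
  by (rule pt_recode[OF pt_if[of P "\<lambda>_. False" "\<lambda>_. True", OF _ pt_const pt_const]]) simp_all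

lemma pt_conj: "pt P \<Longrightarrow> pt Q \<Longrightarrow> pt (\<lambda>x. P x \<and> Q x)"
  by (rule pt_recode[OF pt_if[of P Q "\<lambda>_. False", OF _ _ pt_const]]) simp_all

lemma pt_disj: "pt P \<Longrightarrow> pt Q \<Longrightarrow> pt (\<lambda>x. P x \<or> Q x)"
  by (rule pt_recode[OF pt_if[of P "\<lambda>_. True" Q, OF _ pt_const]]) simp_all

lemma pt_imp: "pt P \<Longrightarrow> pt Q \<Longrightarrow> pt (\<lambda>x. P x \<longrightarrow> Q x)"
  by (rule pt_recode[OF pt_if[of P Q "\<lambda>_. True", OF _ _ pt_const]]) simp_all

lemma pt_eq_bool: "pt P \<Longrightarrow> pt Q \<Longrightarrow> pt (\<lambda>x. P x = (Q x :: bool))"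
  by (rule pt_recode[OF pt_if[of P Q "\<lambda>x. \<not> Q x", OF _ _ pt_not]]) simp_all

lemma pt_null: "pt l \<Longrightarrow> pt (\<lambda>x. l x = [])"
  by (rule pt_recode[OF pt_case_list[OF _ pt_const[of True] pt_const[of False]]]) (auto split: list.split)

lemma pt_tl: "pt l \<Longrightarrow> pt (\<lambda>x. tl (l x))"
  by (rule pt_recode[OF pt_case_list[OF _ pt_const[of "[]"] pt_snd[OF pt_fst[OF pt_id]]]])
      (auto split: list.split)

text \<open>The increment depends on the list entry and on \<open>n\<close>, the size of the
  environment, but not on the accumulator, so increments add up instead of compounding.\<close>

lemma sz_fold_add:
  assumes "\<And>a s. sz (h a s) \<le> sz s + poly q (n + sz a)" "\<And>a. a \<in> set xs \<Longrightarrow> sz a \<le> S"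
  shows "sz (fold h xs s) \<le> sz s + length xs * poly q (n + S)"
  using assms(2)
proof (induction xs arbitrary: s)
  case (Cons a xs)
  have "poly q (n + sz a) \<le> poly q (n + S)" using Cons.prems by (intro poly_nat_mono) simp
  then show ?case using Cons.IH[of "h a s"] Cons.prems assms(1)[of a s] by simp
qed simp

lemma sz_elem: "a \<in> set xs \<Longrightarrow> sz a \<le> sz xs"
  by (induction xs) auto

lemma pt_fold_add:
  fixes h :: "'c::encodable \<Rightarrow> 'a::encodable \<Rightarrow> 's::encodable \<Rightarrow> 's"
  assumes h: "pt (\<lambda>z. h (fst z) (fst (snd z)) (snd (snd z)))" and l: "pt l" and s: "pt s"
    and bnd: "\<And>x a s. sz (h x a s) \<le> sz s + poly q (sz x + sz a)"
  shows "pt (\<lambda>x. fold (h x) (l x) (s x))"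
proof -
  obtain pl where pl: "\<And>x. sz (l x) \<le> poly pl (sz x)" by (rule pt_sz[OF l]) blast
  obtain ps where ps: "\<And>x. sz (s x) \<le> poly ps (sz x)" by (rule pt_sz[OF s]) blast
  show ?thesis
  proof (rule pt_fold[OF h l s])
    fix x i
    have "sz (fold (h x) (take i (l x)) (s x)) \<le> sz (s x) + length (take i (l x)) * poly q
        (sz x + sz (l x))"
      by (rule sz_fold_add) (use bnd sz_elem in_set_takeD in fast)+
    also have "\<dots> \<le> poly ps (sz x) + poly pl (sz x) * poly q (sz x + poly pl (sz x))"
      using ps[of x] pl[of x] length_le_sz[of "l x"]
      by (intro add_mono mult_mono poly_nat_mono) auto
    finally show "sz (fold (h x) (take i (l x)) (s x)) \<le> poly (ps + pl * pcompose q ([:0, 1:] + pl)) (sz x)"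
      by (simp add: poly_pcompose)
  qed
qed

lemma pt_rev: "pt l \<Longrightarrow> pt (\<lambda>x. rev (l x))"
proof -
  assume "pt l"
  have "pt (\<lambda>x. fold (\<lambda>a s. a # s) (l x) [])"
    by (rule pt_fold_add[where h = "\<lambda>_ a s. a # s" and q = "[:1, 1:]", OF _ \<open>pt l\<close>])
      (auto intro!: pt_Cons pt_fst pt_snd pt_id pt_const)
  then show ?thesis by (rule pt_recode) (simp add: fold_Cons_rev)
qed

lemma pt_foldr_add:
  assumes "pt (\<lambda>z. h (fst z) (fst (snd z)) (snd (snd z)))" "pt l" "pt s"
    "\<And>x a s. sz (h x a s) \<le> sz s + poly q (sz x + sz a)"
  shows "pt (\<lambda>x. foldr (h x) (l x) (s x))"
  using pt_fold_add[OF assms(1) pt_rev[OF assms(2)] assms(3,4)] by (simp add: foldr_conv_fold)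

lemma pt_append: "pt f \<Longrightarrow> pt g \<Longrightarrow> pt (\<lambda>x. f x @ g x)"
proof -
  assume fg: "pt f" "pt g"
  have "pt (\<lambda>x. foldr (\<lambda>a s. a # s) (f x) (g x))"
    by (rule pt_foldr_add[where h = "\<lambda>_ a s. a # s" and q = "[:1, 1:]", OF _ fg])
      (auto intro!: pt_Cons pt_fst pt_snd pt_id pt_const)
  moreover have "foldr (\<lambda>a s. a # s) xs ys = xs @ ys" for xs ys :: "'b list" by (induction xs) auto
  ultimately show ?thesis by simp
qed

lemma sz_append: "sz (xs @ ys) + 1 = sz xs + sz ys"
  by (induction xs) simp_all

lemma pt_concat: "pt l \<Longrightarrow> pt (\<lambda>x. concat (l x))"
proof -
  assume l: "pt l"
  have "sz (a @ s) \<le> sz s + poly [:0, 1:] (n + sz a)" for a s :: "'b list" and n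
    using sz_append[of a s] by simp
  then have "pt (\<lambda>x. foldr (\<lambda>a s. a @ s) (l x) [])"
    by (intro pt_foldr_add[where h = "\<lambda>_ a s. a @ s" and q = "[:0, 1:]", OF _ l])
      (auto intro!: pt_append pt_fst pt_snd pt_id pt_const)
  then show ?thesis by (rule pt_recode) (simp add: concat_conv_foldr)
qed

lemma pt_ctxt:
  fixes g :: "'a::encodable \<Rightarrow> 'b::encodable \<Rightarrow> 'c::encodable"
  assumes "pt (\<lambda>z. g (fst z) (snd z))"
  shows "pt (\<lambda>z :: 'a \<times> 'b \<times> 'd::encodable. g (fst z) (fst (snd z)))"
  using pt_comp[of "\<lambda>z :: 'a \<times> 'b \<times> 'd. (fst z, fst (snd z))", OF _ assms]
  by (simp add: pt_pair pt_fst pt_snd pt_id)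

lemma pt_map:
  fixes g :: "'a::encodable \<Rightarrow> 'b::encodable \<Rightarrow> 'c::encodable"
  assumes "pt (\<lambda>z. g (fst z) (snd z))" "pt l"
  shows "pt (\<lambda>x. map (g x) (l x))"
proof -
  obtain p where p: "\<And>z. sz (g (fst z) (snd z)) \<le> poly p (sz z)" by (rule pt_sz[OF assms(1)]) blast
  have "pt (\<lambda>x. foldr (\<lambda>a s. g x a # s) (l x) [])"
  proof (rule pt_foldr_add[OF _ assms(2) pt_const, where h = "\<lambda>x a s. g x a # s" and q =
      "1 + pcompose p [:1, 1:]"])
    show "pt (\<lambda>z :: 'a \<times> 'b \<times> 'c list. g (fst z) (fst (snd z)) # snd (snd z))"
      by (intro pt_Cons pt_ctxt assms pt_snd pt_id)
    show "sz (g x a # s) \<le> sz s + poly (1 + pcompose p [:1, 1:]) (sz x + sz a)" for x a and s :: "'c list"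
      using p[of "(x, a)"] by (simp add: poly_pcompose)
  qed
  moreover have "foldr (\<lambda>a s. g x a # s) xs [] = map (g x) xs" for x xs by (induction xs) auto
  ultimately show ?thesis by simp
qed

lemma pt_Ball:
  assumes "pt (\<lambda>z. P (fst z) (snd z))" "pt l"
  shows "pt (\<lambda>x. \<forall>a \<in> set (l x). P x a)"
proof -
  have "pt (\<lambda>x. foldr (\<lambda>a b. P x a \<and> b) (l x) True)"
  proof (rule pt_foldr_add[OF _ assms(2) pt_const, where h = "\<lambda>x a b. P x a \<and> b" and q = "[:3:]"])
    show "pt (\<lambda>z. P (fst z) (fst (snd z)) \<and> snd (snd z))"
      by (intro pt_conj pt_ctxt assms pt_snd pt_id)
    show "sz (P x a \<and> s) \<le> sz s + poly [:3:] (sz x + sz a)" for x a s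
      using sz_bool[of "P x a \<and> s"] by simp
  qed
  moreover have "foldr (\<lambda>a b. P x a \<and> b) xs True = (\<forall>a \<in> set xs. P x a)" for x xs by (induction xs) auto
  ultimately show ?thesis by simp
qed

lemma pt_Bex: "pt (\<lambda>z. P (fst z) (snd z)) \<Longrightarrow> pt l \<Longrightarrow> pt (\<lambda>x. \<exists>a \<in> set (l x). P x a)"
  using pt_not[OF pt_Ball[OF pt_not[of "\<lambda>z. P (fst z) (snd z)"]], of l] by simp

text \<open>In unary, the length of a list is the list itself with every entry replaced by a unit.
  Sums, products and differences are then lengths of appended, repeated and shortened lists of
  units.\<close>

lemma pt_length: "pt l \<Longrightarrow> pt (\<lambda>x. length (l x))"
proof -
  assume l: "pt l"
  have "pt (\<lambda>x. map (\<lambda>_. ()) (l x))" by (rule pt_map[OF pt_const l])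
  moreover have "tr (length xs) = tr (map (\<lambda>_. ()) xs)" for xs :: "'b list" by (induction xs) simp_all
  ultimately show ?thesis by (rule pt_recode)
qed

lemma pt_replicate_unit: "pt n \<Longrightarrow> pt (\<lambda>x. replicate (n x) ())"
proof (erule pt_recode)
  have "tr (replicate k ()) = tr k" for k by (induction k) simp_all
  then show "tr (replicate (n x) ()) = tr (n x)" for x .
qed

lemma pt_Suc: "pt f \<Longrightarrow> pt (\<lambda>x. Suc (f x))"
  by (rule pt_recode[OF pt_pair[OF pt_const[of "()"]]]) simp_all

lemma pt_plus: "pt f \<Longrightarrow> pt g \<Longrightarrow> pt (\<lambda>x. f x + g x :: nat)"
  using pt_length[OF pt_append[OF pt_replicate_unit pt_replicate_unit], of f g] by simp

lemma pt_mult: "pt f \<Longrightarrow> pt g \<Longrightarrow> pt (\<lambda>x. f x * g x :: nat)"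
proof -
  assume fg: "pt f" "pt g"
  have "pt (\<lambda>x. length (concat (map (\<lambda>_. replicate (g x) ()) (replicate (f x) ()))))"
    by (intro pt_length pt_concat pt_map pt_replicate_unit pt_comp[OF pt_fst[OF pt_id] fg(2)] fg)
  then show ?thesis by (rule pt_recode) (simp add: map_replicate length_concat sum_list_replicate)
qed

lemma pt_drop: "pt n \<Longrightarrow> pt l \<Longrightarrow> pt (\<lambda>x. drop (n x) (l x))"
proof -
  assume nl: "pt n" "pt l"
  have "sz (tl s) \<le> sz s + poly 1 k" for s :: "'b list" and k by (cases s) simp_all
  then have "pt (\<lambda>x. fold (\<lambda>_ s. tl s) (replicate (n x) ()) (l x))"
    by (intro pt_fold_add[where h = "\<lambda>_ _ s. tl s" and q = 1, OF _ pt_replicate_unit[OF nl(1)] nl(2)])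
      (intro pt_tl pt_snd pt_id)
  moreover have "fold (\<lambda>_ s. tl s) (replicate n ()) xs = drop n xs" for n and xs :: "'b list"
    by (induction n arbitrary: xs) (simp_all add: drop_Suc)
  ultimately show ?thesis by simp
qed

lemma pt_minus: "pt f \<Longrightarrow> pt g \<Longrightarrow> pt (\<lambda>x. f x - g x :: nat)"
  using pt_length[OF pt_drop[OF _ pt_replicate_unit], of g f] by simp

lemma pt_le: "pt f \<Longrightarrow> pt g \<Longrightarrow> pt (\<lambda>x. f x \<le> (g x :: nat))"
  using pt_null[OF pt_replicate_unit[OF pt_minus], of f g] by simp

lemma pt_less: "pt f \<Longrightarrow> pt g \<Longrightarrow> pt (\<lambda>x. f x < (g x :: nat))"
  using pt_le[OF pt_Suc, of f g] by (simp add: Suc_le_eq)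

lemma pt_eq_nat: "pt f \<Longrightarrow> pt g \<Longrightarrow> pt (\<lambda>x. f x = (g x :: nat))"
  using pt_conj[OF pt_le pt_le, of f g g f] by (simp add: eq_iff)

text \<open>Each round pushes the length of the accumulator, so the increment does depend on it and
  \<open>pt_fold_add\<close> does not apply. The quadratic size of the list is bounded
  directly.\<close>

lemma pt_upt: "pt f \<Longrightarrow> pt (\<lambda>x. [0..<f x])"
proof -
  assume f: "pt f"
  obtain p where p: "\<And>x. sz (f x) \<le> poly p (sz x)" by (rule pt_sz[OF f]) blast
  have upt: "fold (\<lambda>_ s. length s # s) (replicate n ()) [] = rev [0..<n]" for n
  proof -
    have "fold (\<lambda>_ s. length s # s) (replicate n ()) (rev [0..<m]) = rev [0..<n + m]" for m
    proof (induction n arbitrary: m)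
      case (Suc n)
      from Suc.IH[of "Suc m"] show ?case by simp
    qed simp
    from this[of 0] show ?thesis by simp
  qed
  have "pt (\<lambda>x. rev (fold (\<lambda>_ s. length s # s) (replicate (f x) ()) []))"
  proof (rule pt_rev, rule pt_fold[where h = "\<lambda>_ _ s. length s # s", OF _ pt_replicate_unit[OF f] pt_const])
    show "pt (\<lambda>z :: 'a \<times> unit \<times> nat list. length (snd (snd z)) # snd (snd z))"
      by (intro pt_Cons pt_length pt_snd pt_id)
    fix x i assume i: "i \<le> length (replicate (f x) ())"
    have "sz [0..<n] \<le> 1 + 2 * n * n" for n
    proof (induction n)
      case (Suc n)
      with sz_append[of "[0..<n]" "[n]"] show ?case by (simp add: algebra_simps)
    qed simp
    note this[of i]
    moreover have "i * i \<le> poly p (sz x) * poly p (sz x)"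
      using i p[of x] by (intro mult_le_mono) simp_all
    ultimately have "sz [0..<i] \<le> poly (1 + p * p + p * p) (sz x)" by simp
    moreover have "sz (rev [0..<i]) = sz [0..<i]" by (simp add: sz_list flip: rev_map)
    ultimately show "sz (fold (\<lambda>_ s. length s # s) (take i (replicate (f x) ())) []) \<le> poly
        (1 + p * p + p * p) (sz x)"
      using i by (simp only: length_replicate take_replicate min_absorb1 upt)
  qed
  then show ?thesis by (simp only: upt rev_rev_ident)
qed

lemma pt_poly: "pt f \<Longrightarrow> pt (\<lambda>x. poly p (f x) :: nat)"
  by (induction p) (auto intro!: pt_const pt_plus pt_mult)

text \<open>Beyond the end of a list \<open>!\<close> has no specified value, and a program must
  return a definite one.\<close>

definition nth_or :: "'a \<Rightarrow> 'a list \<Rightarrow> nat \<Rightarrow> 'a" where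
  "nth_or d xs i = (if i < length xs then xs ! i else d)"

lemma pt_nth_or: "pt d \<Longrightarrow> pt l \<Longrightarrow> pt n \<Longrightarrow> pt (\<lambda>x. nth_or (d x) (l x) (n x))"
proof -
  assume *: "pt d" "pt l" "pt n"
  have "pt (\<lambda>x. case drop (n x) (l x) of [] \<Rightarrow> d x | a # t \<Rightarrow> a)"
    by (intro pt_case_list pt_drop * pt_fst pt_id)
  moreover have "(case drop n xs of [] \<Rightarrow> e | a # t \<Rightarrow> a) = nth_or e xs n" for n xs and e :: 'b
    by (cases "n < length xs") (simp_all add: nth_or_def Cons_nth_drop_Suc[symmetric])
  ultimately show ?thesis by simp
qed

lemma pt_eq_bools: "pt f \<Longrightarrow> pt g \<Longrightarrow> pt (\<lambda>x. f x = (g x :: bool list))"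
proof -
  assume fg: "pt f" "pt g"
  define h :: "bool \<Rightarrow> bool list \<times> bool \<Rightarrow> bool list \<times> bool" where
    "h a s = (case fst s of [] \<Rightarrow> ([], False) | b # t \<Rightarrow> (t, snd s \<and> a = b))" for a s
  have "pt (\<lambda>z :: 'a \<times> bool \<times> bool list \<times> bool. h (fst (snd z)) (snd (snd z)))"
    unfolding h_def by (intro pt_case_list pt_pair pt_conj pt_eq_bool pt_fst pt_snd pt_id pt_const)
  then have "pt (\<lambda>x. fold h (f x) (g x, True))"
  proof (rule pt_fold_add[where h = "\<lambda>_. h" and q = "[:10:]", OF _ fg(1)])
    show "sz (h a s) \<le> sz s + poly [:10:] (sz x + sz a)" for x :: 'a and a s
      using sz_bool by (cases s) (auto simp: h_def sz_def split: list.split)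
  qed (intro pt_pair fg pt_const)
  then have "pt (\<lambda>x. fst (fold h (f x) (g x, True)) = [] \<and> snd (fold h (f x) (g x, True)))"
    by (intro pt_conj pt_null pt_fst pt_snd)
  moreover have "fst (fold h xs (ys, b)) = [] \<and> snd (fold h xs (ys, b)) \<longleftrightarrow> xs = ys \<and> b" for xs ys b
  proof (induction xs arbitrary: ys b)
    case (Cons a xs)
    then show ?case by (cases ys) (auto simp: h_def)
  qed auto
  ultimately show ?thesis by simp
qed

lemma enc_list_concat: "enc_list ws = concat (map (\<lambda>w. True # w) ws) @ [False]"
  by (induction ws) simp_all

lemma pt_enc_list: "pt f \<Longrightarrow> pt (\<lambda>x. enc_list (f x))"
  unfolding enc_list_concat by (intro pt_append pt_concat pt_map pt_Cons pt_snd pt_id pt_const)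


subsection \<open>Trees as data\<close>

text \<open>The right spine read as a list. Every tree is the code of exactly one list of trees, so
  data decoded along this view are never malformed.\<close>

definition children :: "tree \<Rightarrow> tree list" where
  "children t = rec_tree [] (\<lambda>a b _ bs. a # bs) t"

lemma children_simps [simp]: "children Leaf = []" "children (Node a b) = a # children b"
  by (simp_all add: children_def)

definition car :: "tree \<Rightarrow> tree" where
  "car t = (case t of Leaf \<Rightarrow> Leaf | Node a b \<Rightarrow> a)"

definition cdr :: "tree \<Rightarrow> tree" where
  "cdr t = (case t of Leaf \<Rightarrow> Leaf | Node a b \<Rightarrow> b)"

lemma car_cdr_simps [simp]: "car Leaf = Leaf" "car (Node a b) = a" "cdr Leaf = Leaf" "cdr (Node a b) = b"
  by (simp_all add: car_def cdr_def)

lemma tr_children [simp]: "tr (children t) = t"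
  by (induction t) simp_all

lemma sz_children: "sz (children t) = sz t"
  by (simp add: sz_def)

lemma pt_children: "pt f \<Longrightarrow> pt (\<lambda>x. children (f x))"
  by (erule pt_recode) simp

lemma pt_car: "pt f \<Longrightarrow> pt (\<lambda>x. car (f x))"
  by (rule pt_recode[OF pt_case_list[OF pt_children pt_const[of Leaf] pt_fst[OF pt_fst[OF pt_id]]]])
    (auto simp: car_def split: tree.split)

lemma pt_cdr: "pt f \<Longrightarrow> pt (\<lambda>x. cdr (f x))"
  by (rule pt_recode[OF pt_case_list[OF pt_children pt_const[of "[]"] pt_snd[OF pt_fst[OF pt_id]]]])
    (auto simp: cdr_def split: tree.split)

lemma pt_is_Leaf: "pt f \<Longrightarrow> pt (\<lambda>x. f x = Leaf)"
  by (rule pt_recode[OF pt_null[OF pt_children]]) (auto, metis children_simps(1) tr_children tr_simps(2))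

text \<open>Stack evaluation of prefix notation read from its right end: a \<open>False\<close>
  pushes the value \<open>e\<close> of a leaf, a \<open>True\<close> combines the two topmost
  values. With fewer than two values the stack is kept, so that any word is accepted.\<close>

definition pstep :: "'b \<Rightarrow> ('b \<Rightarrow> 'b \<Rightarrow> 'b) \<Rightarrow> bool \<Rightarrow> 'b list \<Rightarrow> 'b list" where
  "pstep e g b st = (if b then (case st of [] \<Rightarrow> st | x # r \<Rightarrow> (case r of [] \<Rightarrow> st | y # r' \<Rightarrow> g x y # r'))
      else e # st)"

lemma pt_pstep:
  assumes "pt (\<lambda>z. g (fst z) (snd z))"
  shows "pt (\<lambda>z :: 'a::encodable \<times> bool \<times> 'b::encodable list. pstep e g (fst (snd z)) (snd (snd z)))"
proof -
  have g: "pt (\<lambda>z. g (u z) (v z))" if "pt u" "pt v" for u v :: "'c::encodable \<Rightarrow> 'b"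
    using pt_comp[OF pt_pair[OF that] assms] by simp
  show ?thesis
    unfolding pstep_def by (intro pt_if pt_case_list g pt_Cons pt_fst pt_snd pt_id pt_const)
qed

lemma pstep_code: "foldr (pstep Leaf Node) (code t) st = t # st"
  by (induction t arbitrary: st) (simp_all, simp_all add: pstep_def)

lemma pstep_size: "(\<Sum>t\<leftarrow>foldr (pstep Leaf Node) s []. sz t) \<le> length s"
  by (induction s) (auto simp: pstep_def split: list.split)

definition parse :: "bool list \<Rightarrow> tree" where
  "parse s = (case foldr (pstep Leaf Node) s [] of [] \<Rightarrow> Leaf | t # _ \<Rightarrow> t)"

lemma parse_code: "parse (code t) = t"
  using pstep_code[of t "[]"] by (simp add: parse_def)

lemma pt_Node: "pt f \<Longrightarrow> pt g \<Longrightarrow> pt (\<lambda>x. Node (f x) (g x))"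
  by (rule pt_recode[OF pt_pair[of f g]]) simp_all

text \<open>Structural recursion becomes iteration over the prefix code read backwards. At any time
  the stack of values is the image under \<open>F\<close> of the stack of subtrees parsed so far.
  Their total size is at most that of the whole tree, so the bound on single values bounds the whole
  stack.\<close>

lemma pt_tree_fold:
  fixes F :: "tree \<Rightarrow> 'b::encodable"
  assumes g: "pt (\<lambda>z. g (fst z) (snd z))"
    and F: "F Leaf = e" "\<And>a b. F (Node a b) = g (F a) (F b)"
    and bnd: "\<And>t. sz (F t) \<le> poly p (sz t)"
  shows "pt F"
proof -
  have nat: "foldr (pstep e g) s [] = map F (foldr (pstep Leaf Node) s [])" for s
    by (induction s) (auto simp: pstep_def F split: list.split)
  have "pt (\<lambda>t. fold (pstep e g) (rev (code t)) [])"
  proof (rule pt_fold[where h = "\<lambda>_. pstep e g", OF pt_pstep[OF g] pt_rev[OF pt_code] pt_const])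
    fix t :: tree and i
    let ?st = "foldr (pstep Leaf Node) (drop (length (code t) - i) (code t)) []"
    have size: "(\<Sum>u\<leftarrow>?st. sz u) \<le> sz t"
      using pstep_size[of "drop (length (code t) - i) (code t)"] by (simp add: sz_def)
    have "sz (map F us) \<le> 1 + (\<Sum>u\<leftarrow>us. sz u) * (1 + poly p (\<Sum>u\<leftarrow>us. sz u))" for us
    proof (induction us)
      case (Cons u us)
      have "Suc (sz (F u)) \<le> sz u * (1 + poly p (sz u + (\<Sum>u\<leftarrow>us. sz u)))"
        using bnd[of u] poly_nat_mono[of "sz u" "sz u + (\<Sum>u\<leftarrow>us. sz u)" p]
          mult_le_mono1[OF sz_pos(2)[of u], of "1 + poly p (sz u + (\<Sum>u\<leftarrow>us. sz u))"] by simp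
      moreover have "(\<Sum>u\<leftarrow>us. sz u) * (1 + poly p (\<Sum>u\<leftarrow>us. sz u)) \<le>
         (\<Sum>u\<leftarrow>us. sz u) * (1 + poly p (sz u + (\<Sum>u\<leftarrow>us. sz u)))"
        by (intro mult_left_mono add_left_mono poly_nat_mono) auto
      moreover have "(sz u + (\<Sum>u\<leftarrow>us. sz u)) * (1 + poly p (sz u + (\<Sum>u\<leftarrow>us. sz u))) =
         sz u * (1 + poly p (sz u + (\<Sum>u\<leftarrow>us. sz u))) + (\<Sum>u\<leftarrow>us. sz u) * (1 + poly p (sz u + (\<Sum>u\<leftarrow>us. sz u)))"
        by (rule distrib_right)
      ultimately show ?case using Cons.IH unfolding list.map sz_simps sum_list.Cons by linarith
    qed simp
    also have "1 + (\<Sum>u\<leftarrow>?st. sz u) * (1 + poly p (\<Sum>u\<leftarrow>?st. sz u)) \<le> 1 + sz t * (1 + poly p (sz t))"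
      using size by (intro add_left_mono mult_mono poly_nat_mono) auto
    finally have "sz (map F ?st) \<le> poly (1 + [:0, 1:] * (1 + p)) (sz t)" by simp
    then show "sz (fold (pstep e g) (take i (rev (code t))) []) \<le> poly (1 + [:0, 1:] * (1 + p)) (sz t)"
      by (simp add: take_rev nat flip: foldr_conv_fold)
  qed
  then have "pt (\<lambda>t. case fold (pstep e g) (rev (code t)) [] of [] \<Rightarrow> e | x # _ \<Rightarrow> x)"
    by (intro pt_case_list pt_const pt_fst pt_id)
  moreover have "(case fold (pstep e g) (rev (code t)) [] of [] \<Rightarrow> e | x # _ \<Rightarrow> x) = F t" for t
    using pstep_code[of t "[]"] by (simp add: nat F flip: foldr_conv_fold)
  ultimately show ?thesis by simp
qed

lemma pt_parse: "pt f \<Longrightarrow> pt (\<lambda>x. parse (f x))"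
proof -
  assume f: "pt f"
  have "pt (\<lambda>x. foldr (pstep Leaf Node) (f x) [])"
  proof (rule pt_foldr_add[where h = "\<lambda>_. pstep Leaf Node" and q = "[:10:]", OF _ f pt_const])
    show "pt (\<lambda>z :: 'a \<times> bool \<times> tree list. pstep Leaf Node (fst (snd z)) (snd (snd z)))"
      by (intro pt_pstep pt_Node pt_fst pt_snd pt_id)
  qed (auto simp: pstep_def split: list.split)
  then show ?thesis unfolding parse_def by (intro pt_case_list pt_const pt_fst pt_id)
qed

lemmas pt_rules = pt_const pt_id pt_fst pt_snd pt_pair pt_Cons pt_if pt_not pt_conj pt_disj pt_imp
  pt_eq_bool pt_null pt_tl pt_rev pt_append pt_concat pt_map pt_Ball pt_Bex pt_length
  pt_Suc pt_plus pt_mult pt_drop pt_minus pt_le pt_less pt_eq_nat pt_upt pt_poly pt_nth_or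
  pt_eq_bools pt_enc_list pt_children pt_car pt_cdr pt_is_Leaf pt_Node pt_parse pt_case_list


subsection \<open>Membership in NP by tree certificates\<close>

text \<open>Splits \<open>enc_pair w u\<close> in one pass. The first flag says that the end mark of
  \<open>w\<close> has been passed and bits belong to \<open>u\<close>; the second that the next bit
  is an entry of \<open>w\<close>.\<close>

definition unpair_step :: "bool \<Rightarrow> (bool \<times> bool) \<times> bool list \<times> bool list \<Rightarrow> (bool \<times> bool) \<times> bool list \<times> bool
    list" where
  "unpair_step b s =
     (if fst (fst s) then (fst s, (fst (snd s), b # snd (snd s)))
      else if snd (fst s) then ((False, False), (b # fst (snd s), snd (snd s)))
      else if b then ((False, True), snd s) else ((True, False), snd s))"

definition unpair :: "bool list \<Rightarrow> bool list \<times> bool list" where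
  "unpair z = (let s = snd (fold unpair_step z ((False, False), ([], []))) in (rev (fst s), rev (snd s)))"

lemma unpair_enc_pair: "unpair (enc_pair w u) = (w, u)"
proof -
  have 1: "fold unpair_step u ((True, False), (x, y)) = ((True, False), (x, rev u @ y))" for x y
    by (induction u arbitrary: y) (simp_all add: unpair_step_def)
  have "fold unpair_step (enc_pair w u) ((False, False), (x, [])) = ((True, False), (rev w @ x, rev u))"
      for x
    using 1 by (induction w arbitrary: x) (simp_all add: enc_pair_def unpair_step_def)
  then show ?thesis by (simp add: unpair_def)
qed

lemma pt_unpair: "pt f \<Longrightarrow> pt (\<lambda>x. unpair (f x))"
proof -
  assume f: "pt f"
  have "pt (\<lambda>x. fold unpair_step (f x) ((False, False), ([], [])))"
  proof (rule pt_fold_add[where h = "\<lambda>_. unpair_step" and q = "[:10:]", OF _ f pt_const])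
    show "pt (\<lambda>z :: 'a \<times> bool \<times> (bool \<times> bool) \<times> bool list \<times> bool list. unpair_step (fst (snd z))
        (snd (snd z)))"
      unfolding unpair_step_def by (intro pt_if pt_rules)
    show "sz (unpair_step b s) \<le> sz s + poly [:10:] (sz x + sz b)" for x :: 'a and b s
      using sz_bool[of b] sz_bool[of True]
      by (cases s) (auto simp: unpair_step_def sz_def split: if_splits)
  qed
  then show ?thesis unfolding unpair_def Let_def by (intro pt_rules)
qed

text \<open>Any word parses to some tree, so certificates have no syntax to be checked; conversely a
  tree is handed over as its prefix code, of length \<open>sz t\<close>.\<close>

theorem in_NP_I:
  assumes chk: "pt (\<lambda>z :: bool list \<times> tree. chk (fst z) (snd z))"
    and complete: "\<And>w. w \<in> L \<Longrightarrow> \<exists>t. sz t \<le> poly p (length w) \<and> chk w t"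
    and sound: "\<And>w t. chk w t \<Longrightarrow> w \<in> L"
  shows "in_NP L"
proof -
  define V where "V = {z. chk (fst (unpair z)) (parse (snd (unpair z)))}"
  have "pt (\<lambda>z. chk (fst (fst (unpair z), parse (snd (unpair z))))
      (snd (fst (unpair z), parse (snd (unpair z)))))"
    by (rule pt_comp[OF _ chk]) (intro pt_rules pt_unpair)
  then have "pt (\<lambda>z. [z \<in> V])" by (intro pt_Cons pt_const) (simp add: V_def)
  then have "in_P V" unfolding in_P_def by (rule polytime_pt)
  moreover have "w \<in> L \<longleftrightarrow> (\<exists>u. length u \<le> poly p (length w) \<and> enc_pair w u \<in> V)" for w
  proof
    assume "w \<in> L"
    then obtain t where "sz t \<le> poly p (length w)" "chk w t" using complete by blast
    then have "length (code t) \<le> poly p (length w) \<and> enc_pair w (code t) \<in> V"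
      by (simp add: V_def unpair_enc_pair parse_code sz_def)
    then show "\<exists>u. length u \<le> poly p (length w) \<and> enc_pair w u \<in> V" by blast
  next
    show "\<exists>u. length u \<le> poly p (length w) \<and> enc_pair w u \<in> V \<Longrightarrow> w \<in> L"
      using sound by (auto simp: V_def unpair_enc_pair)
  qed
  ultimately show ?thesis unfolding in_NP_def by blast
qed


section \<open>Membership in NP\<close>

subsection \<open>Decoding certificates\<close>

fun val :: "bool list \<Rightarrow> nat" where
  "val [] = 0"
| "val (b # bs) = of_bool b + 2 * val bs"

text \<open>With the least significant bit first, leading zeros stand at the end. Removing them
  gives the canonical bits of the number, computed without the number itself, which could be
  exponentially large in unary.\<close>

definition strip :: "bool list \<Rightarrow> bool list" where
  "strip bs = foldr (\<lambda>b r. if r = [] \<and> \<not> b then [] else b # r) bs []"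

lemma nat_bits_0 [simp]: "nat_bits 0 = []"
  by (simp add: nat_bits.simps)

lemma nat_bits_pos: "n \<noteq> 0 \<Longrightarrow> nat_bits n = odd n # nat_bits (n div 2)"
  by (subst nat_bits.simps) simp

lemma nat_bits_val: "nat_bits (val bs) = strip bs"
proof (induction bs)
  case (Cons b bs)
  have "strip bs = [] \<longleftrightarrow> val bs = 0"
    using Cons.IH nat_bits_pos[of "val bs"] by (cases "val bs = 0") auto
  then show ?case using Cons.IH nat_bits_pos[of "val (b # bs)"]
    by (cases "val (b # bs) = 0") (auto simp: strip_def of_bool_def split: if_splits)
qed (simp add: strip_def)

lemma val_nat_bits: "val (nat_bits n) = n"
proof (induction n rule: less_induct)
  case (less n)
  show ?case
  proof (cases "n = 0")
    case False
    then show ?thesis using less.IH[of "n div 2"] by (simp add: nat_bits_pos of_bool_def)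
  qed simp
qed

definition dbits :: "tree \<Rightarrow> bool list" where
  "dbits t = map (\<lambda>t. t \<noteq> Leaf) (children t)"

definition dnat :: "tree \<Rightarrow> nat" where
  "dnat t = val (dbits t)"

lemma enc_dnat: "enc_nat (dnat t) = enc_list (map (\<lambda>b. [b]) (strip (dbits t)))"
  by (simp add: enc_nat_def dnat_def nat_bits_val)

lemma size_children [termination_simp]: "x \<in> set (children t) \<Longrightarrow> size x < Suc (n + size t)"
proof -
  assume "x \<in> set (children t)"
  then have "size x < size t" by (induction t) auto
  then show ?thesis by simp
qed

text \<open>Total, with an arbitrary constant for the leaf, and always ground; hence every
  certificate decodes to a legal instance.\<close>

fun dterm :: "tree \<Rightarrow> fterm" where
  "dterm Leaf = Fun 0 []"
| "dterm (Node a b) = Fun (dnat a) (map dterm (children b))"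

definition dlit :: "tree \<Rightarrow> literal" where
  "dlit t = (if car t = Leaf then Neg else Pos) (dnat (car (cdr t))) (map dterm (children (cdr (cdr t))))"

text \<open>A variable number is a position in the guard, small enough to be unary. A constant name
  comes from the instance and stays a list of bits.\<close>

definition darg :: "tree \<Rightarrow> fterm" where
  "darg a = (if car a = Leaf then Var (length (children (cdr a))) else Fun (dnat (cdr a)) [])"

definition dhyp :: "tree \<Rightarrow> literal" where
  "dhyp t = (if car t = Leaf then Neg else Pos) (dnat (car (cdr t))) (map darg (children (cdr (cdr t))))"

definition inst_arg :: "tree list \<Rightarrow> tree \<Rightarrow> tree" where
  "inst_arg ts a = (if car a = Leaf then nth_or Leaf ts (length (children (cdr a))) else Node (cdr a) Leaf)"

text \<open>An instantiated literal is produced as a word and compared with the words of the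
  example's literals, which is faithful because the encoding is injective. Comparing trees would be
  wrong: leading zeros give the same literal several trees.\<close>

definition inst_str :: "tree list \<Rightarrow> tree \<Rightarrow> bool list" where
  "inst_str ts R = (car R \<noteq> Leaf) # enc_nat (dnat (car (cdr R))) @
     enc_list (map (\<lambda>a. enc_term (dterm (inst_arg ts a))) (children (cdr (cdr R))))"

definition dsubst :: "tree list \<Rightarrow> nat \<Rightarrow> fterm" where
  "dsubst ts j = dterm (nth_or Leaf ts j)"

lemma inst_str: "inst_str ts R = enc_literal (subst (dsubst ts) (dhyp R))"
  by (auto simp: inst_str_def dhyp_def darg_def inst_arg_def dsubst_def o_def intro!:
      arg_cong[where f = enc_list])

lemma enc_dlit: "enc_literal (dlit t) =
    (car t \<noteq> Leaf) # enc_nat (dnat (car (cdr t))) @ enc_list (map (\<lambda>a. enc_term (dterm a))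
        (children (cdr (cdr t))))"
  by (auto simp: dlit_def o_def)

lemma enc_literal_inj: "enc_literal R = enc_literal S \<longleftrightarrow> R = S"
  using enc_literal_prefix[of R "[]" S "[]"] by auto

lemma vars_dterm [simp]: "vars_term (dterm t) = {}"
  by (induction t rule: dterm.induct) auto

lemma vars_dlit [simp]: "vars (dlit t) = {}"
  by (auto simp: dlit_def vars_def)

lemma pt_strip: "pt f \<Longrightarrow> pt (\<lambda>x. strip (f x))"
proof -
  assume f: "pt f"
  have "sz (if r = [] \<and> \<not> b then [] else b # r) \<le> sz r + poly [:0, 2:] (n + sz b)"
      for n b and r :: "bool list"
    using sz_pos(2)[of b] by (auto simp: sz_pos)
  then show ?thesis unfolding strip_def
    by (intro pt_foldr_add[where h = "\<lambda>_ b r. if r = [] \<and> \<not> b then [] else b # r" and q =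
        "[:0, 2:]", OF _ f pt_const])
      (intro pt_rules)
qed

lemma pt_dbits: "pt f \<Longrightarrow> pt (\<lambda>x. dbits (f x))"
  unfolding dbits_def by (intro pt_rules)

lemma pt_enc_dnat: "pt f \<Longrightarrow> pt (\<lambda>x. enc_nat (dnat (f x)))"
  unfolding enc_dnat by (intro pt_rules pt_strip pt_dbits)

lemma length_enc_list: "length (enc_list ws) = Suc (\<Sum>w\<leftarrow>ws. Suc (length w))"
  by (induction ws) simp_all

lemma length_enc_nat: "length (enc_nat n) = Suc (2 * length (nat_bits n))"
proof -
  have "(\<Sum>w\<leftarrow>map (\<lambda>b. [b]) bs. Suc (length w)) = 2 * length bs" for bs by (induction bs) simp_all
  then show ?thesis by (simp add: enc_nat_def length_enc_list)
qed

lemma length_enc_dnat: "length (enc_nat (dnat t)) \<le> Suc (2 * sz t)"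
proof -
  have "length (strip bs) \<le> length bs" for bs by (induction bs) (auto simp: strip_def)
  then have "length (strip (dbits t)) \<le> length (children t)" by (metis dbits_def length_map)
  also have "\<dots> \<le> sz t" using length_le_sz[of "children t"] by (simp add: sz_children)
  finally show ?thesis by (simp add: length_enc_nat dnat_def nat_bits_val)
qed

text \<open>A tree acts both as a term and, inside a larger term, as a list of arguments. Carrying
  both encodings, together with the tree itself for the function name, makes the recursion
  structural on binary trees.\<close>

lemma pt_enc_dterm: "pt f \<Longrightarrow> pt (\<lambda>x. enc_term (dterm (f x)))"
proof -
  assume f: "pt f"
  define F where "F t = (t, (enc_term (dterm t), enc_list (map (\<lambda>a. enc_term (dterm a)) (children t))))"
      for t
  have len: "length (fst (snd (F t))) \<le> 4 * sz t \<and> length (snd (snd (F t))) \<le> 4 * sz t" for t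
  proof (induction t)
    case (Node a b)
    then show ?case using length_enc_dnat[of a] by (simp add: F_def o_def)
  qed (simp add: F_def enc_nat_def)
  have "pt F"
  proof (rule pt_tree_fold[where g = "\<lambda>u v. (Node (fst u) (fst v),
        (True # enc_nat (dnat (fst u)) @ snd (snd v), True # fst (snd u) @ snd (snd v)))"])
    show "sz (F t) \<le> poly [:10, 40:] (sz t)" for t
    proof -
      have "sz (F t) = 2 + (sz t + (sz (fst (snd (F t))) + sz (snd (snd (F t)))))" by (simp add: F_def)
      also have "\<dots> \<le> 2 + (sz t + ((1 + 4 * (4 * sz t)) + (1 + 4 * (4 * sz t))))"
        using len[of t] sz_bools[of "fst (snd (F t))"] sz_bools[of "snd (snd (F t))"] by linarith
      finally show ?thesis by simp
    qed
    show "F (Node a b) = (Node (fst (F a)) (fst (F b)), (True # enc_nat (dnat (fst (F a))) @ snd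
        (snd (F b)),
        True # fst (snd (F a)) @ snd (snd (F b))))" for a b
      by (simp add: F_def o_def)
  qed (intro pt_rules pt_enc_dnat, rule refl)
  from pt_fst[OF pt_snd[OF pt_comp[OF f this]]] show ?thesis by (simp add: F_def)
qed

lemma pt_enc_dlit: "pt f \<Longrightarrow> pt (\<lambda>x. enc_literal (dlit (f x)))"
  unfolding enc_dlit by (intro pt_rules pt_enc_dnat pt_enc_dterm)

lemma pt_inst_str: "pt f \<Longrightarrow> pt g \<Longrightarrow> pt (\<lambda>x. inst_str (f x) (g x))"
proof -
  assume fg: "pt f" "pt g"
  have "pt (\<lambda>z :: tree list \<times> tree. inst_str (fst z) (snd z))"
    unfolding inst_str_def inst_arg_def by (intro pt_rules pt_enc_dnat pt_enc_dterm)
  from pt_comp[OF pt_pair[OF fg] this] show ?thesis by simp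
qed

definition lit_args :: "tree \<Rightarrow> tree list" where
  "lit_args t = children (cdr (cdr t))"

text \<open>\<open>L\<close> merely supplies the substitution, as its list of arguments. That the
  guard is mapped into \<open>e\<close> is part of the condition on \<open>hs\<close>.\<close>

definition subs :: "tree list \<Rightarrow> tree list \<Rightarrow> bool" where
  "subs hs e \<longleftrightarrow> (\<exists>L \<in> set e. \<forall>R \<in> set hs. \<exists>K \<in> set e. inst_str (lit_args L) R = enc_literal (dlit K))"

text \<open>In a normalised hypothesis the variables are numbered by their positions in the guard, so
  that the image of the guard, as a list of arguments, is itself the substitution.\<close>

definition normal :: "tree \<Rightarrow> tree list \<Rightarrow> bool" where
  "normal g hs \<longleftrightarrow> (\<forall>R \<in> set hs. \<forall>a \<in> set (lit_args R). car a = Leaf \<longrightarrow>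
     (car (nth_or (Node (Node Leaf Leaf) Leaf) (lit_args g) (length (children (cdr a)))) = Leaf \<and>
      length (children (cdr (nth_or (Node (Node Leaf Leaf) Leaf) (lit_args g)
          (length (children (cdr a)))))) =
        length (children (cdr a))))"

lemma subs_iff: "subs hs e \<longleftrightarrow> (\<exists>L \<in> set e. \<forall>R \<in> set hs. subst (dsubst (lit_args L)) (dhyp R) \<in> dlit ` set e)"
  by (simp add: subs_def inst_str enc_literal_inj image_iff)

lemma vars_dhyp: "x \<in> vars (dhyp R) \<longleftrightarrow> (\<exists>a \<in> set (lit_args R). car a = Leaf \<and> x = length (children (cdr a)))"
proof -
  have "vars (dhyp R) = (\<Union>a \<in> set (lit_args R). vars_term (darg a))"
    by (simp add: vars_def dhyp_def lit_args_def)
  moreover have "x \<in> vars_term (darg a) \<longleftrightarrow> car a = Leaf \<and> x = length (children (cdr a))" for a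
    by (simp add: darg_def)
  ultimately show ?thesis by blast
qed

lemma normal_guard:
  assumes "normal g hs" "R \<in> set hs" "x \<in> vars (dhyp R)"
  shows "x < length (lit_args g) \<and> darg (lit_args g ! x) = Var x"
proof -
  let ?b = "nth_or (Node (Node Leaf Leaf) Leaf) (lit_args g) x"
  obtain a where "a \<in> set (lit_args R)" "car a = Leaf" "x = length (children (cdr a))"
    using assms(3) unfolding vars_dhyp by blast
  then have b: "car ?b = Leaf" "length (children (cdr ?b)) = x"
    using assms(1,2) unfolding normal_def by blast+
  \<comment> \<open>The default in \<open>normal\<close> has a non-leaf \<open>car\<close> and so
    stands for a constant; an index beyond the guard fails the test.\<close>
  then have "x < length (lit_args g)" by (auto simp: nth_or_def split: if_splits)
  then show ?thesis using b by (simp add: nth_or_def darg_def)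
qed

lemma subst_term_cong: "(\<And>x. x \<in> vars_term t \<Longrightarrow> \<theta> x = \<sigma> x) \<Longrightarrow> subst_term \<theta> t = subst_term \<sigma> t"
  by (induction t rule: vars_term.induct) auto

lemma subst_cong: "(\<And>x. x \<in> vars R \<Longrightarrow> \<theta> x = \<sigma> x) \<Longrightarrow> subst \<theta> R = subst \<sigma> R"
  by (cases R) (auto simp: vars_def intro: subst_term_cong)

lemma subsumes_iff_subs:
  assumes "normal g hs" "g \<in> set hs"
  shows "subsumes (dhyp ` set hs) (dlit ` set e) \<longleftrightarrow> subs hs e"
proof
  assume "subsumes (dhyp ` set hs) (dlit ` set e)"
  then obtain \<theta> where \<theta>: "\<And>R. R \<in> set hs \<Longrightarrow> subst \<theta> (dhyp R) \<in> dlit ` set e"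
    unfolding subsumes_def by blast
  then obtain L where L: "L \<in> set e" "subst \<theta> (dhyp g) = dlit L" using assms(2) by blast
  then have args: "map (subst_term \<theta>) (map darg (lit_args g)) = map dterm (lit_args L)"
    by (auto simp: dhyp_def dlit_def lit_args_def split: if_splits)
  have "subst (dsubst (lit_args L)) (dhyp R) \<in> dlit ` set e" if R: "R \<in> set hs" for R
  proof -
    have "dsubst (lit_args L) x = \<theta> x" if x: "x \<in> vars (dhyp R)" for x
    proof -
      note n = normal_guard[OF assms(1) R x]
      have "length (lit_args g) = length (lit_args L)" using arg_cong[OF args, of length] by simp
      moreover have "subst_term \<theta> (darg (lit_args g ! x)) = dterm (lit_args L ! x)"
        using arg_cong[OF args, of "\<lambda>l. l ! x"] n(1) calculation by simp
      ultimately show ?thesis using n by (simp add: dsubst_def nth_or_def)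
    qed
    then have "subst (dsubst (lit_args L)) (dhyp R) = subst \<theta> (dhyp R)" by (rule subst_cong)
    then show ?thesis using \<theta>[OF R] by simp
  qed
  then show "subs hs e" using L unfolding subs_iff by blast
qed (auto simp: subs_iff subsumes_def)

text \<open>The certificate carries the instance in tree form; encoding it again and comparing with
  \<open>w\<close> replaces a parser for instances. It is followed by the guard and the other
  literals. Without positive examples nothing is asked of the hypothesis, since a solution exists
  anyway.\<close>

definition chk :: "bool list \<Rightarrow> tree \<Rightarrow> bool" where
  "chk w t \<longleftrightarrow>
     w = enc_list (map (\<lambda>e. enc_list (map (\<lambda>L. enc_literal (dlit L)) (children e))) (children (car t))) @
         enc_list (map (\<lambda>e. enc_list (map (\<lambda>L. enc_literal (dlit L)) (children e)))
             (children (car (cdr t)))) \<and>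
     (children (car t) = [] \<or>
      normal (car (cdr (cdr t))) (car (cdr (cdr t)) # children (cdr (cdr (cdr t)))) \<and>
      (\<forall>e \<in> set (children (car t)). subs (car (cdr (cdr t)) # children (cdr (cdr (cdr t)))) (children e)) \<and>
      (\<forall>e \<in> set (children (car (cdr t))). \<not> subs (car (cdr (cdr t)) # children (cdr (cdr (cdr t))))
          (children e)))"

lemma pt_subs: "pt f \<Longrightarrow> pt g \<Longrightarrow> pt (\<lambda>x. subs (f x) (g x))"
proof -
  assume fg: "pt f" "pt g"
  have "pt (\<lambda>z :: tree list \<times> tree list. subs (fst z) (snd z))"
    unfolding subs_def lit_args_def by (intro pt_rules pt_inst_str pt_enc_dlit)
  from pt_comp[OF pt_pair[OF fg] this] show ?thesis by simp
qed

lemma pt_normal: "pt f \<Longrightarrow> pt g \<Longrightarrow> pt (\<lambda>x. normal (f x) (g x))"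
proof -
  assume fg: "pt f" "pt g"
  have "pt (\<lambda>z :: tree \<times> tree list. normal (fst z) (snd z))"
    unfolding normal_def lit_args_def by (intro pt_rules)
  from pt_comp[OF pt_pair[OF fg] this] show ?thesis by simp
qed

lemma pt_chk: "pt (\<lambda>z. chk (fst z) (snd z))"
  unfolding chk_def by (intro pt_rules pt_subs pt_normal pt_enc_dlit)

text \<open>A one-element domain and a single truth value for all predicates, given by the sign of
  one literal of \<open>C\<close>, make that literal hold.\<close>

lemma consistent_singleton:
  assumes "C \<noteq> {}"
  shows "consistent {C}"
proof -
  obtain R where R: "R \<in> C" using assms by blast
  have "is_model {0 :: nat} (\<lambda>_ _. 0) (\<lambda>_ _. \<exists>p ts. R = Pos p ts) {C}"
    unfolding is_model_def using R by (cases R) (auto intro!: bexI[of _ R])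
  then show ?thesis unfolding consistent_def by blast
qed

text \<open>A literal without arguments whose predicate name occurs in no negative example subsumes
  none of them. Being ground, it guards itself.\<close>

lemma ilp_no_positive: "ilp_consistent_guarded {} (set ` set Ns)"
proof -
  define pr where "pr R = (case R of Pos p _ \<Rightarrow> p | Neg p _ \<Rightarrow> p)" for R
  obtain p where p: "p \<notin> pr ` set (concat Ns)"
    using ex_new_if_finite[OF infinite_UNIV_nat, of "pr ` set (concat Ns)"] by blast
  have "Pos p [] \<notin> e" if "e \<in> set ` set Ns" for e
    using p that by (force simp: pr_def image_iff split: literal.splits)
  then show ?thesis
    unfolding ilp_consistent_guarded_def
    by (intro exI[of _ "{Pos p []}"])
      (auto simp: function_free_def guarded_def vars_def subsumes_def consistent_singleton)
qed

lemma chk_sound: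
  assumes "chk w t"
  shows "w \<in> ILP_CONSISTENCY_GUARDED"
proof -
  define cl where "cl e = map dlit (children e)" for e
  define Ps where "Ps = map cl (children (car t))"
  define Ns where "Ns = map cl (children (car (cdr t)))"
  define g where "g = car (cdr (cdr t))"
  define hs where "hs = g # children (cdr (cdr (cdr t)))"
  have w: "w = enc_instance Ps Ns"
    using assms unfolding chk_def enc_instance_def enc_clauses_def Ps_def Ns_def cl_def by (simp add: o_def)
  have ground: "\<forall>C \<in> set Ps \<union> set Ns. ground (set C)"
    by (auto simp: Ps_def Ns_def cl_def ground_def)
  have "ilp_consistent_guarded (set ` set Ps) (set ` set Ns)"
  proof (cases "Ps = []")
    case True
    then show ?thesis using ilp_no_positive by simp
  next
    case False
    then have n: "normal g hs" and pos: "\<forall>e \<in> set (children (car t)). subs hs (children e)"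
      and neg: "\<forall>e \<in> set (children (car (cdr t))). \<not> subs hs (children e)"
      using assms by (auto simp: chk_def Ps_def hs_def g_def)
    have g: "g \<in> set hs" by (simp add: hs_def)
    have "function_free (dhyp ` set hs)"
        by (auto simp: function_free_def dhyp_def darg_def split: if_splits)
    moreover have "guarded (dhyp ` set hs)"
    proof -
      have "x \<in> vars (dhyp g)" if "R \<in> set hs" "x \<in> vars (dhyp R)" for x R
      proof -
        note normal_guard[OF n that]
        moreover have "args (dhyp g) = map darg (lit_args g)" by (simp add: dhyp_def lit_args_def)
        ultimately show ?thesis unfolding vars_def by (auto intro!: bexI[of _ "lit_args g ! x"])
      qed
      then show ?thesis using g unfolding guarded_def by blast
    qed
    moreover have "consistent {dhyp ` set hs}" using g by (intro consistent_singleton) auto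
    moreover have "set (cl e) = dlit ` set (children e)" for e by (simp add: cl_def)
    ultimately show ?thesis unfolding ilp_consistent_guarded_def
      using subsumes_iff_subs[OF n g] pos neg
      by (intro exI[of _ "dhyp ` set hs"]) (auto simp: Ps_def Ns_def)
  qed
  then show ?thesis using w ground unfolding ILP_CONSISTENCY_GUARDED_def by blast
qed


subsection \<open>Small hypotheses\<close>

text \<open>A guard together with one literal that fails for each possible image of the guard in a
  negative example is still a solution.\<close>

lemma small_solution:
  assumes "finite H" "G \<in> H" "(\<Union>R \<in> H. vars R) \<subseteq> vars G" "\<And>e. e \<in> set Ns \<Longrightarrow> \<not> subsumes H (set e)"
  obtains Rs where "G \<in> set Rs" "set Rs \<subseteq> H" "length Rs = Suc (length (concat Ns))"
    "\<And>e. e \<in> set Ns \<Longrightarrow> \<not> subsumes (set Rs) (set e)"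
proof -
  have ex: "\<exists>R \<in> H. \<forall>\<theta>. subst \<theta> G = L \<longrightarrow> subst \<theta> R \<notin> set e" if e: "e \<in> set Ns" for e L
  proof (cases "\<exists>\<sigma>. subst \<sigma> G = L")
    case True
    then obtain \<sigma> where \<sigma>: "subst \<sigma> G = L" by blast
    obtain R where R: "R \<in> H" "subst \<sigma> R \<notin> set e"
      using assms(4)[OF e] unfolding subsumes_def by blast
    \<comment> \<open>The literal \<open>R\<close> was chosen for \<open>\<sigma>\<close> alone. As
      its variables all occur in the guard, it fails for every substitution with the same image of
      the guard.\<close>
    have "subst \<theta> R = subst \<sigma> R" if "subst \<theta> G = L" for \<theta>
    proof (rule subst_cong)
      have inj: "\<theta> x = \<sigma> x" if "subst_term \<theta> t = subst_term \<sigma> t" "x \<in> vars_term t" for x t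
        using that by (induction t rule: vars_term.induct) auto
      fix x assume "x \<in> vars R"
      then have "x \<in> vars G" using assms(3) R(1) by blast
      moreover have "map (subst_term \<theta>) (args G) = map (subst_term \<sigma>) (args G)"
        using \<open>subst \<theta> G = L\<close> \<sigma> by (cases G) auto
      ultimately show "\<theta> x = \<sigma> x" using inj by (auto simp: vars_def)
    qed
    with R show ?thesis by metis
  next
    case False
    then show ?thesis using assms(2) by blast
  qed
  define sel where "sel e L = (SOME R. R \<in> H \<and> (\<forall>\<theta>. subst \<theta> G = L \<longrightarrow> subst \<theta> R \<notin> set e))" for e L
  have sel: "sel e L \<in> H \<and> (\<forall>\<theta>. subst \<theta> G = L \<longrightarrow> subst \<theta> (sel e L) \<notin> set e)" if "e \<in> set Ns" for e L
    unfolding sel_def by (rule someI_ex) (use ex[OF that, of L] in blast)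
  define Rs where "Rs = G # concat (map (\<lambda>e. map (sel e) e) Ns)"
  have "\<not> subsumes (set Rs) (set e)" if e: "e \<in> set Ns" for e
  proof
    assume "subsumes (set Rs) (set e)"
    then obtain \<theta> where \<theta>: "\<And>R. R \<in> set Rs \<Longrightarrow> subst \<theta> R \<in> set e" unfolding subsumes_def by blast
    then have "subst \<theta> G \<in> set e" by (simp add: Rs_def)
    then have "sel e (subst \<theta> G) \<in> set Rs" using e by (auto simp: Rs_def)
    then show False using \<theta> sel[OF e] by blast
  qed
  moreover have "length Rs = Suc (length (concat Ns))"
    by (simp add: Rs_def length_concat o_def)
  moreover have "set Rs \<subseteq> H" using sel assms(2) by (auto simp: Rs_def)
  ultimately show ?thesis using that[of Rs] by (simp add: Rs_def)
qed

lemma subst_term_subst_term: "subst_term \<theta> (subst_term \<sigma> t) = subst_term (\<lambda>x. subst_term \<theta> (\<sigma> x)) t"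
  by (induction t) auto

lemma subst_subst: "subst \<theta> (subst \<sigma> R) = subst (\<lambda>x. subst_term \<theta> (\<sigma> x)) R"
  by (cases R) (auto simp: subst_term_subst_term)

lemma args_subst [simp]: "args (subst \<theta> R) = map (subst_term \<theta>) (args R)"
  by (cases R) auto

text \<open>\<open>\<rho> x\<close> is a position of the guard at which the variable
  \<open>x\<close> itself stands; it exists since the guard is function-free. The renaming loses
  nothing: a substitution \<open>\<theta>\<close> is recovered by sending \<open>j\<close> to the
  image of the \<open>j\<close>-th argument of the guard.\<close>

lemma normal_form:
  assumes ff: "function_free (set Rs)" and G: "G \<in> set Rs" "(\<Union>R \<in> set Rs. vars R) \<subseteq> vars G"
  obtains \<rho> :: "nat \<Rightarrow> nat" where
    "\<And>e. subsumes (subst (\<lambda>x. Var (\<rho> x)) ` set Rs) e \<longleftrightarrow> subsumes (set Rs) e"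
    "\<And>R x. R \<in> set Rs \<Longrightarrow> Var x \<in> set (args R) \<Longrightarrow> \<rho> x < length (args G) \<and> args G ! \<rho> x = Var x"
proof -
  define \<rho> where "\<rho> x = (SOME j. j < length (args G) \<and> args G ! j = Var x)" for x
  have \<rho>: "\<rho> x < length (args G) \<and> args G ! \<rho> x = Var x" if "x \<in> vars G" for x
  proof -
    obtain t where t: "t \<in> set (args G)" "x \<in> vars_term t" using \<open>x \<in> vars G\<close> unfolding vars_def by blast
    moreover have "(\<exists>y. t = Var y) \<or> (\<exists>c. t = Fun c [])" using ff G(1) t(1) unfolding function_free_def
        by blast
    ultimately have "Var x \<in> set (args G)" by auto
    then show ?thesis unfolding \<rho>_def in_set_conv_nth by (rule someI_ex)
  qed
  have "subsumes (subst (\<lambda>x. Var (\<rho> x)) ` set Rs) e \<longleftrightarrow> subsumes (set Rs) e" for e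
  proof
    assume "subsumes (subst (\<lambda>x. Var (\<rho> x)) ` set Rs) e"
    then obtain \<theta> where "\<And>R. R \<in> set Rs \<Longrightarrow> subst \<theta> (subst (\<lambda>x. Var (\<rho> x)) R) \<in> e" unfolding subsumes_def
        by blast
    then show "subsumes (set Rs) e" unfolding subsumes_def subst_subst by blast
  next
    assume "subsumes (set Rs) e"
    then obtain \<theta> where \<theta>: "\<And>R. R \<in> set Rs \<Longrightarrow> subst \<theta> R \<in> e" unfolding subsumes_def by blast
    define \<sigma> where "\<sigma> j = subst_term \<theta> (args G ! j)" for j
    have "subst \<sigma> (subst (\<lambda>x. Var (\<rho> x)) R) = subst \<theta> R" if "R \<in> set Rs" for R
      unfolding subst_subst
    proof (rule subst_cong)
      fix x assume "x \<in> vars R"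
      then have "x \<in> vars G" using that G(2) by blast
      then show "subst_term \<sigma> (Var (\<rho> x)) = \<theta> x" using \<rho> by (simp add: \<sigma>_def)
    qed
    then show "subsumes (subst (\<lambda>x. Var (\<rho> x)) ` set Rs) e" using \<theta> unfolding subsumes_def
        by (intro exI[of _ \<sigma>]) auto
  qed
  moreover have "\<rho> x < length (args G) \<and> args G ! \<rho> x = Var x" if "R \<in> set Rs" "Var x \<in> set (args R)"
      for R x
  proof (rule \<rho>)
    have "x \<in> vars R" using that(2) by (force simp: vars_def)
    then show "x \<in> vars G" using that(1) G(2) by blast
  qed
  ultimately show ?thesis using that by blast
qed


subsection \<open>Encoding certificates\<close>

fun uterm :: "fterm \<Rightarrow> tree" where
  "uterm (Var x) = Leaf"
| "uterm (Fun f ts) = Node (tr (nat_bits f)) (tr (map uterm ts))"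

primrec ulit :: "literal \<Rightarrow> tree" where
  "ulit (Pos p ts) = Node (tr True) (Node (tr (nat_bits p)) (tr (map uterm ts)))"
| "ulit (Neg p ts) = Node (tr False) (Node (tr (nat_bits p)) (tr (map uterm ts)))"

fun uarg :: "fterm \<Rightarrow> tree" where
  "uarg (Var x) = Node Leaf (tr x)"
| "uarg (Fun f ts) = Node (Node Leaf Leaf) (tr (nat_bits f))"

primrec uhyp :: "literal \<Rightarrow> tree" where
  "uhyp (Pos p ts) = Node (tr True) (Node (tr (nat_bits p)) (tr (map uarg ts)))"
| "uhyp (Neg p ts) = Node (tr False) (Node (tr (nat_bits p)) (tr (map uarg ts)))"

lemma children_tr: "children (tr xs) = map tr xs"
  by (induction xs) simp_all

lemma children_tr_nat [simp]: "length (children (tr (n::nat))) = n"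
  by (induction n) simp_all

lemma dnat_bits [simp]: "dnat (tr (nat_bits n)) = n"
proof -
  have "dbits (tr bs) = bs" for bs :: "bool list"
    by (induction bs) (simp_all add: dbits_def)
  then show ?thesis by (simp add: dnat_def val_nat_bits)
qed

lemma dterm_uterm: "vars_term t = {} \<Longrightarrow> dterm (uterm t) = t"
  by (induction t rule: uterm.induct) (auto simp: children_tr map_idI)

lemma dlit_ulit: "vars R = {} \<Longrightarrow> dlit (ulit R) = R"
  by (cases R) (auto simp: dlit_def vars_def children_tr intro!: map_idI dterm_uterm)

lemma darg_uarg: "(\<exists>x. t = Var x) \<or> (\<exists>c. t = Fun c []) \<Longrightarrow> darg (uarg t) = t"
  by (auto simp: darg_def)

lemma lit_args_uhyp: "lit_args (uhyp R) = map uarg (args R)"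
  by (cases R) (simp_all add: lit_args_def children_tr)

lemma dhyp_uhyp: "\<forall>t \<in> set (args R). (\<exists>x. t = Var x) \<or> (\<exists>c. t = Fun c []) \<Longrightarrow> dhyp (uhyp R) = R"
  by (cases R) (auto simp: dhyp_def children_tr intro!: map_idI darg_uarg)

lemma sz_enc_list:
  assumes "\<And>x. x \<in> set xs \<Longrightarrow> sz (f x) \<le> 4 * length (g x)"
  shows "sz (map f xs) \<le> 4 * length (enc_list (map g xs))"
  using assms
proof (induction xs)
  case (Cons x xs)
  then have "sz (f x) \<le> 4 * length (g x)" "sz (map f xs) \<le> 4 * length (enc_list (map g xs))" by simp_all
  then show ?case by simp
qed simp

lemma sz_nat_bits: "sz (nat_bits n) \<le> 2 * length (enc_nat n)"
  using sz_bools[of "nat_bits n"] by (simp add: length_enc_nat)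

lemma sz_tr: "sz (tr x) = sz x"
  by (simp add: sz_def)

lemma sz_uterm: "sz (uterm t) \<le> 4 * length (enc_term t)"
proof (induction t rule: uterm.induct)
  case (2 f ts)
  have "sz (map uterm ts) \<le> 4 * length (enc_list (map enc_term ts))"
    by (rule sz_enc_list) (use 2 in auto)
  then show ?case using sz_nat_bits[of f] by (simp add: sz_tr)
qed simp

lemma sz_ulit: "sz (ulit R) \<le> 4 * length (enc_literal R)"
proof -
  have "sz (map uterm ts) \<le> 4 * length (enc_list (map enc_term ts))" for ts
    by (rule sz_enc_list) (use sz_uterm in auto)
  moreover have "5 + sz (nat_bits p) \<le> 4 + 4 * length (enc_nat p)" for p
    using sz_nat_bits[of p] length_enc_nat[of p] by simp
  ultimately have *: "5 + sz (nat_bits p) + sz (map uterm ts) \<le> 4 + 4 * length (enc_nat p) + 4 * length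
      (enc_list (map enc_term ts))" for p ts
    by (rule add_mono[rotated])
  show ?thesis
  proof (cases R)
    case (Pos p ts)
    then show ?thesis using *[of p ts] by (simp add: sz_tr)
  next
    case (Neg p ts)
    then show ?thesis using *[of p ts] by (simp add: sz_tr)
  qed
qed

lemma length_enc_list_elem: "w \<in> set ws \<Longrightarrow> length w < length (enc_list ws)"
  by (induction ws) auto

lemma length_enc_list_ge: "length ws < length (enc_list ws)"
  by (induction ws) auto

lemma children_tr_trees [simp]: "children (tr (ts :: tree list)) = ts"
  by (simp add: children_tr map_idI)

lemma length_concat_enc: "length (concat Cs) \<le> length (enc_clauses Cs)"
proof (induction Cs)
  case (Cons C Cs)
  then show ?case using length_enc_list_ge[of "map enc_literal C"] by (simp add: enc_clauses_def)
qed (simp add: enc_clauses_def)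

lemma sz_list_le: "(\<And>x. x \<in> set xs \<Longrightarrow> sz x \<le> b) \<Longrightarrow> sz xs \<le> 1 + length xs * (1 + b)"
  by (induction xs) fastforce+

text \<open>An instance has the predicate, the number of arguments and all constants of
  \<open>R\<close>, so these are bounded by its code. Only variables can be replaced by something
  shorter; they are unary and at most \<open>n\<close>, which makes the bound quadratic.\<close>

lemma sz_uhyp_le:
  assumes L: "subst \<theta> R = L" "length (enc_literal L) \<le> n"
    and ff: "\<And>t. t \<in> set (args R) \<Longrightarrow> (\<exists>x. t = Var x \<and> x \<le> n) \<or> (\<exists>c. t = Fun c [])"
  shows "sz (uhyp R) \<le> 6 + 2 * n + n * (2 * n + 5)"
proof -
  obtain p where enc: "length (enc_literal L) = 1 + length (enc_nat p) + length
      (enc_list (map enc_term (args L)))"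
    and sz: "sz (uhyp R) \<le> 5 + sz (nat_bits p) + sz (map uarg (args R))"
    using L(1) by (cases R) (auto simp: sz_tr)
  have args: "args L = map (subst_term \<theta>) (args R)" using L(1) by auto
  have "sz (uarg t) \<le> 2 * n + 4" if t: "t \<in> set (args R)" for t
  proof (cases "\<exists>c. t = Fun c []")
    case True
    then obtain c where c: "t = Fun c []" by blast
    then have "Fun c [] \<in> set (args L)" using t args by force
    then have "length (enc_term (Fun c [])) < length (enc_list (map enc_term (args L)))"
      by (intro length_enc_list_elem) (simp only: set_map imageI)
    then have "length (enc_nat c) \<le> n" using enc L(2) by simp
    then show ?thesis using c sz_nat_bits[of c] by (simp add: sz_tr)
  next
    case False
    then show ?thesis using ff[OF t] by (auto simp: sz_tr)
  qed
  then have "sz (map uarg (args R)) \<le> 1 + length (map uarg (args R)) * (1 + (2 * n + 4))"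
    by (intro sz_list_le) auto
  also have "length (map uarg (args R)) \<le> n"
    using length_enc_list_ge[of "map enc_term (args L)"] enc L(2) args by simp
  from mult_le_mono1[OF this, of "2 * n + 5"]
  have "1 + length (map uarg (args R)) * (1 + (2 * n + 4)) \<le> 1 + n * (2 * n + 5)"
    by (simp add: algebra_simps)
  finally show ?thesis using sz sz_nat_bits[of p] enc L(2) by simp
qed

text \<open>In the polynomial, \<open>[:10, 8:]\<close> pays for the instance and
  \<open>[:6, 7, 2:]\<close>, which is the bound of \<open>sz_uhyp_le\<close>, for the guard. The
  product pays for a list of at most \<open>n + 1\<close> literals: the guard once more and one for
  each literal of a negative example.\<close>

lemma chk_complete:
  assumes "w \<in> ILP_CONSISTENCY_GUARDED"
  shows "\<exists>t. sz t \<le> poly ([:10, 8:] + [:6, 7, 2:] + [:1, 1:] * (1 + [:6, 7, 2:])) (length w) \<and> chk w t"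
proof -
  obtain Ps Ns where w: "w = enc_instance Ps Ns" and gr: "\<forall>C \<in> set Ps \<union> set Ns. ground (set C)"
    and ilp: "ilp_consistent_guarded (set ` set Ps) (set ` set Ns)"
    using assms unfolding ILP_CONSISTENCY_GUARDED_def by blast
  define n where "n = length w"
  have n: "length (enc_clauses Ps) + length (enc_clauses Ns) = n"
    using w by (simp add: n_def enc_instance_def)
  have dl: "dlit (ulit R) = R" if "C \<in> set Ps \<union> set Ns" "R \<in> set C" for C R
    using gr that by (intro dlit_ulit) (auto simp: ground_def)
  define tree_of where "tree_of h = Node (tr (map (map ulit) Ps)) (Node (tr (map (map ulit) Ns)) h)" for h
  have enc: "w = enc_list (map (\<lambda>e. enc_list (map (\<lambda>L. enc_literal (dlit L)) (children e)))
      (children (car (tree_of h)))) @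
         enc_list (map (\<lambda>e. enc_list (map (\<lambda>L. enc_literal (dlit L)) (children e)))
             (children (car (cdr (tree_of h)))))" for h
    unfolding w enc_instance_def enc_clauses_def tree_of_def
    by (auto simp: children_tr o_def intro!: arg_cong2[where f = append] arg_cong[where f = enc_list]
        map_cong)
      (metis dl UnI1 UnI2)+
  have szc: "sz (map (map ulit) Cs) \<le> 4 * length (enc_clauses Cs)" for Cs
    unfolding enc_clauses_def by (intro sz_enc_list sz_ulit)
  have szt: "sz (tree_of h) \<le> 2 + 4 * n + sz h" for h
    using szc[of Ps] szc[of Ns] n by (simp add: tree_of_def sz_tr)
  show ?thesis
  proof (cases "Ps = []")
    case True
    have "chk w (tree_of Leaf)" unfolding chk_def
      by (rule conjI[OF enc], rule disjI1) (simp add: tree_of_def True)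
    moreover have "sz (tree_of Leaf) \<le> poly ([:10, 8:] + [:6, 7, 2:] + [:1, 1:] * (1 + [:6, 7, 2:])) n"
      by (rule le_trans[OF szt]) (simp add: algebra_simps)
    ultimately show ?thesis unfolding n_def by blast
  next
    case False
    obtain H where H: "finite H" "function_free H" "guarded H"
      and "\<forall>e \<in> set ` set Ps. subsumes H e" "\<forall>e \<in> set ` set Ns. \<not> subsumes H e"
      using ilp unfolding ilp_consistent_guarded_def by blast
    then have Hpos: "subsumes H (set e)" if "e \<in> set Ps" for e using that by simp
    have Hneg: "\<not> subsumes H (set e)" if "e \<in> set Ns" for e
      using that \<open>\<forall>e \<in> set ` set Ns. \<not> subsumes H e\<close> by simp
    obtain G where G: "G \<in> H" "(\<Union>R \<in> H. vars R) \<subseteq> vars G" using H(3) unfolding guarded_def by blast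
    obtain Rs where Rs: "G \<in> set Rs" "set Rs \<subseteq> H" "length Rs = Suc (length (concat Ns))"
      "\<And>e. e \<in> set Ns \<Longrightarrow> \<not> subsumes (set Rs) (set e)"
      using small_solution[OF H(1) G Hneg] by metis
    have pos: "subsumes (set Rs) (set e)" if "e \<in> set Ps" for e
      using Hpos[OF that] Rs(2) unfolding subsumes_def by blast
    have ff: "(\<exists>x. t = Var x) \<or> (\<exists>c. t = Fun c [])" if "R \<in> set Rs" "t \<in> set (args R)" for R t
      using H(2) Rs(2) that unfolding function_free_def by blast
    have ffR: "function_free (set Rs)" "(\<Union>R \<in> set Rs. vars R) \<subseteq> vars G"
      using H(2) Rs(2) G(2) unfolding function_free_def by blast+
    obtain \<rho> where \<rho>: "\<And>e. subsumes (subst (\<lambda>x. Var (\<rho> x)) ` set Rs) e \<longleftrightarrow> subsumes (set Rs) e"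
      "\<And>R x. R \<in> set Rs \<Longrightarrow> Var x \<in> set (args R) \<Longrightarrow> \<rho> x < length (args G) \<and> args G ! \<rho> x = Var x"
      using normal_form[OF ffR(1) Rs(1) ffR(2)] by metis
    let ?r = "subst (\<lambda>x. Var (\<rho> x))"
    define g where "g = uhyp (?r G)"
    define hs where "hs = map (\<lambda>R. uhyp (?r R)) Rs"
    have ff': "(\<exists>x. t = Var x \<and> x < length (args G) \<and> args (?r G) ! x = t) \<or> (\<exists>c. t = Fun c [])"
      if R: "R \<in> set Rs" and t: "t \<in> set (args (?r R))" for R t
    proof -
      obtain u where u: "u \<in> set (args R)" "t = subst_term (\<lambda>x. Var (\<rho> x)) u" using t by auto
      show ?thesis
      proof (cases "\<exists>x. u = Var x")
        case True
        then obtain x where "u = Var x" by blast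
        then show ?thesis using \<rho>(2)[OF R, of x] u by auto
      next
        case False
        then show ?thesis using ff[OF R u(1)] u(2) by auto
      qed
    qed
    have dh: "dhyp (uhyp (?r R)) = ?r R" if "R \<in> set Rs" for R
      using ff'[OF that] by (intro dhyp_uhyp) blast
    have g: "g \<in> set (g # hs)" by simp
    have im: "dhyp ` set (g # hs) = ?r ` set Rs"
      using dh Rs(1) by (auto simp: g_def hs_def image_image)
    have normal: "normal g (g # hs)"
      unfolding normal_def
    proof (intro ballI impI)
      fix R a assume R: "R \<in> set (g # hs)" and a: "a \<in> set (lit_args R)" "car a = Leaf"
      obtain S where S: "S \<in> set Rs" "R = uhyp (?r S)" using R Rs(1) by (auto simp: g_def hs_def)
      obtain t where t: "t \<in> set (args (?r S))" "a = uarg t" using a(1) unfolding S(2) lit_args_uhyp by auto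
      obtain x where x: "t = Var x" "x < length (args G)" "args (?r G) ! x = t"
        using ff'[OF S(1) t(1)] a(2) t(2) by auto
      have "nth_or (Node (Node Leaf Leaf) Leaf) (lit_args g) x = uarg t"
        using x by (simp add: nth_or_def g_def lit_args_uhyp)
      then show "car (nth_or (Node (Node Leaf Leaf) Leaf) (lit_args g) (length (children (cdr a)))) = Leaf \<and>
        length (children (cdr (nth_or (Node (Node Leaf Leaf) Leaf) (lit_args g)
            (length (children (cdr a)))))) =
        length (children (cdr a))"
        using t(2) x(1) by simp
    qed
    have subs: "subs (g # hs) (map ulit C) \<longleftrightarrow> subsumes (set Rs) (set C)" if "C \<in> set Ps \<union> set Ns" for C
    proof -
      have "dlit ` set (map ulit C) = set C" using dl[OF that] by (auto simp: image_image)
      then show ?thesis using subsumes_iff_subs[OF normal g, of "map ulit C"] \<rho>(1)[of "set C"]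
        unfolding im by simp
    qed
    let ?t = "tree_of (Node g (tr hs))"
    have "chk w ?t" unfolding chk_def
      by (rule conjI[OF enc], rule disjI2) (use normal subs pos Rs(4) in \<open>auto simp: tree_of_def
          children_tr\<close>)
    moreover have "sz ?t \<le> poly ([:10, 8:] + [:6, 7, 2:] + [:1, 1:] * (1 + [:6, 7, 2:])) n"
    proof -
      \<comment> \<open>One positive example is enough: every literal of the hypothesis has an
        instance in it, and the instance of the guard bounds the variable numbers, which are guard
        positions.\<close>
      obtain C where C: "C \<in> set Ps" using False by (cases Ps) auto
      have "subsumes (?r ` set Rs) (set C)" using pos[OF C] \<rho>(1) by simp
      then obtain \<theta> where "subst \<theta> ` ?r ` set Rs \<subseteq> set C" unfolding subsumes_def by (elim exE)
      then have \<theta>: "subst \<theta> (?r R) \<in> set C" if "R \<in> set Rs" for R using that by auto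
      have len: "length (enc_literal L) \<le> n" if "L \<in> set C" for L
      proof -
        have "length (enc_literal L) < length (enc_list (map enc_literal C))"
          using that by (intro length_enc_list_elem) auto
        also have "\<dots> < length (enc_clauses Ps)"
          unfolding enc_clauses_def using C by (intro length_enc_list_elem) auto
        finally show ?thesis using n by simp
      qed
      have "length (args L) < length (enc_literal L)" for L
        using length_enc_list_ge[of "map enc_term (args L)"] by (cases L) auto
      from this[of "subst \<theta> (?r G)"] len[OF \<theta>[OF Rs(1)]] have lenG: "length (args G) \<le> n" by simp
      have "sz (uhyp (?r R)) \<le> 6 + 2 * n + n * (2 * n + 5)" if R: "R \<in> set Rs" for R
        by (rule sz_uhyp_le[OF refl len[OF \<theta>[OF R]]]) (use ff'[OF R] lenG in force)
      then have le: "sz h \<le> 6 + 2 * n + n * (2 * n + 5)" if "h \<in> set (g # hs)" for h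
        using that Rs(1) unfolding g_def hs_def by auto
      have B: "sz g \<le> 6 + 2 * n + n * (2 * n + 5)" "sz hs \<le> 1 + length hs *
          (1 + (6 + 2 * n + n * (2 * n + 5)))"
        by (rule le, simp) (rule sz_list_le, rule le, simp)
      have "length hs \<le> n + 1" using length_concat_enc[of Ns] n Rs(3) by (simp add: hs_def)
      then have "length hs * (1 + (6 + 2 * n + n * (2 * n + 5))) \<le> (n + 1) *
          (1 + (6 + 2 * n + n * (2 * n + 5)))"
        by (rule mult_right_mono) simp
      then show ?thesis using szt[of "Node g (tr hs)"] B by (simp add: sz_tr algebra_simps)
    qed
    ultimately show ?thesis unfolding n_def by blast
  qed
qed

theorem in_NP_ilp: "in_NP ILP_CONSISTENCY_GUARDED"
  by (rule in_NP_I[OF pt_chk chk_complete chk_sound])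


section \<open>Constraint satisfaction as a consistency problem\<close>

text \<open>Constant 0 is a wildcard and constant \<open>Suc s\<close> stands for the value \<open>s\<close>. A hypothesis has the
  guard \<open>P(x\<^sub>1, \<dots>, x\<^sub>N)\<close>, and the literals \<open>Q\<^sub>s(x\<^sub>i)\<close> that it may contain besides are those with \<open>s\<close> the
  value of \<open>x\<^sub>i\<close>, chosen by mapping the guard into the \<open>i\<close>-th positive example.\<close>

definition pat :: "nat list \<Rightarrow> literal" where
  "pat xs = Pos 0 (map (\<lambda>c. Fun c []) xs)"

text \<open>The part common to all examples, in which \<open>Q\<^sub>s\<close> holds of the wildcard
  and of the value \<open>s\<close>. A variable mapped to the wildcard is thus under no constraint,
  and in the \<open>i\<close>-th positive example this applies to all variables except the
  \<open>i\<close>-th.\<close>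

definition base :: "nat \<Rightarrow> literal list" where
  "base K = concat (map (\<lambda>s. [Pos (Suc s) [Fun 0 []], Pos (Suc s) [Fun (Suc s) []]]) [0..<K])"

definition pos_ex :: "nat \<Rightarrow> nat \<Rightarrow> (nat \<Rightarrow> nat list) \<Rightarrow> nat \<Rightarrow> literal list" where
  "pos_ex K N dm i = base K @ map (\<lambda>s. pat (map (\<lambda>j. if j = i then Suc s else 0) [0..<N])) (dm i)"

definition neg_ex :: "nat \<Rightarrow> nat list list \<Rightarrow> literal list" where
  "neg_ex K forb = base K @ map pat forb"

lemma set_base: "set (base K) = {Pos (Suc s) [Fun c []] | s c. s < K \<and> (c = 0 \<or> c = Suc s)}"
  by (auto simp: base_def)

lemma pat_notin_base [simp]: "pat xs \<notin> set (base K)"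
  by (simp add: pat_def set_base)

lemma pat_inj [simp]: "pat xs = pat ys \<longleftrightarrow> xs = ys"
  by (simp add: pat_def inj_map_eq_map inj_def)

text \<open>The hypothesis has the guard and the literals \<open>Q\<^sub>s(x\<^sub>i)\<close> with
  \<open>s = A i\<close> for all \<open>i\<close>. Were the negative example subsumed, the guard
  would be mapped to a forbidden pattern, since \<open>base\<close> has no literal with predicate 0.
  The unary literals would then make that pattern agree with \<open>A\<close> wherever it is not a
  wildcard.\<close>

lemma csp_to_ilp:
  assumes A: "\<And>i. i < N \<Longrightarrow> A i \<in> set (dm i)" "\<And>i. i < N \<Longrightarrow> A i < K" and N: "N \<ge> 1"
    and forb: "\<And>xs. xs \<in> set forb \<Longrightarrow> \<exists>i < N. xs ! i \<noteq> 0 \<and> xs ! i \<noteq> Suc (A i)"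
  shows "ilp_consistent_guarded ((\<lambda>i. set (pos_ex K N dm i)) ` {..<N}) {set (neg_ex K forb)}"
proof -
  define G where "G = Pos 0 (map Var [0..<N])"
  define H where "H = insert G ((\<lambda>i. Pos (Suc (A i)) [Var i]) ` {..<N})"
  have "function_free H" by (auto simp: function_free_def H_def G_def)
  moreover have "guarded H" unfolding guarded_def by (rule bexI[of _ G]) (auto simp: H_def G_def vars_def)
  moreover have "subsumes H (set (pos_ex K N dm i))" if i: "i < N" for i
  proof -
    define \<theta> where "\<theta> x = Fun (if x = i then Suc (A i) else 0) []" for x
    have "subst \<theta> G = pat (map (\<lambda>j. if j = i then Suc (A i) else 0) [0..<N])"
      by (simp add: G_def pat_def \<theta>_def o_def)
    moreover have "subst \<theta> (Pos (Suc (A j)) [Var j]) \<in> set (base K)" if "j < N" for j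
      using A(2)[OF that] by (simp add: set_base \<theta>_def)
    ultimately have "subst \<theta> ` H \<subseteq> set (pos_ex K N dm i)"
      using A(1)[OF i] by (auto simp: H_def pos_ex_def simp del: subst.simps)
    then show ?thesis unfolding subsumes_def by blast
  qed
  moreover have "\<not> subsumes H (set (neg_ex K forb))"
  proof
    assume "subsumes H (set (neg_ex K forb))"
    then obtain \<theta> where \<theta>: "\<And>R. R \<in> H \<Longrightarrow> subst \<theta> R \<in> set (neg_ex K forb)" unfolding subsumes_def by blast
    have "subst \<theta> G \<in> set (neg_ex K forb)" by (rule \<theta>) (simp add: H_def)
    then obtain xs where xs: "xs \<in> set forb" "subst \<theta> G = pat xs"
      by (auto simp: neg_ex_def set_base G_def)
    then have eq: "map \<theta> [0..<N] = map (\<lambda>c. Fun c []) xs" by (simp add: G_def pat_def o_def)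
    then have len: "length xs = N" by (metis length_map length_upt minus_nat.diff_0)
    have "xs ! i = 0 \<or> xs ! i = Suc (A i)" if i: "i < N" for i
    proof -
      have "\<theta> i = Fun (xs ! i) []" using arg_cong[OF eq, of "\<lambda>l. l ! i"] i len by simp
      moreover have "subst \<theta> (Pos (Suc (A i)) [Var i]) \<in> set (neg_ex K forb)"
        by (rule \<theta>) (use i in \<open>simp add: H_def\<close>)
      ultimately show ?thesis by (auto simp: neg_ex_def set_base pat_def)
    qed
    then have "\<not> (\<exists>i < N. xs ! i \<noteq> 0 \<and> xs ! i \<noteq> Suc (A i))" by simp
    with forb[OF xs(1)] show False by (rule notE[rotated])
  qed
  moreover have "finite H" by (simp add: H_def)
  moreover have "consistent {H}" by (rule consistent_singleton) (simp add: H_def)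
  ultimately show ?thesis unfolding ilp_consistent_guarded_def
    by (intro exI[of _ H] conjI ballI) auto
qed

text \<open>\<open>A i\<close> is read off the substitution for the \<open>i\<close>-th example,
  which also forces any literal \<open>Q\<^sub>s(x\<^sub>i)\<close> of the hypothesis to have
  \<open>s = A i\<close>. If a forbidden pattern agreed with \<open>A\<close>, mapping the guard to
  it would subsume the negative example. Having at least two positions excludes a unary guard and
  constants inside the guard.\<close>

lemma ilp_to_csp:
  assumes N: "N \<ge> 2" and len: "\<And>xs. xs \<in> set forb \<Longrightarrow> length xs = N"
    and ilp: "ilp_consistent_guarded ((\<lambda>i. set (pos_ex K N dm i)) ` {..<N}) {set (neg_ex K forb)}"
  obtains A where "\<And>i. i < N \<Longrightarrow> A i \<in> set (dm i)"
    "\<And>xs. xs \<in> set forb \<Longrightarrow> \<exists>i < N. xs ! i \<noteq> 0 \<and> xs ! i \<noteq> Suc (A i)"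
proof -
  obtain H where H: "function_free H" "guarded H"
    and "\<forall>e \<in> (\<lambda>i. set (pos_ex K N dm i)) ` {..<N}. subsumes H e" and neg:
        "\<not> subsumes H (set (neg_ex K forb))"
    using ilp unfolding ilp_consistent_guarded_def by auto
  then have "\<forall>i. \<exists>\<theta>. i < N \<longrightarrow> (\<forall>R \<in> H. subst \<theta> R \<in> set (pos_ex K N dm i))"
    unfolding subsumes_def by (simp add: image_subset_iff)
  then obtain \<theta> where \<theta>: "\<And>i R. i < N \<Longrightarrow> R \<in> H \<Longrightarrow> subst (\<theta> i) R \<in> set (pos_ex K N dm i)" by metis
  have unary: "\<exists>s t. R = Pos (Suc s) [t] \<and> s < K"
    if "R \<in> H" "\<And>ts. R \<noteq> Pos 0 ts" for R
  proof -
    have "subst (\<theta> 0) R \<in> set (base K)"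
      using \<theta>[of 0 R] N that by (cases R) (auto simp: pos_ex_def pat_def)
    then show ?thesis by (cases R) (auto simp: set_base)
  qed
  have P: "\<exists>v a. ts = map (\<lambda>j. Var (v j)) [0..<N] \<and>
      (\<forall>i < N. a i \<in> set (dm i) \<and> (\<forall>j < N. \<theta> i (v j) = Fun (if j = i then Suc (a i) else 0) []))"
    if R: "Pos 0 ts \<in> H" for ts
  proof -
    have "\<exists>s \<in> set (dm i). subst (\<theta> i) (Pos 0 ts) = pat (map (\<lambda>j. if j = i then Suc s else 0) [0..<N])"
        if "i < N" for i
      using \<theta>[OF that R] by (auto simp: pos_ex_def set_base)
    then obtain a where a: "\<And>i. i < N \<Longrightarrow> a i \<in> set (dm i)"
      "\<And>i. i < N \<Longrightarrow> map (subst_term (\<theta> i)) ts = map (\<lambda>j. Fun (if j = i then Suc (a i) else 0) []) [0..<N]"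
      by (simp add: pat_def o_def) metis
    have lts: "length ts = N" using arg_cong[OF a(2)[of 0], of length] N by simp
    have st: "subst_term (\<theta> i) (ts ! j) = Fun (if j = i then Suc (a i) else 0) []" if "i < N" "j < N"
        for i j
      using arg_cong[OF a(2)[OF that(1)], of "\<lambda>l. l ! j"] that lts by simp
    have "\<exists>x. ts ! j = Var x" if j: "j < N" for j
    proof (rule ccontr)
      assume "\<nexists>x. ts ! j = Var x"
      moreover have "ts ! j \<in> set ts" using j lts by simp
      ultimately obtain c where c: "ts ! j = Fun c []" using H(1) R unfolding function_free_def by fastforce
      \<comment> \<open>Position \<open>j\<close> receives a value in the \<open>j\<close>-th
        example but the wildcard in any other one, here the \<open>i\<close>-th; a constant cannot
        become both.\<close>
      define i where "i = (if j = 0 then 1 else 0 :: nat)"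
      have "i < N" "i \<noteq> j" using N by (auto simp: i_def)
      then show False using st[of j j] st[of i j] j c by simp
    qed
    then obtain v where "\<And>j. j < N \<Longrightarrow> ts ! j = Var (v j)" by metis
    moreover from this have "ts = map (\<lambda>j. Var (v j)) [0..<N]" using lts by (intro nth_equalityI) simp_all
    ultimately show ?thesis using a(1) st by (intro exI[of _ v] exI[of _ a]) auto
  qed
  obtain G where G: "G \<in> H" "(\<Union>R \<in> H. vars R) \<subseteq> vars G" using H(2) unfolding guarded_def by blast
  \<comment> \<open>Otherwise the whole hypothesis would be mapped into \<open>base\<close>, which
    the negative example contains.\<close>
  have "\<exists>ts. Pos 0 ts \<in> H"
  proof (rule ccontr)
    assume no: "\<nexists>ts. Pos 0 ts \<in> H"
    have "subst (\<theta> 0) R \<in> set (neg_ex K forb)" if R: "R \<in> H" for R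
    proof -
      obtain s t where "R = Pos (Suc s) [t]" using unary[OF R] no R by blast
      then show ?thesis using \<theta>[of 0 R] R N by (auto simp: pos_ex_def neg_ex_def pat_def)
    qed
    then show False using neg unfolding subsumes_def by blast
  qed
  then obtain us where us: "Pos 0 us \<in> H" by blast
  obtain vu au where vu: "us = map (\<lambda>j. Var (vu j)) [0..<N]"
    "\<And>i j. i < N \<Longrightarrow> j < N \<Longrightarrow> \<theta> i (vu j) = Fun (if j = i then Suc (au i) else 0) []"
    using P[OF us] by metis
  have "\<exists>ts. G = Pos 0 ts"
  proof (rule ccontr)
    assume "\<nexists>ts. G = Pos 0 ts"
    then obtain s t where Gst: "G = Pos (Suc s) [t]" using unary[OF G(1)] by blast
    have "vu 0 \<in> vars (Pos 0 us)" "vu 1 \<in> vars (Pos 0 us)" using vu(1) N by (auto simp: vars_def)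
    moreover have "vars (Pos 0 us) \<subseteq> vars G" using G(2) us by blast
    ultimately have "vu 0 \<in> vars G" "vu 1 \<in> vars G" by blast+
    then have "vu 0 \<in> vars_term t" "vu 1 \<in> vars_term t" by (simp_all add: Gst vars_def)
    moreover have "(\<exists>x. t = Var x) \<or> (\<exists>c. t = Fun c [])" using H(1) G(1) Gst unfolding function_free_def
        by force
    ultimately have "vu 0 = vu 1" by auto
    then show False using vu(2)[of 0 0] vu(2)[of 0 1] N by simp
  qed
  then obtain ts where ts: "G = Pos 0 ts" by blast
  obtain v A where v: "ts = map (\<lambda>j. Var (v j)) [0..<N]" and A: "\<And>i. i < N \<Longrightarrow> A i \<in> set (dm i)"
    and th: "\<And>i j. i < N \<Longrightarrow> j < N \<Longrightarrow> \<theta> i (v j) = Fun (if j = i then Suc (A i) else 0) []"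
    using P[of ts] G(1) ts by metis
  have inj: "v i = v j \<longleftrightarrow> i = j" if "i < N" "j < N" for i j
    using th[of i i] th[of i j] that by (auto split: if_splits)
  have vars: "\<exists>j < N. x = v j" if "R \<in> H" "x \<in> vars R" for R x
  proof -
    have "x \<in> vars G" using G(2) that by blast
    then show ?thesis by (auto simp: ts v vars_def)
  qed
  have "\<exists>i < N. xs ! i \<noteq> 0 \<and> xs ! i \<noteq> Suc (A i)" if xs: "xs \<in> set forb" for xs
  proof (rule ccontr)
    assume "\<not> ?thesis"
    then have match: "\<And>i. i < N \<Longrightarrow> xs ! i = 0 \<or> xs ! i = Suc (A i)" by blast
    define \<sigma> where "\<sigma> x = Fun (xs ! (THE j. j < N \<and> v j = x)) []" for x
    have \<sigma>: "\<sigma> (v j) = Fun (xs ! j) []" if "j < N" for j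
    proof -
      have "(THE k. k < N \<and> v k = v j) = j" using inj that by (intro the_equality) auto
      then show ?thesis by (simp add: \<sigma>_def)
    qed
    have "subst \<sigma> R \<in> set (neg_ex K forb)" if R: "R \<in> H" for R
    proof (cases "\<exists>us. R = Pos 0 us")
      case True
      then obtain us where us: "R = Pos 0 us" by blast
      obtain v' a' where v': "us = map (\<lambda>j. Var (v' j)) [0..<N]"
        "\<And>i j. i < N \<Longrightarrow> j < N \<Longrightarrow> \<theta> i (v' j) = Fun (if j = i then Suc (a' i) else 0) []"
        using P[of us] R us by metis
      \<comment> \<open>Only one guard variable, \<open>v j\<close>, avoids the wildcard in the
        \<open>j\<close>-th example, so every literal with predicate 0 has the same arguments in the
        same order.\<close>
      have "v' j = v j" if j: "j < N" for j
      proof -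
        have "v' j \<in> vars R" using us v'(1) j by (auto simp: vars_def)
        then obtain k where k: "k < N" "v' j = v k" using vars[OF R] by blast
        then show ?thesis using v'(2)[OF j j] th[OF j k(1)] by (auto split: if_splits)
      qed
      then have "subst \<sigma> R = Pos 0 (map (\<lambda>j. Fun (xs ! j) []) [0..<N])"
        using us v'(1) \<sigma> by (simp add: o_def)
      also have "\<dots> = pat xs" unfolding pat_def using len[OF xs] by (auto intro: nth_equalityI)
      finally show ?thesis using xs by (simp add: neg_ex_def)
    next
      case False
      then obtain s t where st: "R = Pos (Suc s) [t]" "s < K" using unary[OF R] by blast
      have base: "subst_term (\<theta> i) t \<in> {Fun 0 [], Fun (Suc s) []}" if "i < N" for i
        using \<theta>[OF that R] st by (auto simp: pos_ex_def pat_def set_base)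
      have "subst_term \<sigma> t \<in> {Fun 0 [], Fun (Suc s) []}"
      proof (cases "\<exists>x. t = Var x")
        case True
        then obtain x where x: "t = Var x" by blast
        then obtain j where j: "j < N" "x = v j" using vars[OF R, of x] st by (auto simp: vars_def)
        \<comment> \<open>In the \<open>j\<close>-th example \<open>x\<close> is mapped to
          \<open>Suc (A j)\<close>, which is not the wildcard and therefore has to be
          \<open>Suc s\<close>.\<close>
        then have "A j = s" using base[OF j(1)] th[OF j(1) j(1)] x by simp
        then show ?thesis using \<sigma>[OF j(1)] match[OF j(1)] x j by auto
      next
        case False
        then obtain c where "t = Fun c []" using H(1) R st unfolding function_free_def by fastforce
        then show ?thesis using base[of 0] N by simp
      qed
      then show ?thesis using st by (auto simp: neg_ex_def set_base)
    qed
    then show False using neg unfolding subsumes_def by blast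
  qed
  then show ?thesis using A that by blast
qed


subsection \<open>Instances with named variables\<close>

text \<open>Yields names of constants: the wildcard 0 where the partial assignment is undefined, the
  successor of the value elsewhere.\<close>

definition lookup :: "('v \<times> nat) list \<Rightarrow> 'v \<Rightarrow> nat" where
  "lookup f v = (case concat (map (\<lambda>e. if fst e = v then [Suc (snd e)] else []) f) of [] \<Rightarrow> 0 | c # _ \<Rightarrow> c)"

lemma lookup_notin: "v \<notin> fst ` set f \<Longrightarrow> lookup f v = 0"
proof -
  assume "v \<notin> fst ` set f"
  then have "map (\<lambda>e. if fst e = v then [Suc (snd e)] else []) f = map (\<lambda>_. []) f" by auto
  then show ?thesis by (simp add: lookup_def del: map_eq_conv) (simp add: map_replicate_const)
qed

lemma lookup_in: "distinct (map fst f) \<Longrightarrow> e \<in> set f \<Longrightarrow> lookup f (fst e) = Suc (snd e)"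
proof (induction f)
  case (Cons d f)
  show ?case
  proof (cases "d = e")
    case False
    then have "e \<in> set f" "fst d \<noteq> fst e" using Cons.prems by force+
    then have "lookup (d # f) (fst e) = lookup f (fst e)" by (simp add: lookup_def)
    then show ?thesis using Cons \<open>e \<in> set f\<close> by simp
  qed (simp add: lookup_def)
qed simp

definition pos_clause :: "nat \<Rightarrow> 'v list \<Rightarrow> ('v \<Rightarrow> nat list) \<Rightarrow> 'v \<Rightarrow> literal list" where
  "pos_clause K vs dm v = base K @ map (\<lambda>s. pat (map (\<lambda>u. if u = v then Suc s else 0) vs)) (dm v)"

definition neg_clause :: "nat \<Rightarrow> 'v list \<Rightarrow> ('v \<times> nat) list list \<Rightarrow> literal list" where
  "neg_clause K vs forb = base K @ map (\<lambda>f. pat (map (lookup f) vs)) forb"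

definition csp_instance :: "nat \<Rightarrow> 'v list \<Rightarrow> ('v \<Rightarrow> nat list) \<Rightarrow> ('v \<times> nat) list list \<Rightarrow> bool list" where
  "csp_instance K vs dm forb = enc_instance (map (pos_clause K vs dm) vs) [neg_clause K vs forb]"

text \<open>Membership asks for some pair of lists with this code; since the code is injective, it
  can only be the given pair.\<close>

lemma enc_instance_mem:
  "enc_instance Ps Ns \<in> ILP_CONSISTENCY_GUARDED \<longleftrightarrow>
     (\<forall>C \<in> set Ps \<union> set Ns. ground (set C)) \<and> ilp_consistent_guarded (set ` set Ps) (set ` set Ns)"
proof
  assume "enc_instance Ps Ns \<in> ILP_CONSISTENCY_GUARDED"
  then obtain Ps' Ns' where *: "enc_instance Ps Ns = enc_instance Ps' Ns'" "\<forall>C \<in> set Ps' \<union> set Ns'. ground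
      (set C)"
      "ilp_consistent_guarded (set ` set Ps') (set ` set Ns')"
    unfolding ILP_CONSISTENCY_GUARDED_def by blast
  from enc_instance_inj[OF *(1)] *(2,3)
  show "(\<forall>C \<in> set Ps \<union> set Ns. ground (set C)) \<and> ilp_consistent_guarded (set ` set Ps) (set ` set Ns)"
    by simp
qed (auto simp: ILP_CONSISTENCY_GUARDED_def)

text \<open>Names are identified with their positions in the distinct list \<open>vs\<close>.
  Distinct names within each \<open>f\<close> ensure that \<open>lookup\<close> finds every entry,
  so that a position at which the pattern excludes \<open>A\<close> is the same as an entry violated
  by \<open>A\<close>.\<close>

lemma csp_instance_iff:
  assumes vs: "distinct vs" "length vs \<ge> 2"
    and K: "\<And>v s. v \<in> set vs \<Longrightarrow> s \<in> set (dm v) \<Longrightarrow> s < K"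
    and forb: "\<And>f. f \<in> set forb \<Longrightarrow> distinct (map fst f) \<and> fst ` set f \<subseteq> set vs"
  shows "csp_instance K vs dm forb \<in> ILP_CONSISTENCY_GUARDED \<longleftrightarrow>
    (\<exists>A. (\<forall>v \<in> set vs. A v \<in> set (dm v)) \<and> (\<forall>f \<in> set forb. \<exists>e \<in> set f. A (fst e) \<noteq> snd e))"
proof -
  define N where "N = length vs"
  define dm' where "dm' i = dm (vs ! i)" for i
  define forb' where "forb' = map (\<lambda>f. map (lookup f) vs) forb"
  have pos: "pos_clause K vs dm (vs ! i) = pos_ex K N dm' i" if "i < N" for i
  proof -
    have "map (\<lambda>u. if u = vs ! i then Suc s else 0) vs = map (\<lambda>j. if j = i then Suc s else 0) [0..<N]" for s
      using vs(1) that by (intro nth_equalityI) (simp_all add: N_def nth_eq_iff_index_eq)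
    then show ?thesis by (simp add: pos_clause_def pos_ex_def dm'_def)
  qed
  have "set vs = (!) vs ` {..<N}" by (auto simp: N_def in_set_conv_nth)
  then have "set ` set (map (pos_clause K vs dm) vs) = (\<lambda>i. set (pos_clause K vs dm (vs ! i))) ` {..<N}"
    by (simp add: image_image)
  also have "\<dots> = (\<lambda>i. set (pos_ex K N dm' i)) ` {..<N}" using pos by auto
  finally have P: "set ` set (map (pos_clause K vs dm) vs) = (\<lambda>i. set (pos_ex K N dm' i)) ` {..<N}" .
  have Nc: "neg_clause K vs forb = neg_ex K forb'"
    by (simp add: neg_clause_def neg_ex_def forb'_def)
  have "vars (pat xs) = {}" "R \<in> set (base K) \<Longrightarrow> vars R = {}" for xs R
    by (auto simp: pat_def vars_def set_base)
  then have gr: "ground (set (pos_clause K vs dm v))" "ground (set (neg_clause K vs forb))" for v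
    by (auto simp: ground_def pos_clause_def neg_clause_def)
  have "csp_instance K vs dm forb \<in> ILP_CONSISTENCY_GUARDED \<longleftrightarrow>
      ilp_consistent_guarded (set ` set (map (pos_clause K vs dm) vs)) (set ` set [neg_clause K vs forb])"
    unfolding csp_instance_def enc_instance_mem using gr by auto
  also have "\<dots> \<longleftrightarrow> ilp_consistent_guarded ((\<lambda>i. set (pos_ex K N dm' i)) ` {..<N}) {set (neg_ex K forb')}"
    unfolding P by (simp add: Nc)
  finally have iff: "csp_instance K vs dm forb \<in> ILP_CONSISTENCY_GUARDED \<longleftrightarrow>
      ilp_consistent_guarded ((\<lambda>i. set (pos_ex K N dm' i)) ` {..<N}) {set (neg_ex K forb')}" .
  have match: "(\<exists>i < N. map (lookup f) vs ! i \<noteq> 0 \<and> map (lookup f) vs ! i \<noteq> Suc (A (vs ! i))) \<longleftrightarrow>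
      (\<exists>e \<in> set f. A (fst e) \<noteq> snd e)" if f: "f \<in> set forb" for f A
  proof
    assume "\<exists>i < N. map (lookup f) vs ! i \<noteq> 0 \<and> map (lookup f) vs ! i \<noteq> Suc (A (vs ! i))"
    then obtain i where i: "i < N" "lookup f (vs ! i) \<noteq> 0" "lookup f (vs ! i) \<noteq> Suc (A (vs ! i))"
      by (auto simp: N_def)
    then obtain e where "e \<in> set f" "fst e = vs ! i" using lookup_notin by (metis imageE)
    then show "\<exists>e \<in> set f. A (fst e) \<noteq> snd e" using lookup_in[of f e] forb[OF f] i
      by (intro bexI[of _ e]) auto
  next
    assume "\<exists>e \<in> set f. A (fst e) \<noteq> snd e"
    then obtain e where e: "e \<in> set f" "A (fst e) \<noteq> snd e" by blast
    then have "fst e \<in> set vs" using forb[OF f] by auto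
    then obtain i where i: "i < N" "vs ! i = fst e" unfolding N_def in_set_conv_nth by blast
    then show "\<exists>i < N. map (lookup f) vs ! i \<noteq> 0 \<and> map (lookup f) vs ! i \<noteq> Suc (A (vs ! i))"
      using lookup_in[of f e] forb[OF f] e by (intro exI[of _ i]) (auto simp: N_def)
  qed
  show ?thesis unfolding iff
  proof
    assume ilp: "ilp_consistent_guarded ((\<lambda>i. set (pos_ex K N dm' i)) ` {..<N}) {set (neg_ex K forb')}"
    obtain A where A: "\<And>i. i < N \<Longrightarrow> A i \<in> set (dm' i)"
      "\<And>xs. xs \<in> set forb' \<Longrightarrow> \<exists>i < N. xs ! i \<noteq> 0 \<and> xs ! i \<noteq> Suc (A i)"
      by (rule ilp_to_csp[OF _ _ ilp]) (use vs in \<open>auto simp: N_def forb'_def\<close>)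
    define B where "B v = A (THE i. i < N \<and> vs ! i = v)" for v
    have B: "B (vs ! i) = A i" if "i < N" for i
    proof -
      have "(THE j. j < N \<and> vs ! j = vs ! i) = i"
        using vs(1) that by (intro the_equality) (auto simp: N_def nth_eq_iff_index_eq)
      then show ?thesis by (simp add: B_def)
    qed
    have "B v \<in> set (dm v)" if "v \<in> set vs" for v
      using that A(1) B by (auto simp: in_set_conv_nth dm'_def N_def)
    moreover have "\<exists>e \<in> set f. B (fst e) \<noteq> snd e" if f: "f \<in> set forb" for f
    proof -
      have "map (lookup f) vs \<in> set forb'" using f by (auto simp: forb'_def)
      from A(2)[OF this] show ?thesis unfolding match[OF f, symmetric] using B by auto
    qed
    ultimately show "\<exists>A. (\<forall>v \<in> set vs. A v \<in> set (dm v)) \<and> (\<forall>f \<in> set forb. \<exists>e \<in> set f. A (fst e) \<noteq> snd e)"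
      by blast
  next
    assume "\<exists>A. (\<forall>v \<in> set vs. A v \<in> set (dm v)) \<and> (\<forall>f \<in> set forb. \<exists>e \<in> set f. A (fst e) \<noteq> snd e)"
    then obtain A where A: "\<And>v. v \<in> set vs \<Longrightarrow> A v \<in> set (dm v)"
      "\<And>f. f \<in> set forb \<Longrightarrow> \<exists>e \<in> set f. A (fst e) \<noteq> snd e" by blast
    have AK: "A v < K" if "v \<in> set vs" for v using A(1)[OF that] K[OF that] by blast
    show "ilp_consistent_guarded ((\<lambda>i. set (pos_ex K N dm' i)) ` {..<N}) {set (neg_ex K forb')}"
    proof (rule csp_to_ilp[where A = "\<lambda>i. A (vs ! i)"])
      fix xs assume "xs \<in> set forb'"
      then obtain f where "f \<in> set forb" "xs = map (lookup f) vs" by (auto simp: forb'_def)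
      then show "\<exists>i < N. xs ! i \<noteq> 0 \<and> xs ! i \<noteq> Suc (A (vs ! i))" using match A(2) by blast
    qed (use A(1) AK vs(2) in \<open>auto simp: dm'_def N_def\<close>)
  qed
qed

section \<open>Writing down instances in polynomial time\<close>

definition const_code :: "nat \<Rightarrow> nat \<Rightarrow> bool list" where
  "const_code K c = nth_or [] (map (\<lambda>c. enc_term (Fun c [])) [0..<Suc K]) c"

lemma const_code: "c \<le> K \<Longrightarrow> const_code K c = enc_term (Fun c [])"
  by (simp add: const_code_def nth_or_def del: enc_term.simps upt_Suc)

definition pat_code :: "nat \<Rightarrow> nat list \<Rightarrow> bool list" where
  "pat_code K xs = True # enc_nat 0 @ enc_list (map (const_code K) xs)"

lemma pat_code: "\<forall>c \<in> set xs. c \<le> K \<Longrightarrow> pat_code K xs = enc_literal (pat xs)"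
  by (auto simp: pat_code_def pat_def const_code o_def simp del: enc_term.simps intro!:
      arg_cong[where f = enc_list])

lemma lookup_le: "(\<And>e. e \<in> set f \<Longrightarrow> snd e < K) \<Longrightarrow> lookup f v \<le> K"
  by (induction f) (auto simp: lookup_def Suc_le_eq split: list.splits)

text \<open>With \<open>K\<close> fixed, the codes of the constants 0 to \<open>K\<close> form a
  finite table, which avoids converting unary numbers to binary. The bounds on the values keep every
  access inside the table.\<close>

lemma csp_instance_code:
  assumes "\<And>v s. v \<in> set vs \<Longrightarrow> s \<in> set (dm v) \<Longrightarrow> s < K"
    and "\<And>f e. f \<in> set forb \<Longrightarrow> e \<in> set f \<Longrightarrow> snd e < K"
  shows "csp_instance K vs dm forb =
    enc_list (map (\<lambda>v. enc_list (map enc_literal (base K) @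
      map (\<lambda>s. pat_code K (map (\<lambda>u. if u = v then Suc s else 0) vs)) (dm v))) vs) @
    enc_list [enc_list (map enc_literal (base K) @ map (\<lambda>f. pat_code K (map (lookup f) vs)) forb)]"
proof -
  have "pat_code K (map (lookup f) vs) = enc_literal (pat (map (lookup f) vs))" if "f \<in> set forb" for f
    by (rule pat_code) (use lookup_le[of f K] assms(2)[OF that] in auto)
  moreover have "pat_code K (map (\<lambda>u. if u = v then Suc s else 0) vs) = enc_literal
      (pat (map (\<lambda>u. if u = v then Suc s else 0) vs))"
    if "v \<in> set vs" "s \<in> set (dm v)" for v s
    by (rule pat_code) (use assms(1)[OF that] in auto)
  ultimately show ?thesis
    unfolding csp_instance_def enc_instance_def enc_clauses_def pos_clause_def neg_clause_def map_append
        map_map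
    by (auto intro!: arg_cong2[where f = append] arg_cong[where f = enc_list])
qed

lemma pt_eq_triple: "pt f \<Longrightarrow> pt g \<Longrightarrow> pt (\<lambda>x. f x = (g x :: nat \<times> nat \<times> nat))"
proof -
  assume fg: "pt f" "pt g"
  have "pt (\<lambda>x. fst (f x) = fst (g x) \<and> fst (snd (f x)) = fst (snd (g x)) \<and> snd (snd (f x)) = snd
      (snd (g x)))"
    by (intro pt_rules fg)
  then show ?thesis by (simp add: prod_eq_iff)
qed

lemma pt_const_code: "pt f \<Longrightarrow> pt (\<lambda>x. const_code K (f x))"
  unfolding const_code_def by (rule pt_nth_or[OF pt_const pt_const])

lemma pt_lookup:
  assumes "pt f" "pt g"
  shows "pt (\<lambda>x. lookup (f x) (g x :: nat \<times> nat \<times> nat))"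
proof -
  have "pt (\<lambda>z :: ((nat \<times> nat \<times> nat) \<times> nat) list \<times> nat \<times> nat \<times> nat. lookup (fst z) (snd z))"
    unfolding lookup_def by (intro pt_rules pt_eq_triple)
  from pt_comp[OF pt_pair[OF assms] this] show ?thesis by simp
qed

lemma pt_pat_code: "pt f \<Longrightarrow> pt (\<lambda>x. pat_code K (f x))"
proof -
  assume f: "pt f"
  have "pt (pat_code K)" unfolding pat_code_def
      by (intro pt_Cons pt_append pt_enc_list pt_map pt_const_code pt_snd pt_id pt_const)
  from pt_comp[OF f this] show ?thesis .
qed

lemma pt_csp_instance:
  fixes vs :: "'a::encodable \<Rightarrow> (nat \<times> nat \<times> nat) list"
  assumes vs: "pt vs" and dm: "pt (\<lambda>z. dm (fst z) (snd z))" and forb: "pt forb"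
    and K: "\<And>x v s. v \<in> set (vs x) \<Longrightarrow> s \<in> set (dm x v) \<Longrightarrow> s < K"
      "\<And>x f e. f \<in> set (forb x) \<Longrightarrow> e \<in> set f \<Longrightarrow> snd e < K"
  shows "pt (\<lambda>x. csp_instance K (vs x) (dm x) (forb x))"
proof -
  have 1: "pt (\<lambda>z :: 'a \<times> nat \<times> nat \<times> nat. enc_list (map enc_literal (base K) @
      map (\<lambda>s. pat_code K (map (\<lambda>u. if u = snd z then Suc s else 0) (vs (fst z)))) (dm (fst z) (snd z))))"
    by (intro pt_enc_list pt_append pt_map pt_pat_code pt_if pt_eq_triple pt_Suc pt_fst pt_snd pt_id
        pt_const dm
      pt_comp[OF _ vs])
  have 2: "pt (\<lambda>z :: 'a \<times> ((nat \<times> nat \<times> nat) \<times> nat) list. pat_code K (map (lookup (snd z)) (vs (fst z))))"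
    by (intro pt_pat_code pt_map pt_lookup pt_fst pt_snd pt_id pt_comp[OF _ vs])
  have "csp_instance K (vs x) (dm x) (forb x) =
      enc_list (map (\<lambda>v. enc_list (map enc_literal (base K) @
        map (\<lambda>s. pat_code K (map (\<lambda>u. if u = v then Suc s else 0) (vs x))) (dm x v))) (vs x)) @
      enc_list [enc_list (map enc_literal (base K) @ map (\<lambda>f. pat_code K (map (lookup f) (vs x)))
          (forb x))]" for x
    by (rule csp_instance_code) (use K in blast)+
  then show ?thesis
    by (simp only:)
      (intro pt_append pt_enc_list pt_Cons pt_map pt_const vs forb 1 2)
qed


section \<open>The computation tableau\<close>

text \<open>Applied to finite sets that depend only on the machine. Such a list enters a
  polynomial-time function as a constant, so any choice of it will do.\<close>

definition listing :: "'a set \<Rightarrow> 'a list" where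
  "listing S = (SOME xs. set xs = S)"

lemma set_listing [simp]: "finite S \<Longrightarrow> set (listing S) = S"
  unfolding listing_def by (rule someI_ex) (rule finite_list)

definition view :: "tape \<Rightarrow> int \<Rightarrow> nat \<times> bool" where
  "view t z = (fst t z, snd t = z)"

definition upd :: "nat \<times> direction \<Rightarrow> nat \<times> bool \<Rightarrow> nat \<times> bool \<Rightarrow> nat \<times> bool \<Rightarrow> nat \<times> bool" where
  "upd x l c r = (if snd c then fst x else fst c,
     snd l \<and> snd x = MoveRight \<or> snd c \<and> snd x = Stay \<or> snd r \<and> snd x = MoveLeft)"

text \<open>A head moves by at most one square, so it can only arrive from a neighbouring square;
  this is what makes the tableau locally checkable.\<close>

lemma view_act: "view (act t x) z = upd x (view t (z - 1)) (view t z) (view t (z + 1))"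
  by (cases t; cases x) (auto simp: view_def upd_def split: direction.splits)

locale tableau =
  fixes M :: machine
  assumes valid: "valid_machine M"
begin

text \<open>Row \<open>t\<close> of the tableau consists of the state and the scanned symbols, held by the variable
  \<open>(t, num_tapes M, 0)\<close>, and of the squares \<open>(t, j, i)\<close>, where \<open>i\<close> stands for the position
  \<open>i - T - 1\<close> on tape \<open>j\<close>.\<close>

definition infos :: "(nat \<times> nat list) set" where
  "infos = {..num_states M} \<times> {as. set as \<subseteq> {..<num_symbols M} \<and> length as = num_tapes M}"

definition cells :: "(nat \<times> bool) set" where
  "cells = {..<num_symbols M} \<times> UNIV"

text \<open>Both kinds of entries share one alphabet; the injections into the sum type keep their
  numbers apart.\<close>

definition ci :: "nat \<times> nat list \<Rightarrow> nat" where
  "ci I = to_nat (Inl I :: (nat \<times> nat list) + (nat \<times> bool))"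

definition cc :: "nat \<times> bool \<Rightarrow> nat" where
  "cc c = to_nat (Inr c :: (nat \<times> nat list) + (nat \<times> bool))"

definition K :: nat where
  "K = Suc (Max (ci ` infos \<union> cc ` cells))"

text \<open>A halted machine idles, so a run that ends early still fills all rows of the
  tableau.\<close>

definition next_state :: "nat \<times> nat list \<Rightarrow> nat" where
  "next_state I = (if fst I < num_states M then fst (transition M (fst I) (snd I)) else fst I)"

definition acts :: "nat \<times> nat list \<Rightarrow> (nat \<times> direction) list" where
  "acts I = (if fst I < num_states M then snd (transition M (fst I) (snd I)) else idle (snd I))"

lemma ci_cc [simp]: "ci I = ci J \<longleftrightarrow> I = J" "cc c = cc d \<longleftrightarrow> c = d" "ci I \<noteq> cc c" "cc c \<noteq> ci I"
  by (simp_all add: ci_def cc_def)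

lemma finite_infos [simp]: "finite infos" and finite_cells [simp]: "finite cells"
  by (simp_all add: infos_def cells_def finite_lists_length_eq)

lemma ci_less: "I \<in> infos \<Longrightarrow> ci I < K" and cc_less: "c \<in> cells \<Longrightarrow> cc c < K"
  by (simp_all add: K_def less_Suc_eq_le)

lemma num: "num_tapes M \<ge> 1" "num_symbols M \<ge> 3"
  using valid by (simp_all add: valid_machine_def)

lemma acts_valid:
  assumes "I \<in> infos"
  shows "next_state I \<le> num_states M" "length (acts I) = num_tapes M" "x \<in> set (acts I) \<Longrightarrow>
      fst x < num_symbols M"
proof -
  obtain q as where I: "I = (q, as)" by (cases I)
  have as: "length as = num_tapes M" "set as \<subseteq> {..<num_symbols M}" "q \<le> num_states M"
    using assms I by (auto simp: infos_def)
  have "q < num_states M \<Longrightarrow> fst (transition M q as) \<le> num_states M \<and>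
      length (snd (transition M q as)) = num_tapes M \<and> fst ` set (snd (transition M q as)) \<subseteq>
          {..<num_symbols M}"
    using valid as unfolding valid_machine_def by (simp add: case_prod_beta)
  note tr = this
  then show "next_state I \<le> num_states M" "length (acts I) = num_tapes M"
    using as by (auto simp: I next_state_def acts_def idle_def)
  assume x: "x \<in> set (acts I)"
  show "fst x < num_symbols M"
  proof (cases "q < num_states M")
    case True
    then have "fst x \<in> fst ` set (snd (transition M q as))" using x by (simp add: I acts_def)
    then show ?thesis using tr[OF True] by blast
  next
    case False
    then show ?thesis using x as by (auto simp: I acts_def idle_def)
  qed
qed

lemma step_eq: "step M (q, ts) = (next_state (q, reads ts), map2 act ts (acts (q, reads ts)))"
  by (simp add: next_state_def acts_def reads_def[symmetric] case_prod_beta)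

definition run :: "bool list \<Rightarrow> nat \<Rightarrow> nat \<times> tape list" where
  "run z t = (step M ^^ t) (initial M z)"

text \<open>Within \<open>t\<close> steps a head stays within distance \<open>t\<close> of position
  0, and it can only write where it has been. This confines the whole run to a strip whose border
  squares are blank.\<close>

lemma run_inv:
  "fst (run z t) \<le> num_states M \<and> length (snd (run z t)) = num_tapes M \<and>
   (\<forall>u \<in> set (snd (run z t)). (\<forall>p. fst u p < num_symbols M) \<and> \<bar>snd u\<bar> \<le> int t \<and>
      (\<forall>p. p < - int t \<or> p > int t + int (length z) \<longrightarrow> fst u p = 0))"
proof (induction t)
  case 0
  have "word_contents z p < num_symbols M" for p using num by (simp add: word_contents_def)
  then show ?case using num by (auto simp: run_def initial_def word_contents_def)
next
  case (Suc t)
  obtain q ts where qt: "run z t = (q, ts)" by (cases "run z t")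
  have inv: "q \<le> num_states M" "length ts = num_tapes M" "\<And>u p. u \<in> set ts \<Longrightarrow> fst u p < num_symbols M"
    "\<And>u. u \<in> set ts \<Longrightarrow> \<bar>snd u\<bar> \<le> int t"
    "\<And>u p. u \<in> set ts \<Longrightarrow> p < - int t \<or> p > int t + int (length z) \<Longrightarrow> fst u p = 0"
    using Suc qt by auto
  have I: "(q, reads ts) \<in> infos" using inv(1-3) by (auto simp: infos_def reads_def)
  have new: "run z (Suc t) = (next_state (q, reads ts), map2 act ts (acts (q, reads ts)))"
    using qt step_eq by (simp add: run_def)
  have "(\<forall>p. fst u p < num_symbols M) \<and> \<bar>snd u\<bar> \<le> int (Suc t) \<and>
      (\<forall>p. p < - int (Suc t) \<or> p > int (Suc t) + int (length z) \<longrightarrow> fst u p = 0)"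
    if u: "u \<in> set (map2 act ts (acts (q, reads ts)))" for u
  proof -
    obtain vx where vx: "vx \<in> set (zip ts (acts (q, reads ts)))" "u = (case vx of (v, x) \<Rightarrow> act v x)"
      using u unfolding set_map by blast
    obtain v x where "vx = (v, x)" by (cases vx)
    with vx have v: "v \<in> set ts" "x \<in> set (acts (q, reads ts))" "u = act v x"
      using set_zip_leftD set_zip_rightD by fastforce+
    obtain c h b d where ch: "v = (c, h)" "x = (b, d)" by (cases v; cases x) auto
    have "b < num_symbols M" using acts_valid(3)[OF I v(2)] ch by simp
    moreover have "\<bar>h\<bar> \<le> int t" using inv(4)[OF v(1)] ch by simp
    ultimately show ?thesis using inv(3)[OF v(1)] inv(5)[OF v(1)] v(3) ch
      by (auto split: direction.splits)
  qed
  then show ?case using acts_valid(1,2)[OF I] inv(2) by (simp add: new)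
qed

definition accepts :: "bool list \<Rightarrow> nat \<Rightarrow> bool" where
  "accepts z T \<longleftrightarrow> fst (run z T) = num_states M \<and> fst (hd (snd (run z T))) = word_contents [True]"

definition var_list :: "nat \<Rightarrow> nat \<Rightarrow> (nat \<times> nat \<times> nat) list" where
  "var_list T W = map (\<lambda>t. (t, num_tapes M, 0)) [0..<Suc T] @
     List.product [0..<Suc T] (List.product [0..<num_tapes M] [0..<W])"

text \<open>The start row: square \<open>Suc T\<close> is position 0, where the input begins. The part \<open>inp\<close> of the
  input is given, and at most \<open>m\<close> further symbols are free.\<close>

definition start_cells :: "nat \<Rightarrow> bool list \<Rightarrow> nat \<Rightarrow> nat \<Rightarrow> nat \<Rightarrow> nat list" where
  "start_cells T inp m j i =
     (if j = 0 then
        (if i < Suc T then [cc (0, False)]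
         else if i - Suc T < length inp then
           (if nth_or False inp (i - Suc T)
            then (if i = Suc T then [cc (2, True)] else [cc (2, False)])
            else (if i = Suc T then [cc (1, True)] else [cc (1, False)]))
         else if i - Suc T < length inp + m then [cc (0, False), cc (1, False), cc (2, False)]
         else [cc (0, False)])
      else (if i = Suc T then [cc (0, True)] else [cc (0, False)]))"

text \<open>All constraints on a single variable are put into its domain: initial and halting state,
  blank borders, the start row, and the output \<open>[True]\<close> on the first tape of row
  \<open>T\<close>, whose single symbol 2 is in square \<open>Suc T\<close>.\<close>

definition dmn :: "nat \<Rightarrow> nat \<Rightarrow> bool list \<Rightarrow> nat \<Rightarrow> nat \<times> nat \<times> nat \<Rightarrow> nat list" where
  "dmn T W inp m v =
     (if fst (snd v) = num_tapes M then
        (if fst v = 0 then listing (ci ` {I \<in> infos. fst I = 0})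
         else if fst v = T then listing (ci ` {I \<in> infos. fst I = num_states M})
         else listing (ci ` infos))
      else if snd (snd v) = 0 \<or> Suc (snd (snd v)) = W then [cc (0, False)]
      else if fst v = 0 then start_cells T inp m (fst (snd v)) (snd (snd v))
      else if fst v = T \<and> fst (snd v) = 0 then
        (if snd (snd v) = Suc T then [cc (2, False), cc (2, True)] else [cc (0, False), cc (0, True)])
      else listing (cc ` cells))"

text \<open>Conflicts do not mention a place in the tableau. They form a constant list, of which the
  forbidden assignments are shifted copies.\<close>

definition read_conflicts :: "(nat \<times> nat \<times> nat) list" where
  "read_conflicts = listing ((\<lambda>x. (fst x, ci (fst (snd x)), cc (snd (snd x), True))) `
     {x \<in> {..<num_tapes M} \<times> infos \<times> {..<num_symbols M}. snd (fst (snd x)) ! fst x \<noteq> snd (snd x)})"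

definition state_conflicts :: "(nat \<times> nat) list" where
  "state_conflicts = listing ((\<lambda>x. (ci (fst x), ci (snd x))) ` {x \<in> infos \<times> infos. fst (snd x) \<noteq> next_state
      (fst x)})"

definition square_conflicts :: "(nat \<times> nat \<times> nat \<times> nat \<times> nat \<times> nat) list" where
  "square_conflicts = listing ((\<lambda>(j, I, l, c, r, d). (j, ci I, cc l, cc c, cc r, cc d)) `
     {x \<in> {..<num_tapes M} \<times> infos \<times> cells \<times> cells \<times> cells \<times> cells.
        case x of (j, I, l, c, r, d) \<Rightarrow> d \<noteq> upd (acts I ! j) l c r})"

definition forbid_read :: "nat \<Rightarrow> nat \<Rightarrow> ((nat \<times> nat \<times> nat) \<times> nat) list list" where
  "forbid_read T W = concat (map (\<lambda>t. concat (map (\<lambda>i. map (\<lambda>x.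
     [((t, num_tapes M, 0), fst (snd x)), ((t, fst x, i), snd (snd x))]) read_conflicts) [0..<W]))
         [0..<Suc T])"

definition forbid_state :: "nat \<Rightarrow> ((nat \<times> nat \<times> nat) \<times> nat) list list" where
  "forbid_state T = concat (map (\<lambda>t. map (\<lambda>x.
     [((t, num_tapes M, 0), fst x), ((Suc t, num_tapes M, 0), snd x)]) state_conflicts) [0..<T])"

definition forbid_square :: "nat \<Rightarrow> nat \<Rightarrow> ((nat \<times> nat \<times> nat) \<times> nat) list list" where
  "forbid_square T W = concat (map (\<lambda>t. concat (map (\<lambda>i. map (\<lambda>x.
     [((t, num_tapes M, 0), fst (snd x)), ((t, fst x, i), fst (snd (snd x))),
      ((t, fst x, Suc i), fst (snd (snd (snd x)))), ((t, fst x, Suc (Suc i)), fst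
          (snd (snd (snd (snd x))))),
      ((Suc t, fst x, Suc i), snd (snd (snd (snd (snd x)))))]) square_conflicts) [0..<W - 2])) [0..<T])"

text \<open>No bit may follow a blank among the free squares, so they spell a word with blanks
  behind it. There are \<open>m - 1\<close> pairs of neighbours among \<open>m\<close>
  squares.\<close>

definition forbid_tail :: "nat \<Rightarrow> nat \<Rightarrow> nat \<Rightarrow> ((nat \<times> nat \<times> nat) \<times> nat) list list" where
  "forbid_tail T n m = concat (map (\<lambda>i. map (\<lambda>x.
     [((0, 0, Suc T + n + i), cc (0, False)), ((0, 0, Suc T + n + Suc i), x)]) [cc (1, False), cc
         (2, False)]) [0..<m - 1])"

definition forbidden :: "nat \<Rightarrow> nat \<Rightarrow> nat \<Rightarrow> nat \<Rightarrow> ((nat \<times> nat \<times> nat) \<times> nat) list list" where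
  "forbidden T W n m = forbid_read T W @ forbid_state T @ forbid_square T W @ forbid_tail T n m"

lemma set_conflicts:
  "set read_conflicts = {(j, ci I, cc (a, True)) | j I a. j < num_tapes M \<and> I \<in> infos \<and> a < num_symbols M \<and>
      snd I ! j \<noteq> a}"
  "set state_conflicts = {(ci I, ci J) | I J. I \<in> infos \<and> J \<in> infos \<and> fst J \<noteq> next_state I}"
  "set square_conflicts = {(j, ci I, cc l, cc c, cc r, cc d) | j I l c r d. j < num_tapes M \<and> I \<in> infos \<and>
      l \<in> cells \<and>
     c \<in> cells \<and> r \<in> cells \<and> d \<in> cells \<and> d \<noteq> upd (acts I ! j) l c r}"
proof -
  have "finite {x \<in> {..<num_tapes M} \<times> infos \<times> {..<num_symbols M}. snd (fst (snd x)) ! fst x \<noteq> snd (snd x)}"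
    by (rule finite_subset[of _ "{..<num_tapes M} \<times> infos \<times> {..<num_symbols M}"]) auto
  then show "set read_conflicts = {(j, ci I, cc (a, True)) | j I a. j < num_tapes M \<and> I \<in> infos \<and>
      a < num_symbols M \<and> snd I ! j \<noteq> a}"
    by (force simp: read_conflicts_def)
  have "finite {x \<in> infos \<times> infos. fst (snd x) \<noteq> next_state (fst x)}"
    by (rule finite_subset[of _ "infos \<times> infos"]) auto
  then show "set state_conflicts = {(ci I, ci J) | I J. I \<in> infos \<and> J \<in> infos \<and> fst J \<noteq> next_state I}"
    by (force simp: state_conflicts_def)
  have "finite {x \<in> {..<num_tapes M} \<times> infos \<times> cells \<times> cells \<times> cells \<times> cells.
        case x of (j, I, l, c, r, d) \<Rightarrow> d \<noteq> upd (acts I ! j) l c r}"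
    by (rule finite_subset[of _ "{..<num_tapes M} \<times> infos \<times> cells \<times> cells \<times> cells \<times> cells"]) auto
  from set_listing[OF finite_imageI[OF this, of "\<lambda>(j, I, l, c, r, d). (j, ci I, cc l, cc c, cc r, cc d)"]]
  show "set square_conflicts = {(j, ci I, cc l, cc c, cc r, cc d) | j I l c r d. j < num_tapes M \<and>
      I \<in> infos \<and> l \<in> cells \<and>
     c \<in> cells \<and> r \<in> cells \<and> d \<in> cells \<and> d \<noteq> upd (acts I ! j) l c r}"
    unfolding square_conflicts_def by (simp only:) (auto simp: image_iff)
qed

lemma set_var_list: "v \<in> set (var_list T W) \<longleftrightarrow> (\<exists>t \<le> T. v = (t, num_tapes M, 0)) \<or>
    (\<exists>t j i. t \<le> T \<and> j < num_tapes M \<and> i < W \<and> v = (t, j, i))"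
  by (auto simp: var_list_def less_Suc_eq_le simp del: upt_Suc)

lemma distinct_var_list: "distinct (var_list T W)"
  unfolding var_list_def
  by (auto simp: distinct_map inj_on_def intro!: distinct_product simp del: upt_Suc)

text \<open>For \<open>T \<ge> 1\<close> this provides the two variables that
  \<open>csp_instance_iff\<close> asks for.\<close>

lemma length_var_list: "length (var_list T W) \<ge> Suc T"
  by (simp add: var_list_def)

lemma in_infos: "I \<in> infos \<longleftrightarrow> fst I \<le> num_states M \<and> length (snd I) = num_tapes M \<and>
    (\<forall>a \<in> set (snd I). a < num_symbols M)"
  by (cases I) (auto simp: infos_def)

lemma in_cells: "c \<in> cells \<longleftrightarrow> fst c < num_symbols M"
  by (cases c) (simp add: cells_def)

lemma start_cells_cells: "x \<in> set (start_cells T inp m j i) \<Longrightarrow> x \<in> cc ` cells"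
  using num by (auto simp: start_cells_def in_cells split: if_splits intro!: imageI)

lemma dmn_info: "T \<ge> 1 \<Longrightarrow> x \<in> set (dmn T W inp m (t, num_tapes M, 0)) \<longleftrightarrow>
    (\<exists>I \<in> infos. x = ci I \<and> (t = 0 \<longrightarrow> fst I = 0) \<and> (t = T \<longrightarrow> fst I = num_states M))"
  by (auto simp: dmn_def)

lemma dmn_cell:
  assumes "T \<ge> 1" "j < num_tapes M"
  shows "x \<in> set (dmn T W inp m (t, j, i)) \<longleftrightarrow> (\<exists>c \<in> cells. x = cc c \<and>
     (i = 0 \<or> Suc i = W \<longrightarrow> c = (0, False)) \<and>
     (i \<noteq> 0 \<and> Suc i \<noteq> W \<and> t = 0 \<longrightarrow> x \<in> set (start_cells T inp m j i)) \<and>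
     (i \<noteq> 0 \<and> Suc i \<noteq> W \<and> t = T \<and> j = 0 \<longrightarrow> fst c = (if i = Suc T then 2 else 0)))"
proof (cases "i \<noteq> 0 \<and> Suc i \<noteq> W \<and> t = 0")
  case True
  then show ?thesis using assms start_cells_cells[of x T inp m j i] by (auto simp: dmn_def)
next
  case False
  have "(c = (n, False) \<or> c = (n, True)) \<longleftrightarrow> fst c = n" for c :: "nat \<times> bool" and n by (cases c) auto
  note 1 = this[symmetric]
  show ?thesis using assms False num
    by (auto simp: dmn_def 1 in_cells)
qed

lemma ball_upt: "(\<forall>t \<in> {0..<n}. P t) \<longleftrightarrow> (\<forall>t < (n :: nat). P t)"
  by auto

lemma ball_read_conflicts: "(\<forall>x \<in> set read_conflicts. Q x) \<longleftrightarrow> (\<forall>j < num_tapes M. \<forall>I \<in> infos. \<forall>a <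
    num_symbols M.
    snd I ! j \<noteq> a \<longrightarrow> Q (j, ci I, cc (a, True)))"
  unfolding set_conflicts by blast

lemma ball_state_conflicts: "(\<forall>x \<in> set state_conflicts. Q x) \<longleftrightarrow> (\<forall>I \<in> infos. \<forall>J \<in> infos. fst J \<noteq> next_state
    I \<longrightarrow> Q (ci I, ci J))"
  unfolding set_conflicts by blast

lemma ball_square_conflicts: "(\<forall>x \<in> set square_conflicts. Q x) \<longleftrightarrow> (\<forall>j < num_tapes M. \<forall>I \<in> infos. \<forall>l \<in> cells.
    \<forall>c \<in> cells.
    \<forall>r \<in> cells. \<forall>d \<in> cells. d \<noteq> upd (acts I ! j) l c r \<longrightarrow> Q (j, ci I, cc l, cc c, cc r, cc d))"
  unfolding set_conflicts by blast

lemma forbid_read_all: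
  "(\<forall>f \<in> set (forbid_read T W). \<exists>e \<in> set f. A (fst e) \<noteq> snd e) \<longleftrightarrow>
     (\<forall>t \<le> T. \<forall>i < W. \<forall>j < num_tapes M. \<forall>I \<in> infos. \<forall>a < num_symbols M. snd I ! j \<noteq> a \<longrightarrow>
        A (t, num_tapes M, 0) \<noteq> ci I \<or> A (t, j, i) \<noteq> cc (a, True))"
  by (simp add: forbid_read_def ball_upt less_Suc_eq_le ball_read_conflicts del: upt_Suc)

lemma forbid_state_all:
  "(\<forall>f \<in> set (forbid_state T). \<exists>e \<in> set f. A (fst e) \<noteq> snd e) \<longleftrightarrow>
     (\<forall>t < T. \<forall>I \<in> infos. \<forall>J \<in> infos. fst J \<noteq> next_state I \<longrightarrow>
        A (t, num_tapes M, 0) \<noteq> ci I \<or> A (Suc t, num_tapes M, 0) \<noteq> ci J)"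
  by (simp add: forbid_state_def ball_upt ball_state_conflicts)

lemma forbid_square_all:
  "(\<forall>f \<in> set (forbid_square T W). \<exists>e \<in> set f. A (fst e) \<noteq> snd e) \<longleftrightarrow>
     (\<forall>t < T. \<forall>i < W - 2. \<forall>j < num_tapes M. \<forall>I \<in> infos. \<forall>l \<in> cells. \<forall>c \<in> cells. \<forall>r \<in> cells. \<forall>d \<in> cells.
        d \<noteq> upd (acts I ! j) l c r \<longrightarrow> A (t, num_tapes M, 0) \<noteq> ci I \<or> A (t, j, i) \<noteq> cc l \<or>
          A (t, j, Suc i) \<noteq> cc c \<or> A (t, j, Suc (Suc i)) \<noteq> cc r \<or> A (Suc t, j, Suc i) \<noteq> cc d)"
  by (simp add: forbid_square_def ball_upt ball_square_conflicts)

lemma forbid_tail_all: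
  "(\<forall>f \<in> set (forbid_tail T n m). \<exists>e \<in> set f. A (fst e) \<noteq> snd e) \<longleftrightarrow>
     (\<forall>i < m - 1. \<forall>x \<in> {cc (1, False), cc (2, False)}.
        A (0, 0, Suc T + n + i) \<noteq> cc (0, False) \<or> A (0, 0, Suc T + n + Suc i) \<noteq> x)"
  by (auto simp: forbid_tail_def)

lemmas forbidden_all = forbid_read_all forbid_state_all forbid_square_all forbid_tail_all

lemma forbidden_vars:
  assumes "f \<in> set (forbidden T W n m)" "W = 2 * T + n + m + 3"
  shows "distinct (map fst f) \<and> fst ` set f \<subseteq> set (var_list T W) \<and> (\<forall>e \<in> set f. snd e < K)"
proof -
  have 012: "(0, b) \<in> cells" "(Suc 0, b) \<in> cells" "(2, b) \<in> cells" for b using num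
      by (simp_all add: in_cells)
  consider "f \<in> set (forbid_read T W)" | "f \<in> set (forbid_state T)" | "f \<in> set (forbid_square T W)" |
      "f \<in> set (forbid_tail T n m)"
    using assms(1) by (auto simp: forbidden_def)
  then show ?thesis
  proof cases
    case 1
    then show ?thesis
      by (auto simp: forbid_read_def set_conflicts set_var_list in_cells intro!: ci_less cc_less simp del:
          upt_Suc)
  next
    case 2
    then show ?thesis by (auto simp: forbid_state_def set_conflicts set_var_list intro!: ci_less)
  next
    case 3
    then show ?thesis by (auto simp: forbid_square_def set_conflicts set_var_list intro!: ci_less cc_less)
  next
    case 4
    then show ?thesis using num assms(2) by (auto simp: forbid_tail_def set_var_list 012 intro!: cc_less)
  qed
qed

lemma dmn_less:
  assumes "T \<ge> 1" "v \<in> set (var_list T W)" "s \<in> set (dmn T W inp m v)"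
  shows "s < K"
  using assms ci_less cc_less unfolding set_var_list by (auto simp: dmn_info dmn_cell)

end

text \<open>A solution of the constraints with the encodings \<open>ci\<close> and \<open>cc\<close>
  stripped off: \<open>I t\<close> is the state and the scanned symbols of row \<open>t\<close>, and
  \<open>C t j i\<close> is square \<open>i\<close> of tape \<open>j\<close> in that row.\<close>

locale tableau_rules = tableau +
  fixes T W :: nat and inp :: "bool list" and m :: nat
    and I :: "nat \<Rightarrow> nat \<times> nat list" and C :: "nat \<Rightarrow> nat \<Rightarrow> nat \<Rightarrow> nat \<times> bool"
  assumes info: "t \<le> T \<Longrightarrow> I t \<in> infos"
    and info_first: "fst (I 0) = 0"
    and info_last: "fst (I T) = num_states M"
    and cell: "t \<le> T \<Longrightarrow> j < num_tapes M \<Longrightarrow> i < W \<Longrightarrow> C t j i \<in> cells"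
    and border: "t \<le> T \<Longrightarrow> j < num_tapes M \<Longrightarrow> i < W \<Longrightarrow> i = 0 \<or> Suc i = W \<Longrightarrow> C t j i = (0, False)"
    and start: "j < num_tapes M \<Longrightarrow> i < W \<Longrightarrow> i \<noteq> 0 \<Longrightarrow> Suc i \<noteq> W \<Longrightarrow> cc (C 0 j i) \<in> set (start_cells T inp m j i)"
    and last: "i < W \<Longrightarrow> i \<noteq> 0 \<Longrightarrow> Suc i \<noteq> W \<Longrightarrow> fst (C T 0 i) = (if i = Suc T then 2 else 0)"
    and reading: "t \<le> T \<Longrightarrow> j < num_tapes M \<Longrightarrow> i < W \<Longrightarrow> snd (C t j i) \<Longrightarrow> snd (I t) ! j = fst (C t j i)"
    and state: "t < T \<Longrightarrow> fst (I (Suc t)) = next_state (I t)"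
    and cell_Suc: "t < T \<Longrightarrow> j < num_tapes M \<Longrightarrow> i < W - 2 \<Longrightarrow> C (Suc t) j (Suc i) = upd (acts (I t) ! j)
        (C t j i) (C t j (Suc i)) (C t j (Suc (Suc i)))"
    and blank_tail: "i < m - 1 \<Longrightarrow> C 0 0 (Suc T + length inp + i) = (0, False) \<Longrightarrow>
        C 0 0 (Suc T + length inp + Suc i) \<notin> {(1, False), (2, False)}"


context tableau
begin

lemma assignment_iff_rules:
  assumes T: "T \<ge> 1" and W: "W = 2 * T + length inp + m + 3"
  shows "(\<exists>A. (\<forall>v \<in> set (var_list T W). A v \<in> set (dmn T W inp m v)) \<and>
      (\<forall>f \<in> set (forbidden T W (length inp) m). \<exists>e \<in> set f. A (fst e) \<noteq> snd e)) \<longleftrightarrow>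
          (\<exists>I C. tableau_rules M T W inp m I C)"
proof
  assume "\<exists>A. (\<forall>v \<in> set (var_list T W). A v \<in> set (dmn T W inp m v)) \<and>
      (\<forall>f \<in> set (forbidden T W (length inp) m). \<exists>e \<in> set f. A (fst e) \<noteq> snd e)"
  then obtain A where A: "\<And>v. v \<in> set (var_list T W) \<Longrightarrow> A v \<in> set (dmn T W inp m v)"
    and forb: "\<forall>f \<in> set (forbidden T W (length inp) m). \<exists>e \<in> set f. A (fst e) \<noteq> snd e" by blast
  define I where "I t = inv ci (A (t, num_tapes M, 0))" for t
  define C where "C t j i = inv cc (A (t, j, i))" for t j i
  have inv: "inv ci (ci J) = J" "inv cc (cc c) = c" for J c
    by (simp_all add: inv_f_f inj_def)
  have I: "I t \<in> infos \<and> A (t, num_tapes M, 0) = ci (I t) \<and> (t = 0 \<longrightarrow> fst (I t) = 0) \<and>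
      (t = T \<longrightarrow> fst (I t) = num_states M)"
    if t: "t \<le> T" for t
  proof -
    have "(t, num_tapes M, 0) \<in> set (var_list T W)" using t by (simp add: set_var_list)
    from A[OF this] show ?thesis unfolding dmn_info[OF T] by (auto simp: I_def inv)
  qed
  have C: "C t j i \<in> cells \<and> A (t, j, i) = cc (C t j i) \<and> (i = 0 \<or> Suc i = W \<longrightarrow> C t j i = (0, False)) \<and>
     (i \<noteq> 0 \<and> Suc i \<noteq> W \<and> t = 0 \<longrightarrow> cc (C t j i) \<in> set (start_cells T inp m j i)) \<and>
     (i \<noteq> 0 \<and> Suc i \<noteq> W \<and> t = T \<and> j = 0 \<longrightarrow> fst (C t j i) = (if i = Suc T then 2 else 0))"
    if t: "t \<le> T" and j: "j < num_tapes M" and i: "i < W" for t j i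
  proof -
    have "(t, j, i) \<in> set (var_list T W)" using t j i by (simp add: set_var_list)
    from A[OF this] show ?thesis unfolding dmn_cell[OF T j] by (auto simp: C_def inv)
  qed
  have f: "\<forall>f \<in> set (forbid_read T W). \<exists>e \<in> set f. A (fst e) \<noteq> snd e" "\<forall>f \<in> set (forbid_state T). \<exists>e \<in> set
      f. A (fst e) \<noteq> snd e"
    "\<forall>f \<in> set (forbid_square T W). \<exists>e \<in> set f. A (fst e) \<noteq> snd e" "\<forall>f \<in> set (forbid_tail T (length inp) m).
        \<exists>e \<in> set f. A (fst e) \<noteq> snd e"
    using forb by (simp_all add: forbidden_def)
  note f = f[unfolded forbidden_all]
  have reading: "snd (I t) ! j = fst (C t j i)" if "t \<le> T" "j < num_tapes M" "i < W" "snd (C t j i)"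
      for t j i
  proof (rule ccontr)
    assume "snd (I t) ! j \<noteq> fst (C t j i)"
    moreover have "C t j i = (fst (C t j i), True)" using that(4) by (cases "C t j i") simp
    ultimately show False using f(1) I[OF that(1)] C[OF that(1,2,3)] that(1,2,3) in_cells by metis
  qed
  have state: "fst (I (Suc t)) = next_state (I t)" if "t < T" for t
    using f(2) I[of t] I[of "Suc t"] that by (metis Suc_leI less_imp_le)
  have cell: "C (Suc t) j (Suc i) = upd (acts (I t) ! j) (C t j i) (C t j (Suc i)) (C t j (Suc (Suc i)))"
    if t: "t < T" and j: "j < num_tapes M" and i: "i < W - 2" for t j i
  proof -
    have lt: "i < W" "Suc i < W" "Suc (Suc i) < W" "t \<le> T" "Suc t \<le> T" using i t by auto
    show ?thesis
    proof (rule ccontr)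
      assume "\<not> ?thesis"
      from f(3)[rule_format, OF t i j _ _ _ _ _ this] show False
        using I[OF lt(4)] C[OF lt(4) j lt(1)] C[OF lt(4) j lt(2)] C[OF lt(4) j lt(3)] C[OF lt(5) j lt(2)]
            by metis
    qed
  qed
  have free: "C 0 0 (Suc T + length inp + Suc i) \<notin> {(1, False), (2, False)}"
    if i: "i < m - 1" and c: "C 0 0 (Suc T + length inp + i) = (0, False)" for i
  proof
    assume *: "C 0 0 (Suc T + length inp + Suc i) \<in> {(1, False), (2, False)}"
    have "A (0, 0, Suc T + length inp + i) = cc (0, False)"
      using C[of 0 0 "Suc T + length inp + i"] c num i W by simp
    moreover have "A (0, 0, Suc T + length inp + Suc i) = cc (C 0 0 (Suc T + length inp + Suc i))"
      using C[of 0 0 "Suc T + length inp + Suc i"] num i W by simp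
    ultimately show False using f(4)[rule_format, OF i, of "cc (C 0 0 (Suc T + length inp + Suc i))"] *
        by auto
  qed
  have "tableau_rules M T W inp m I C"
  proof unfold_locales
    show "I t \<in> infos" if "t \<le> T" for t using I[OF that] by simp
    show "fst (I 0) = 0" using I[of 0] by simp
    show "fst (I T) = num_states M" using I[of T] by simp
    show "C t j i \<in> cells" if "t \<le> T" "j < num_tapes M" "i < W" for t j i using C[OF that] by simp
    show "C t j i = (0, False)" if "t \<le> T" "j < num_tapes M" "i < W" "i = 0 \<or> Suc i = W" for t j i
      using C[OF that(1-3)] that(4) by simp
    show "cc (C 0 j i) \<in> set (start_cells T inp m j i)" if "j < num_tapes M" "i < W" "i \<noteq> 0" "Suc i \<noteq> W"
        for j i
      using C[OF le0 that(1,2)] that(3,4) by simp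
    show "fst (C T 0 i) = (if i = Suc T then 2 else 0)" if "i < W" "i \<noteq> 0" "Suc i \<noteq> W" for i
      using C[OF le_refl _ that(1), of 0] that(2,3) num by simp
  qed (fact reading state cell free)+
  then show "\<exists>I C. tableau_rules M T W inp m I C" by blast
next
  assume "\<exists>I C. tableau_rules M T W inp m I C"
  then obtain I C where r: "tableau_rules M T W inp m I C" by blast
  define A where "A v = (if fst (snd v) = num_tapes M then ci (I (fst v)) else cc (C (fst v) (fst (snd v))
      (snd (snd v))))" for v
  have AI: "A (t, num_tapes M, i) = ci (I t)" for t i by (simp add: A_def)
  have AC: "A (t, j, i) = cc (C t j i)" if "j < num_tapes M" for t j i using that by (simp add: A_def)
  have AC0: "A (t, 0, i) = cc (C t 0 i)" for t i using AC num by simp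
  have "A v \<in> set (dmn T W inp m v)" if "v \<in> set (var_list T W)" for v
    using that unfolding set_var_list
  proof (elim disjE exE conjE)
    fix t assume "t \<le> T" "v = (t, num_tapes M, 0)"
    then show ?thesis using tableau_rules.info[OF r] tableau_rules.info_first[OF r]
        tableau_rules.info_last[OF r] T by (auto simp: dmn_info AI)
  next
    fix t j i assume *: "t \<le> T" "j < num_tapes M" "i < W" "v = (t, j, i)"
    have "C t j i \<in> cells" "i = 0 \<or> Suc i = W \<longrightarrow> C t j i = (0, False)"
      using tableau_rules.cell[OF r *(1,2,3)] tableau_rules.border[OF r *(1,2,3)] by blast+
    moreover have "i \<noteq> 0 \<and> Suc i \<noteq> W \<and> t = 0 \<longrightarrow> cc (C t j i) \<in> set (start_cells T inp m j i)"
      using tableau_rules.start[OF r *(2,3)] by blast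
    moreover have "i \<noteq> 0 \<and> Suc i \<noteq> W \<and> t = T \<and> j = 0 \<longrightarrow> fst (C t j i) = (if i = Suc T then 2 else 0)"
      using tableau_rules.last[OF r *(3)] by blast
    ultimately have "A (t, j, i) \<in> set (dmn T W inp m (t, j, i))" unfolding dmn_cell[OF T *(2)] AC[OF *(2)]
        by blast
    then show ?thesis using * by simp
  qed
  moreover have "\<forall>f \<in> set (forbid_read T W). \<exists>e \<in> set f. A (fst e) \<noteq> snd e"
    unfolding forbidden_all
  proof (intro allI ballI impI)
    fix t i j a and J :: "nat \<times> nat list" assume "t \<le> T" "i < W" "j < num_tapes M" "snd J ! j \<noteq> a"
    then show "A (t, num_tapes M, 0) \<noteq> ci J \<or> A (t, j, i) \<noteq> cc (a, True)"
      using tableau_rules.reading[OF r, of t j i] by (auto simp: AI AC)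
  qed
  moreover have "\<forall>f \<in> set (forbid_state T). \<exists>e \<in> set f. A (fst e) \<noteq> snd e"
    unfolding forbidden_all
  proof (intro allI ballI impI)
    fix t and J J' :: "nat \<times> nat list" assume "t < T" "fst J' \<noteq> next_state J"
    then show "A (t, num_tapes M, 0) \<noteq> ci J \<or> A (Suc t, num_tapes M, 0) \<noteq> ci J'"
      using tableau_rules.state[OF r, of t] by (auto simp: AI)
  qed
  moreover have "\<forall>f \<in> set (forbid_square T W). \<exists>e \<in> set f. A (fst e) \<noteq> snd e"
    unfolding forbidden_all
  proof (intro allI ballI impI)
    fix t i j l c e d and J :: "nat \<times> nat list" assume "t < T" "i < W - 2" "j < num_tapes M"
        "d \<noteq> upd (acts J ! j) l c e"
    then show "A (t, num_tapes M, 0) \<noteq> ci J \<or> A (t, j, i) \<noteq> cc l \<or>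
          A (t, j, Suc i) \<noteq> cc c \<or> A (t, j, Suc (Suc i)) \<noteq> cc e \<or> A (Suc t, j, Suc i) \<noteq> cc d"
      using tableau_rules.cell_Suc[OF r, of t j i] by (auto simp: AI AC)
  qed
  moreover have "\<forall>f \<in> set (forbid_tail T (length inp) m). \<exists>e \<in> set f. A (fst e) \<noteq> snd e"
    unfolding forbidden_all
  proof (intro allI ballI impI)
    fix i x assume "i < m - 1" "x \<in> {cc (1, False), cc (2, False)}"
    then show "A (0, 0, Suc T + length inp + i) \<noteq> cc (0, False) \<or> A (0, 0, Suc T + length inp + Suc i) \<noteq> x"
      using tableau_rules.blank_tail[OF r, of i] by (auto simp: AC0)
  qed
  ultimately show "\<exists>A. (\<forall>v \<in> set (var_list T W). A v \<in> set (dmn T W inp m v)) \<and>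
      (\<forall>f \<in> set (forbidden T W (length inp) m). \<exists>e \<in> set f. A (fst e) \<noteq> snd e)"
    by (intro exI[of _ A]) (auto simp: forbidden_def)
qed

text \<open>To the left of position 0 there are the \<open>T\<close> squares that a head can reach
  and one border square. With an input of length at most \<open>n + m\<close> the right border is at
  position \<open>T + n + m + 1\<close>, which accounts for the width
  \<open>2 * T + n + m + 3\<close>.\<close>

definition pos :: "nat \<Rightarrow> nat \<Rightarrow> int" where
  "pos T i = int i - int (Suc T)"

lemma initial_view:
  assumes "j < num_tapes M"
  shows "view (snd (run z 0) ! j) p = (if j = 0 then word_contents z p else 0, p = 0)"
  using assms by (auto simp: run_def initial_def view_def nth_Cons split: nat.split)

lemma word_contents_pos: "word_contents z (pos T i) =
    (if i < Suc T then 0 else if i - Suc T < length z then (if z ! (i - Suc T) then 2 else 1) else 0)"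
proof (cases "i < Suc T")
  case False
  then obtain k where "i = Suc T + k" using le_Suc_ex by (metis not_less)
  then show ?thesis by (simp add: word_contents_def pos_def)
qed (simp add: word_contents_def pos_def)

lemma pos_eq_0: "pos T i = 0 \<longleftrightarrow> i = Suc T"
  by (auto simp: pos_def)

text \<open>As \<open>inp\<close> is non-empty, the head starts on a given square; the free squares
  can all be declared to be without a head.\<close>

lemma start_run:
  assumes "j < num_tapes M" "length u \<le> m" "inp \<noteq> []"
  shows "cc (view (snd (run (inp @ u) 0) ! j) (pos T i)) \<in> set (start_cells T inp m j i)"
proof -
  show ?thesis
    using assms unfolding initial_view[OF assms(1)] word_contents_pos pos_eq_0
    by (auto simp: start_cells_def nth_or_def nth_append)
qed

lemma run_facts:
  "fst (run z t) \<le> num_states M" "length (snd (run z t)) = num_tapes M"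
  "j < num_tapes M \<Longrightarrow> fst (snd (run z t) ! j) p < num_symbols M"
  "j < num_tapes M \<Longrightarrow> \<bar>snd (snd (run z t) ! j)\<bar> \<le> int t"
  "j < num_tapes M \<Longrightarrow> p < - int t \<or> p > int t + int (length z) \<Longrightarrow> fst (snd (run z t) ! j) p = 0"
  using run_inv[of z t] nth_mem[of j "snd (run z t)"] by auto

lemma run_Suc: "run z (Suc t) = (next_state (fst (run z t), reads (snd (run z t))),
    map2 act (snd (run z t)) (acts (fst (run z t), reads (snd (run z t)))))"
  using step_eq[of "fst (run z t)" "snd (run z t)"] by (simp add: run_def)

lemma run_infos: "(fst (run z t), reads (snd (run z t))) \<in> infos"
  using run_facts(1,2) run_inv[of z t] by (auto simp: in_infos reads_def)

lemma border_view:
  assumes "t \<le> T" "j < num_tapes M" "W \<ge> 2 * T + length z + 3" "i = 0 \<or> Suc i = W"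
  shows "view (snd (run z t) ! j) (pos T i) = (0, False)"
proof -
  have "pos T i < - int t \<or> pos T i > int t + int (length z)" using assms by (auto simp: pos_def)
  with run_facts(4)[OF assms(2), of z t] run_facts(5)[OF assms(2), of "pos T i" t z] show ?thesis
    by (auto simp: view_def)
qed

lemma view_Suc:
  assumes "j < num_tapes M"
  shows "view (snd (run z (Suc t)) ! j) (pos T (Suc i)) =
    upd (acts (fst (run z t), reads (snd (run z t))) ! j) (view (snd (run z t) ! j) (pos T i))
      (view (snd (run z t) ! j) (pos T (Suc i))) (view (snd (run z t) ! j) (pos T (Suc (Suc i))))"
proof -
  have "snd (run z (Suc t)) ! j = act (snd (run z t) ! j) (acts (fst (run z t), reads (snd (run z t))) ! j)"
    using assms run_facts(2)[of z t] acts_valid(2)[OF run_infos[of z t]] by (simp add: run_Suc)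
  moreover have "pos T (Suc i) - 1 = pos T i" "pos T (Suc i) + 1 = pos T (Suc (Suc i))"
      by (simp_all add: pos_def)
  ultimately show ?thesis by (simp add: view_act)
qed

lemma run_rules:
  assumes T: "T \<ge> 1" and W: "W = 2 * T + length inp + m + 3" and u: "length u \<le> m"
    and inp: "inp \<noteq> []" and acc: "accepts (inp @ u) T"
  shows "tableau_rules M T W inp m (\<lambda>t. (fst (run (inp @ u) t), reads (snd (run (inp @ u) t))))
    (\<lambda>t j i. view (snd (run (inp @ u) t) ! j) (pos T i))"
proof -
  let ?z = "inp @ u"
  let ?I = "\<lambda>t. (fst (run ?z t), reads (snd (run ?z t)))"
  note inv = run_facts[where z = ?z]
  have "snd (run ?z T) \<noteq> []" using inv(2)[of T] num by auto
  then have last: "fst (snd (run ?z T) ! 0) = word_contents [True]"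
    using acc by (simp add: accepts_def hd_conv_nth)
  have free: "C' = (0, False) \<longrightarrow> D' \<notin> {(1, False), (2, False)}"
    if "i < m - 1" "C' = view (snd (run ?z 0) ! 0) (pos T (Suc T + length inp + i))"
      "D' = view (snd (run ?z 0) ! 0) (pos T (Suc T + length inp + Suc i))" for i C' D'
  proof -
    have "pos T (Suc T + length inp + i) = int (length inp + i)"
      "pos T (Suc T + length inp + Suc i) = int (length inp + Suc i)" by (simp_all add: pos_def)
    then show ?thesis using that(2,3) num
      by (auto simp: initial_view word_contents_def split: if_splits simp flip: of_nat_add of_nat_Suc)
  qed
  have rd: "reads (snd (run ?z t)) ! j = fst (view (snd (run ?z t) ! j) (pos T i))"
    if "j < num_tapes M" "snd (view (snd (run ?z t) ! j) (pos T i))" for t j i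
    using that inv(2)[of t] by (simp add: view_def nth_reads)
  have cell: "view (snd (run ?z t) ! j) p \<in> cells" if "j < num_tapes M" for t j p
    using inv(3)[OF that] by (simp add: view_def in_cells)
  define I where "I = (\<lambda>t. (fst (run ?z t), reads (snd (run ?z t))))"
  define C where "C = (\<lambda>t j i. view (snd (run ?z t) ! j) (pos T i))"
  have "tableau_rules M T W inp m I C"
  proof unfold_locales
    show "I t \<in> infos" for t using run_infos by (simp add: I_def)
    show "fst (I 0) = 0" by (simp add: I_def run_def initial_def)
    show "fst (I T) = num_states M" using acc by (simp add: I_def accepts_def)
    show "C t j i \<in> cells" if "j < num_tapes M" for t j i using cell[OF that] by (simp add: C_def)
    show "C t j i = (0, False)" if "t \<le> T" "j < num_tapes M" "i < W" "i = 0 \<or> Suc i = W" for t j i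
      unfolding C_def using border_view[OF that(1,2) _ that(4), of ?z] W u by simp
    show "cc (C 0 j i) \<in> set (start_cells T inp m j i)" if "j < num_tapes M" for j i
      unfolding C_def by (rule start_run[OF that u inp])
    show "fst (C T 0 i) = (if i = Suc T then 2 else 0)" for i
      by (simp add: C_def view_def last word_contents_def pos_def)
    show "snd (I t) ! j = fst (C t j i)" if "j < num_tapes M" "snd (C t j i)" for t j i
      using rd[OF that(1), of t i] that(2) by (simp only: C_def I_def snd_conv)
    show "fst (I (Suc t)) = next_state (I t)" for t by (simp add: I_def run_Suc)
    show "C (Suc t) j (Suc i) = upd (acts (I t) ! j) (C t j i) (C t j (Suc i)) (C t j (Suc (Suc i)))"
      if "j < num_tapes M" for t j i
      unfolding C_def I_def by (rule view_Suc[OF that])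
    show "C 0 0 (Suc T + length inp + Suc i) \<notin> {(1, False), (2, False)}"
      if "i < m - 1" "C 0 0 (Suc T + length inp + i) = (0, False)" for i
      unfolding C_def by (rule free[OF that(1) refl refl, THEN mp, OF that(2)[unfolded C_def]])
  qed
  then show ?thesis unfolding I_def C_def .
qed

text \<open>By \<open>blank_tail\<close> a blank among the free squares is followed by blanks only,
  so the bits in front of the first blank form the certificate \<open>u\<close> and determine the
  start row completely.\<close>

lemma start_input:
  assumes r: "tableau_rules M T W inp m I C" and W: "W = 2 * T + length inp + m + 3" and inp: "inp \<noteq> []"
  obtains u where "length u \<le> m"
    "\<And>j i. j < num_tapes M \<Longrightarrow> i < W \<Longrightarrow> C 0 j i = view (snd (run (inp @ u) 0) ! j) (pos T i)"
proof -
  define b where "b i = C 0 0 (Suc T + length inp + i)" for i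
  have b: "b i = (0, False) \<or> b i = (1, False) \<or> b i = (2, False)" if "i < m" for i
    using tableau_rules.start[OF r, of 0 "Suc T + length inp + i"] that num W
    by (auto simp: b_def start_cells_def)
  have mono: "b (Suc i) = (0, False)" if "Suc i < m" "b i = (0, False)" for i
    using tableau_rules.blank_tail[OF r, of i] b[of "Suc i"] that by (auto simp: b_def)
  \<comment> \<open>The alternative \<open>i = m\<close> covers the case that no free square is
    blank.\<close>
  define l where "l = (LEAST i. i = m \<or> b i = (0, False))"
  have lm: "l \<le> m" unfolding l_def by (rule Least_le) simp
  have below: "b i \<noteq> (0, False)" if "i < l" for i using not_less_Least[OF that[unfolded l_def]] by simp
  have above: "b i = (0, False)" if "l \<le> i" "i < m" for i
    using that
  proof (induction i rule: dec_induct)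
    case base
    have "l = m \<or> b l = (0, False)" unfolding l_def by (rule LeastI[of _ m]) simp
    then show ?case using base by simp
  next
    case (step i)
    then show ?case using mono[of i] by simp
  qed
  define u where "u = map (\<lambda>i. fst (b i) = 2) [0..<l]"
  have "C 0 j i = view (snd (run (inp @ u) 0) ! j) (pos T i)" if j: "j < num_tapes M" and i: "i < W" for j i
  proof (cases "i = 0 \<or> Suc i = W")
    case True
    then have "C 0 j i = (0, False)" using tableau_rules.border[OF r le0 j i] by simp
    moreover have "view (snd (run (inp @ u) 0) ! j) (pos T i) = (0, False)"
      by (rule border_view[OF le0 j _ True]) (use W lm in \<open>simp add: u_def\<close>)
    ultimately show ?thesis by simp
  next
    case False
    then have st: "cc (C 0 j i) \<in> set (start_cells T inp m j i)" using tableau_rules.start[OF r j i] by simp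
    show ?thesis
    proof (cases "j = 0 \<and> length inp \<le> i - Suc T \<and> i - Suc T < length inp + m")
      case True
      then obtain k where k: "i - Suc T = length inp + k" "k < m" using le_Suc_ex
          by (metis nat_add_left_cancel_less)
      then have ik: "i = Suc T + length inp + k" using inp by (cases inp) auto
      have "C 0 j i = b k" using True ik by (simp add: b_def)
      moreover have "view (snd (run (inp @ u) 0) ! j) (pos T i) =
          (if k < l then (if fst (b k) = 2 then 2 else 1) else 0, False)"
        using True k(1) inp unfolding initial_view[OF j] word_contents_pos pos_eq_0 ik
        by (auto simp: u_def nth_append)
      ultimately show ?thesis using b[OF k(2)] below[of k] above[of k] k(2) by auto
    next
      case False
      then show ?thesis using st inp lm unfolding initial_view[OF j] word_contents_pos pos_eq_0
        by (auto simp: start_cells_def nth_or_def nth_append u_def split: if_splits)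
    qed
  qed
  moreover have "length u \<le> m" using lm by (simp add: u_def)
  ultimately show ?thesis using that by blast
qed

text \<open>By induction on the rows the tableau agrees with the run: the scanned symbols recorded
  in \<open>I t\<close> are fixed by the squares carrying heads, and they fix the actions and thus
  the next row. The border squares, to which \<open>cell_Suc\<close> does not apply, are blank on
  both sides.\<close>

lemma rules_run:
  assumes r: "tableau_rules M T W inp m I C" and W: "W = 2 * T + length inp + m + 3" and inp: "inp \<noteq> []"
  shows "\<exists>u. length u \<le> m \<and> accepts (inp @ u) T"
proof -
  obtain u where u: "length u \<le> m"
    and start: "\<And>j i. j < num_tapes M \<Longrightarrow> i < W \<Longrightarrow> C 0 j i = view (snd (run (inp @ u) 0) ! j) (pos T i)"
    using start_input[OF r W inp] by metis
  let ?z = "inp @ u"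
  have Wz: "W \<ge> 2 * T + length ?z + 3" using W u by simp
  have "fst (I t) = fst (run ?z t) \<and> (\<forall>j < num_tapes M. \<forall>i < W. C t j i = view (snd (run ?z t) ! j)
      (pos T i))"
    if "t \<le> T" for t
    using that
  proof (induction t)
    case 0
    have "fst (run ?z 0) = 0" by (simp add: run_def initial_def)
    then show ?case using start tableau_rules.info_first[OF r] by simp
  next
    case (Suc t)
    then have tT: "t < T" "t \<le> T" and IH: "fst (I t) = fst (run ?z t)"
      "\<And>j i. j < num_tapes M \<Longrightarrow> i < W \<Longrightarrow> C t j i = view (snd (run ?z t) ! j) (pos T i)" by auto
    \<comment> \<open>The scanned symbols are constrained only at squares carrying a head. In the
      run, the head of tape \<open>j\<close> is within distance \<open>t\<close> of position 0, so
      its square belongs to the tableau, where the induction hypothesis shows the head as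
      well.\<close>
    have "snd (I t) = reads (snd (run ?z t))"
    proof (rule nth_equalityI)
      show len: "length (snd (I t)) = length (reads (snd (run ?z t)))"
        using tableau_rules.info[OF r tT(2)] run_facts(2)[of ?z t] by (simp add: in_infos)
      fix j assume "j < length (snd (I t))"
      then have j: "j < num_tapes M" using len run_facts(2)[of ?z t] by simp
      define h where "h = snd (snd (run ?z t) ! j)"
      have h: "\<bar>h\<bar> \<le> int t" using run_facts(4)[OF j, of ?z t] by (simp add: h_def)
      define i where "i = nat (h + int (Suc T))"
      have i: "i < W" "pos T i = h" using h tT W by (auto simp: i_def pos_def)
      have C: "C t j i = (fst (snd (run ?z t) ! j) h, True)" using IH(2)[OF j i(1)] i(2)
          by (simp add: view_def h_def)
      then have "snd (I t) ! j = fst (snd (run ?z t) ! j) h" using tableau_rules.reading[OF r tT(2) j i(1)]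
          by simp
      then show "snd (I t) ! j = reads (snd (run ?z t)) ! j"
        using j run_facts(2)[of ?z t] by (simp add: nth_reads h_def)
    qed
    with IH(1) have I: "I t = (fst (run ?z t), reads (snd (run ?z t)))" by (cases "I t") simp
    have "C (Suc t) j i = view (snd (run ?z (Suc t)) ! j) (pos T i)" if j: "j < num_tapes M" and i: "i < W"
        for j i
    proof (cases "i = 0 \<or> Suc i = W")
      case True
      then show ?thesis using tableau_rules.border[OF r Suc.prems j i True] border_view[OF Suc.prems j Wz
          True] by simp
    next
      case False
      then obtain k where k: "i = Suc k" "k < W - 2" using i by (cases i) auto
      then have "k < W" "Suc k < W" "Suc (Suc k) < W" by auto
      then show ?thesis using tableau_rules.cell_Suc[OF r tT(1) j k(2)] view_Suc[OF j, of ?z t T k]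
          IH(2)[OF j] I k(1) by simp
    qed
    moreover have "fst (I (Suc t)) = fst (run ?z (Suc t))" using tableau_rules.state[OF r tT(1)] I
        by (simp add: run_Suc)
    ultimately show ?case by blast
  qed
  note last = this[OF le_refl]
  \<comment> \<open>The rule for the last row speaks about the inner squares only; beyond them the
    tape is blank because no head gets there.\<close>
  have "fst (snd (run ?z T) ! 0) p = word_contents [True] p" for p
  proof (cases "- int T \<le> p \<and> p \<le> int T + int (length ?z)")
    case True
    define i where "i = nat (p + int (Suc T))"
    have i: "i < W" "i \<noteq> 0" "Suc i \<noteq> W" "pos T i = p" using True Wz by (auto simp: i_def pos_def)
    have "fst (view (snd (run ?z T) ! 0) (pos T i)) = (if i = Suc T then 2 else 0)"
      using last tableau_rules.last[OF r i(1-3)] i(1) num by simp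
    then show ?thesis using i(4) by (auto simp: view_def word_contents_def pos_def)
  next
    case False
    then show ?thesis using run_facts(5)[of 0 p T ?z] num by (auto simp: word_contents_def)
  qed
  then have "fst (snd (run ?z T) ! 0) = word_contents [True]" by blast
  moreover have "snd (run ?z T) \<noteq> []" using run_facts(2)[of ?z T] num by auto
  ultimately have "accepts ?z T" using last tableau_rules.info_last[OF r]
      by (simp add: accepts_def hd_conv_nth)
  then show ?thesis using u by blast
qed

lemma csp_iff_accepts:
  assumes "T \<ge> 1" "W = 2 * T + length inp + m + 3" "inp \<noteq> []"
  shows "csp_instance K (var_list T W) (dmn T W inp m) (forbidden T W (length inp) m) \<in>
      ILP_CONSISTENCY_GUARDED \<longleftrightarrow>
    (\<exists>u. length u \<le> m \<and> accepts (inp @ u) T)"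
proof -
  have "csp_instance K (var_list T W) (dmn T W inp m) (forbidden T W (length inp) m) \<in>
      ILP_CONSISTENCY_GUARDED \<longleftrightarrow>
     (\<exists>A. (\<forall>v \<in> set (var_list T W). A v \<in> set (dmn T W inp m v)) \<and>
      (\<forall>f \<in> set (forbidden T W (length inp) m). \<exists>e \<in> set f. A (fst e) \<noteq> snd e))"
    by (rule csp_instance_iff)
      (use distinct_var_list length_var_list[of T W] dmn_less[OF assms(1)] forbidden_vars[OF _ assms(2)]
          assms(1)
       in \<open>auto intro: le_trans[rotated]\<close>)
  also have "\<dots> \<longleftrightarrow> (\<exists>I C. tableau_rules M T W inp m I C)" by (rule assignment_iff_rules[OF assms(1,2)])
  also have "\<dots> \<longleftrightarrow> (\<exists>u. length u \<le> m \<and> accepts (inp @ u) T)"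
    using rules_run[OF _ assms(2,3)] run_rules[OF assms(1,2) _ assms(3)] by blast
  finally show ?thesis .
qed

end


section \<open>The reduction is computable in polynomial time\<close>

lemma pt_product: "pt f \<Longrightarrow> pt g \<Longrightarrow> pt (\<lambda>x. List.product (f x) (g x))"
proof -
  assume fg: "pt f" "pt g"
  have "pt (\<lambda>x. concat (map (\<lambda>a. map (\<lambda>b. (a, b)) (g x)) (f x)))"
    by (intro pt_concat pt_map pt_pair pt_fst pt_snd pt_id pt_comp[OF _ fg(2)] fg(1))
  then show ?thesis by (simp add: product_concat_map)
qed

context tableau
begin

text \<open>Numbers being unary, the hypotheses on \<open>T\<close> and \<open>m\<close> already
  bound height and width of the tableau polynomially; the lists of variables and forbidden
  assignments are then nested maps over ranges with constant lists inside.\<close>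

lemma pt_tableau:
  assumes "pt T" "pt inp" "pt m" and pos: "\<And>x. T x \<ge> 1"
  shows "pt (\<lambda>x. csp_instance K (var_list (T x) (2 * T x + length (inp x) + m x + 3))
    (dmn (T x) (2 * T x + length (inp x) + m x + 3) (inp x) (m x))
    (forbidden (T x) (2 * T x + length (inp x) + m x + 3) (length (inp x)) (m x)))"
proof (rule pt_csp_instance)
  note c = pt_comp[OF _ assms(1)] pt_comp[OF _ assms(2)] pt_comp[OF _ assms(3)]
  define W where "W x = 2 * T x + length (inp x) + m x + 3" for x
  have W: "pt W" unfolding W_def by (intro pt_rules assms(1-3))
  note cW = pt_comp[OF _ W]
  show "pt (\<lambda>x. var_list (T x) (2 * T x + length (inp x) + m x + 3))"
    unfolding var_list_def by (intro pt_product pt_rules assms(1-3))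
  have "pt (\<lambda>z. dmn (T (fst z)) (W (fst z)) (inp (fst z)) (m (fst z)) (snd z))"
    unfolding dmn_def start_cells_def by (intro pt_rules c cW)
  then show "pt (\<lambda>z. dmn (T (fst z)) (2 * T (fst z) + length (inp (fst z)) + m (fst z) + 3) (inp (fst z))
      (m (fst z)) (snd z))"
    by (simp only: W_def)
  have "pt (\<lambda>x. forbid_read (T x) (W x))" unfolding forbid_read_def by (intro pt_rules c cW W assms(1-3))
  moreover have "pt (\<lambda>x. forbid_state (T x))" unfolding forbid_state_def by (intro pt_rules c assms(1-3))
  moreover have "pt (\<lambda>x. forbid_square (T x) (W x))" unfolding forbid_square_def
      by (intro pt_rules c cW W assms(1-3))
  moreover have "pt (\<lambda>x. forbid_tail (T x) (length (inp x)) (m x))" unfolding forbid_tail_def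
      by (intro pt_rules c assms(1-3))
  ultimately have "pt (\<lambda>x. forbidden (T x) (W x) (length (inp x)) (m x))"
    unfolding forbidden_def by (intro pt_append)
  then show "pt (\<lambda>x. forbidden (T x) (2 * T x + length (inp x) + m x + 3) (length (inp x)) (m x))"
    by (simp only: W_def)
  show "s < K" if "v \<in> set (var_list (T x) (2 * T x + length (inp x) + m x + 3))"
    "s \<in> set (dmn (T x) (2 * T x + length (inp x) + m x + 3) (inp x) (m x) v)" for x v s
    using dmn_less[OF pos[of x] that] .
  show "snd e < K" if "f \<in> set (forbidden (T x) (2 * T x + length (inp x) + m x + 3) (length (inp x))
      (m x))" "e \<in> set f" for x f e
    using forbidden_vars[OF that(1) refl] that(2) by blast
qed

end

text \<open>The verifier halts at some unknown time, whereas the tableau has a fixed height; a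
  halted configuration persists until the last row.\<close>

lemma halted_run:
  assumes "fst ((step M ^^ n) c) = num_states M" "n \<le> t"
  shows "(step M ^^ t) c = (step M ^^ n) c"
proof -
  have "(step M ^^ k) ((step M ^^ n) c) = (step M ^^ n) c" for k
  proof (induction k)
    case (Suc k)
    then show ?case using assms(1) by (cases "(step M ^^ n) c") simp
  qed simp
  moreover have "t = (t - n) + n" using assms(2) by simp
  ultimately show ?thesis by (metis comp_apply funpow_add)
qed

theorem NP_hard_ilp: "NP_hard ILP_CONSISTENCY_GUARDED"
  unfolding NP_hard_def
proof (intro allI impI)
  fix L assume "in_NP L"
  then obtain V p where V: "in_P V"
    and L: "\<And>w. w \<in> L \<longleftrightarrow> (\<exists>u. length u \<le> poly p (length w) \<and> enc_pair w u \<in> V)"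
    unfolding in_NP_def by blast
  obtain M q where M: "valid_machine M" and out: "\<And>z. outputs_within M z [z \<in> V] (poly q (length z))"
    using V unfolding in_P_def polytime_def by blast
  interpret tableau M by unfold_locales (rule M)
  \<comment> \<open>The part of \<open>enc_pair w u\<close> in front of \<open>u\<close>. The
    certificate follows it unencoded, so the free squares of the start row are just the bits of
    \<open>u\<close>, and the end mark makes \<open>inp w\<close> non-empty.\<close>
  define inp where "inp w = enc_list (map (\<lambda>b. [b]) w)" for w
  define m where "m w = poly p (length w)" for w :: "bool list"
  \<comment> \<open>The time bound at the longest input considered, which by monotonicity covers
    every shorter certificate; the successor ensures \<open>T w \<ge> 1\<close>.\<close>
  define T where "T w = Suc (poly q (length (inp w) + m w))" for w
  define W where "W w = 2 * T w + length (inp w) + m w + 3" for w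
  define f where "f w = csp_instance K (var_list (T w) (W w)) (dmn (T w) (W w) (inp w) (m w))
      (forbidden (T w) (W w) (length (inp w)) (m w))" for w
  have inp: "pt inp" unfolding inp_def by (intro pt_enc_list pt_map pt_Cons pt_snd pt_id pt_const)
  have m: "pt m" unfolding m_def by (intro pt_poly pt_length pt_id)
  have T: "pt T" unfolding T_def by (intro pt_Suc pt_poly pt_plus pt_length inp m)
  have "pt f" unfolding f_def W_def by (rule pt_tableau[OF T inp m]) (simp add: T_def)
  then have "polytime f" by (rule polytime_pt)
  moreover have "w \<in> L \<longleftrightarrow> f w \<in> ILP_CONSISTENCY_GUARDED" for w
  proof -
    have "accepts (inp w @ u) (T w) \<longleftrightarrow> enc_pair w u \<in> V" if u: "length u \<le> m w" for u
    proof -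
      define z where "z = inp w @ u"
      obtain n where n: "n \<le> poly q (length z)" "fst (run z n) = num_states M"
          "fst (hd (snd (run z n))) = word_contents [z \<in> V]"
        using out[of z] unfolding outputs_within_def run_def by (auto simp: case_prod_beta)
      have "poly q (length z) \<le> T w" unfolding T_def z_def using u
        by (intro le_SucI poly_nat_mono) simp
      then have "run z (T w) = run z n"
        using halted_run[where M = M and n = n and t = "T w"] n(1,2) by (simp add: run_def)
      moreover have "word_contents [b] = word_contents [True] \<longleftrightarrow> b" for b
        by (cases b) (auto simp: word_contents_def fun_eq_iff)
      ultimately have "accepts z (T w) \<longleftrightarrow> z \<in> V" using n by (simp add: accepts_def)
      then show ?thesis by (simp add: z_def inp_def enc_pair_def)
    qed
    moreover have "inp w \<noteq> []" by (cases w) (simp_all add: inp_def)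
    ultimately show ?thesis
      using csp_iff_accepts[of "T w" "W w" "inp w" "m w"] unfolding L f_def
      by (auto simp: T_def W_def m_def)
  qed
  ultimately show "polytime_reducible L ILP_CONSISTENCY_GUARDED"
    unfolding polytime_reducible_def by blast
qed

theorem theorem5:
  shows "NP_complete ILP_CONSISTENCY_GUARDED"
  unfolding NP_complete_def using in_NP_ilp NP_hard_ilp by blast

end
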